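(* Let $(E,w)$ be a row-finite weighted graph and $K$ a field. If the weighted Leavitt path algebra $L_K(E,w)$ is simple, or graded simple, or locally finite, or Noetherian, or Artinian, or von Neumann regular, or has finite Gelfand-Kirillov dimension, then $L_K(E,w)$ is isomorphic (as a $K$-algebra) to an unweighted Leavitt path algebra (that is, to $L_K(F)$ for some graph $F$).
   Context: A $K$-algebra is an associative (not necessarily commutative or unital) $K$-algebra. Ideal means two-sided ideal. Graphs. A (directed) graph is a quadruple $E=(E^0,E^1,s,r)$ where $E^0$ (vertices) and $E^1$ (edges) are sets and $s,r:E^1\to E^0$ are maps (source, range). $E$ is row-finite if $s^{-1}(v)$ is finite for every $v\in E^0$. All graphs (in particular $F$ in the claim) are assumed to be row-finite. A weighted graph is a pair $(E,w)$ with $E$ a graph and $w:E^1\to\{1,2,3,\dots\}$ a map; it is called row-finite if $E$ is. For $v\in E^0$ set $w(v):=\max\{w(e)\mid e\in s^{-1}(v)\}$, with $\max\emptyset=0$. Unweighted Leavitt path algebra. $L_K(E)$ is the $K$-algebra presented by generators $\{v,e,e^*\mid v\in E^0,e\in E^1\}$ and relations (i) $uv=\delta_{uv}u$ ($u,v\in E^0$); (ii) $s(e)e=e=er(e)$, $r(e)e^*=e^*=e^*s(e)$ ($e\in E^1$); (iii) $e^*f=\delta_{ef}r(e)$ ($v\in E^0$, $e,f\in s^{-1}(v)$); (iv) $\sum_{e\in s^{-1}(v)}ee^*=v$ ($v\in E^0$, $s^{-1}(v)\neq\emptyset$). Weighted Leavitt path algebra. $L_K(E,w)$ is the $K$-algebra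 presented by generators $\{v,e_i,e_i^*\mid v\in E^0,e\in E^1,1\le i\le w(e)\}$ and relations (i) $uv=\delta_{uv}u$ ($u,v\in E^0$); (ii) $s(e)e_i=e_i=e_ir(e)$, $r(e)e_i^*=e_i^*=e_i^*s(e)$ ($e\in E^1$, $1\le i\le w(e)$); (iii) $\sum_{1\le i\le w(v)}e_i^*f_i=\delta_{ef}r(e)$ ($v\in E^0$, $e,f\in s^{-1}(v)$); (iv) $\sum_{e\in s^{-1}(v)}e_ie_j^*=\delta_{ij}v$ ($v\in E^0$, $1\le i,j\le w(v)$). In (iii) and (iv), $e_i$ and $e_i^*$ are set to zero whenever $i>w(e)$. Grading. Let $n:=\sup\{w(e)\mid e\in E^1\}$. $L_K(E,w)$ is $\mathbb Z^n$-graded by $\deg(v)=0$, $\deg(e_i)=\epsilon_i$, $\deg(e_i^* )=-\epsilon_i$, where $\epsilon_i$ has $i$-th component $1$ and all other components $0$ (if the weights are unbounded, $\mathbb Z^n$ is read as the direct sum of countably many copies of $\mathbb Z$). "Graded simple" and "locally finite" refer to this grading: a $G$-graded algebra $A=\bigoplus_{g\in G}A_g$ is locally finite if $\dim_KA_g<\infty$ for every $g\in G$; graded simple means having no graded ideals other than $0$ and the whole algebra (for a nonzero algebra). Other notions. Noetherian and Artinian refer to chain conditions on left ideals (equivalently on right ideals, since $L_K(E,w)$ has an involution fixing $K$ and $E^0$ and exchanging $e_i$ and $e_i^*$). A ring $R$ is von Neumann regular if for every $a\in R$ there is $x\in R$ with $axa=a$. For a nonzero finitely generated $K$-algebra $A$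 with finite-dimensional generating subspace $V$, let $V^n$ be the span of all products of at most $n$ (and at least one) elements of $V$; then $\mathrm{GKdim}\,A:=\limsup_{n\to\infty}\log_n(\dim V^n)$ (independent of $V$). For a general $A$, $\mathrm{GKdim}\,A$ is the supremum of $\mathrm{GKdim}\,B$ over finitely generated subalgebras $B$ of $A$, and $\mathrm{GKdim}\,\{0\}:=0$. *)

theory Defs
  imports
    "Jordan_Normal_Form.VS_Connect"
    "Graph_Theory.Digraph"
    "HOL-Algebra.QuotRing"
    "HOL-Library.Poly_Mapping"
    "HOL-Library.Extended_Real"
begin

section \<open>Algebras over a field, not necessarily unital or commutative\<close>

text \<open>
  The field \<open>K\<close> is a type of class \<^class>\<open>field\<close>, seen as a ring record through
  \<^abbrev>\<open>class_ring\<close>. A \<open>K\<close>-algebra is carried by the record type of \<^locale>\<open>Module.module\<close>, which has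
  fields for the addition, the scalar action and the multiplication. The field \<^const>\<open>one\<close> of
  that record has no meaning here: it is set to \<^const>\<open>undefined\<close> and never used.
\<close>

definition algebra_iso :: "('k::field, 'a) module \<Rightarrow> ('k, 'b) module \<Rightarrow> bool" where
  "algebra_iso A B \<longleftrightarrow> (\<exists>\<phi> \<in> LinearCombinations.module_hom class_ring A B.
     bij_betw \<phi> (carrier A) (carrier B) \<and>
     (\<forall>x\<in>carrier A. \<forall>y\<in>carrier A. \<phi> (x \<otimes>\<^bsub>A\<^esub> y) = \<phi> x \<otimes>\<^bsub>B\<^esub> \<phi> y))"

abbreviation lin_subspace :: "('k::field, 'a) module \<Rightarrow> 'a set \<Rightarrow> bool" where
  "lin_subspace A V \<equiv> Module.submodule V class_ring A"

text \<open>
  Ideals are linear subspaces. For algebras with local units, such as all (weighted) Leavitt path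
  algebras, ideals of the underlying ring are automatically linear subspaces.
\<close>

definition left_ideal :: "('k::field, 'a) module \<Rightarrow> 'a set \<Rightarrow> bool" where
  "left_ideal A I \<longleftrightarrow> lin_subspace A I \<and> (\<forall>a\<in>carrier A. \<forall>x\<in>I. a \<otimes>\<^bsub>A\<^esub> x \<in> I)"

definition two_sided_ideal :: "('k::field, 'a) module \<Rightarrow> 'a set \<Rightarrow> bool" where
  "two_sided_ideal A I \<longleftrightarrow> lin_subspace A I \<and>
     (\<forall>a\<in>carrier A. \<forall>x\<in>I. a \<otimes>\<^bsub>A\<^esub> x \<in> I \<and> x \<otimes>\<^bsub>A\<^esub> a \<in> I)"

definition subalgebra :: "('k::field, 'a) module \<Rightarrow> 'a set \<Rightarrow> bool" where
  "subalgebra A B \<longleftrightarrow> lin_subspace A B \<and> (\<forall>x\<in>B. \<forall>y\<in>B. x \<otimes>\<^bsub>A\<^esub> y \<in> B)"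

definition ideal_generated :: "('k::field, 'a) module \<Rightarrow> 'a set \<Rightarrow> 'a set" where
  "ideal_generated A S = \<Inter>{I. two_sided_ideal A I \<and> S \<subseteq> I}"

definition subalgebra_generated :: "('k::field, 'a) module \<Rightarrow> 'a set \<Rightarrow> 'a set" where
  "subalgebra_generated A S = \<Inter>{B. subalgebra A B \<and> S \<subseteq> B}"

text \<open>Ring structure as in \<^const>\<open>FactRing\<close>, with the induced scalar action.\<close>

definition quotient_algebra :: "('k::field, 'a) module \<Rightarrow> 'a set \<Rightarrow> ('k, 'a set) module" where
  "quotient_algebra A I =
    \<lparr>carrier = a_rcosets\<^bsub>A\<^esub> I, mult = rcoset_mult A I, one = undefined, zero = I,
     add = set_add A, smult = (\<lambda>c X. \<Union>x\<in>X. I +>\<^bsub>A\<^esub> (c \<odot>\<^bsub>A\<^esub> x))\<rparr>"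


subsection \<open>Ring-theoretic properties\<close>

definition simple_algebra :: "('k::field, 'a) module \<Rightarrow> bool" where
  "simple_algebra A \<longleftrightarrow> carrier A \<noteq> {\<zero>\<^bsub>A\<^esub>} \<and>
     (\<forall>I. two_sided_ideal A I \<longrightarrow> I = {\<zero>\<^bsub>A\<^esub>} \<or> I = carrier A)"

definition noetherian_algebra :: "('k::field, 'a) module \<Rightarrow> bool" where
  "noetherian_algebra A \<longleftrightarrow> (\<forall>I :: nat \<Rightarrow> 'a set.
     (\<forall>n. left_ideal A (I n)) \<and> (\<forall>n. I n \<subseteq> I (Suc n)) \<longrightarrow> (\<exists>m. \<forall>n\<ge>m. I n = I m))"

definition artinian_algebra :: "('k::field, 'a) module \<Rightarrow> bool" where
  "artinian_algebra A \<longleftrightarrow> (\<forall>I :: nat \<Rightarrow> 'a set.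
     (\<forall>n. left_ideal A (I n)) \<and> (\<forall>n. I (Suc n) \<subseteq> I n) \<longrightarrow> (\<exists>m. \<forall>n\<ge>m. I n = I m))"

definition von_neumann_regular :: "('k::field, 'a) module \<Rightarrow> bool" where
  "von_neumann_regular A \<longleftrightarrow>
     (\<forall>a\<in>carrier A. \<exists>x\<in>carrier A. a \<otimes>\<^bsub>A\<^esub> x \<otimes>\<^bsub>A\<^esub> a = a)"


subsection \<open>Graded algebras\<close>

text \<open>
  A grading is given by the index set \<open>G\<close> (the grading group) and the family \<open>c\<close> of
  homogeneous components.
\<close>

definition graded_ideal ::
    "('k::field, 'a) module \<Rightarrow> 'g set \<Rightarrow> ('g \<Rightarrow> 'a set) \<Rightarrow> 'a set \<Rightarrow> bool" where
  "graded_ideal A G c I \<longleftrightarrow> two_sided_ideal A I \<and>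
     I = LinearCombinations.module.span class_ring A (\<Union>g\<in>G. I \<inter> c g)"

definition graded_simple :: "('k::field, 'a) module \<Rightarrow> 'g set \<Rightarrow> ('g \<Rightarrow> 'a set) \<Rightarrow> bool" where
  "graded_simple A G c \<longleftrightarrow> carrier A \<noteq> {\<zero>\<^bsub>A\<^esub>} \<and>
     (\<forall>I. graded_ideal A G c I \<longrightarrow> I = {\<zero>\<^bsub>A\<^esub>} \<or> I = carrier A)"

abbreviation fin_dim_subspace :: "('k::field, 'a) module \<Rightarrow> 'a set \<Rightarrow> bool" where
  "fin_dim_subspace A V \<equiv>
     lin_subspace A V \<and> vectorspace.fin_dim class_ring (A\<lparr>carrier := V\<rparr>)"

definition locally_finite :: "('k::field, 'a) module \<Rightarrow> 'g set \<Rightarrow> ('g \<Rightarrow> 'a set) \<Rightarrow> bool" where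
  "locally_finite A G c \<longleftrightarrow> (\<forall>g\<in>G. fin_dim_subspace A (c g))"


subsection \<open>Gelfand-Kirillov dimension\<close>

text \<open>Product of a nonempty list; the value at the empty list is irrelevant.\<close>

fun list_prod :: "('k::field, 'a) module \<Rightarrow> 'a list \<Rightarrow> 'a" where
  "list_prod A [] = undefined"
| "list_prod A [x] = x"
| "list_prod A (x # y # xs) = x \<otimes>\<^bsub>A\<^esub> list_prod A (y # xs)"

definition power_space :: "('k::field, 'a) module \<Rightarrow> 'a set \<Rightarrow> nat \<Rightarrow> 'a set" where
  "power_space A V n = LinearCombinations.module.span class_ring A
     {list_prod A xs | xs. set xs \<subseteq> V \<and> 1 \<le> length xs \<and> length xs \<le> n}"

definition gk_growth :: "('k::field, 'a) module \<Rightarrow> 'a set \<Rightarrow> ereal" where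
  "gk_growth A V = limsup (\<lambda>n. ereal (log (real n)
     (real (vectorspace.dim class_ring (A\<lparr>carrier := power_space A V n\<rparr>)))))"

definition generating_subspace :: "('k::field, 'a) module \<Rightarrow> 'a set \<Rightarrow> bool" where
  "generating_subspace A V \<longleftrightarrow> fin_dim_subspace A V \<and> subalgebra_generated A V = carrier A"

text \<open>
  For a finitely generated algebra. The growth does not depend on the finite-dimensional
  generating subspace, so the supremum is just the common value.
\<close>

definition gk_dim_fg :: "('k::field, 'a) module \<Rightarrow> ereal" where
  "gk_dim_fg A = (if carrier A = {\<zero>\<^bsub>A\<^esub>} then 0
     else (SUP V\<in>{V. generating_subspace A V}. gk_growth A V))"

definition gk_dim :: "('k::field, 'a) module \<Rightarrow> ereal" where
  "gk_dim A = (SUP B\<in>{B. subalgebra A B \<and> (\<exists>V. generating_subspace (A\<lparr>carrier := B\<rparr>) V)}.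
     gk_dim_fg (A\<lparr>carrier := B\<rparr>))"


section \<open>Presentations by generators and relations\<close>

text \<open>
  Words, i.e. the free monoid, written additively because \<^typ>\<open>'a \<Rightarrow>\<^sub>0 'b\<close> is the monoid
  algebra of an additive monoid \<^typ>\<open>'a\<close>.
\<close>

datatype 'x fmon = FMon (letters: "'x list")

instantiation fmon :: (type) monoid_add
begin

definition zero_fmon :: "'x fmon" where
  "zero_fmon = FMon []"

definition plus_fmon :: "'x fmon \<Rightarrow> 'x fmon \<Rightarrow> 'x fmon" where
  "plus_fmon u v = FMon (letters u @ letters v)"

instance
  by standard (simp_all add: zero_fmon_def plus_fmon_def)

end

text \<open>
  The free non-unital algebra on \<open>X\<close>: linear combinations of nonempty words over \<open>X\<close>, inside the
  free unital algebra. The element \<^term>\<open>Poly_Mapping.single 0 c\<close> is \<open>c\<close> times the empty word.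
\<close>

definition free_algebra :: "'x set \<Rightarrow> ('k::field, 'x fmon \<Rightarrow>\<^sub>0 'k) module" where
  "free_algebra X =
    \<lparr>carrier = {p. \<forall>u\<in>Poly_Mapping.keys p. letters u \<noteq> [] \<and> set (letters u) \<subseteq> X},
     mult = (*), one = undefined, zero = 0, add = (+),
     smult = (\<lambda>c p. Poly_Mapping.single 0 c * p)\<rparr>"

definition gen :: "'x \<Rightarrow> 'x fmon \<Rightarrow>\<^sub>0 'k::field" where
  "gen x = Poly_Mapping.single (FMon [x]) 1"

definition presented_algebra ::
    "'x set \<Rightarrow> ('x fmon \<Rightarrow>\<^sub>0 'k::field) set \<Rightarrow> ('k, ('x fmon \<Rightarrow>\<^sub>0 'k) set) module" where
  "presented_algebra X R = quotient_algebra (free_algebra X) (ideal_generated (free_algebra X) R)"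


section \<open>Graphs\<close>

text \<open>
  A directed graph is a \<^locale>\<open>wf_digraph\<close>, possibly infinite, with source map \<^const>\<open>tail\<close> and
  range map \<^const>\<open>head\<close>; the edges emitted by \<open>v\<close> are \<^term>\<open>out_arcs E v\<close>.
\<close>

definition row_finite :: "('v, 'e) pre_digraph \<Rightarrow> bool" where
  "row_finite E \<longleftrightarrow> (\<forall>v\<in>verts E. finite (out_arcs E v))"

definition weighted_digraph :: "('v, 'e) pre_digraph \<Rightarrow> ('e \<Rightarrow> nat) \<Rightarrow> bool" where
  "weighted_digraph E w \<longleftrightarrow> wf_digraph E \<and> (\<forall>e\<in>arcs E. 1 \<le> w e)"

definition vertex_weight :: "('v, 'e) pre_digraph \<Rightarrow> ('e \<Rightarrow> nat) \<Rightarrow> 'v \<Rightarrow> nat" where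
  "vertex_weight E w v = Max (insert 0 (w ` out_arcs E v))"


section \<open>Leavitt path algebras\<close>

datatype ('v, 'e) leavitt_gen = LVertex 'v | LEdge 'e | LGhost 'e

definition leavitt_gens :: "('v, 'e) pre_digraph \<Rightarrow> ('v, 'e) leavitt_gen set" where
  "leavitt_gens E = LVertex ` verts E \<union> LEdge ` arcs E \<union> LGhost ` arcs E"

definition leavitt_rels ::
    "('v, 'e) pre_digraph \<Rightarrow> (('v, 'e) leavitt_gen fmon \<Rightarrow>\<^sub>0 'k::field) set" where
  "leavitt_rels E =
     {gen (LVertex u) * gen (LVertex v) - (if u = v then gen (LVertex u) else 0) | u v.
        u \<in> verts E \<and> v \<in> verts E} \<union>
     {gen (LVertex (tail E e)) * gen (LEdge e) - gen (LEdge e) | e. e \<in> arcs E} \<union>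
     {gen (LEdge e) * gen (LVertex (head E e)) - gen (LEdge e) | e. e \<in> arcs E} \<union>
     {gen (LVertex (head E e)) * gen (LGhost e) - gen (LGhost e) | e. e \<in> arcs E} \<union>
     {gen (LGhost e) * gen (LVertex (tail E e)) - gen (LGhost e) | e. e \<in> arcs E} \<union>
     {gen (LGhost e) * gen (LEdge f) - (if e = f then gen (LVertex (head E e)) else 0) | v e f.
        v \<in> verts E \<and> e \<in> out_arcs E v \<and> f \<in> out_arcs E v} \<union>
     {(\<Sum>e\<in>out_arcs E v. gen (LEdge e) * gen (LGhost e)) - gen (LVertex v) | v.
        v \<in> verts E \<and> out_arcs E v \<noteq> {}}"

definition leavitt_algebra ::
    "('v, 'e) pre_digraph \<Rightarrow> ('k::field, (('v, 'e) leavitt_gen fmon \<Rightarrow>\<^sub>0 'k) set) module" where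
  "leavitt_algebra E = presented_algebra (leavitt_gens E) (leavitt_rels E)"


section \<open>Weighted Leavitt path algebras\<close>

datatype ('v, 'e) wleavitt_gen = WVertex 'v | WEdge 'e nat | WGhost 'e nat

definition wleavitt_gens ::
    "('v, 'e) pre_digraph \<Rightarrow> ('e \<Rightarrow> nat) \<Rightarrow> ('v, 'e) wleavitt_gen set" where
  "wleavitt_gens E w = WVertex ` verts E \<union>
     {WEdge e i | e i. e \<in> arcs E \<and> 1 \<le> i \<and> i \<le> w e} \<union>
     {WGhost e i | e i. e \<in> arcs E \<and> 1 \<le> i \<and> i \<le> w e}"

definition wedge ::
    "('e \<Rightarrow> nat) \<Rightarrow> 'e \<Rightarrow> nat \<Rightarrow> ('v, 'e) wleavitt_gen fmon \<Rightarrow>\<^sub>0 'k::field" where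
  "wedge w e i = (if i \<le> w e then gen (WEdge e i) else 0)"

definition wghost ::
    "('e \<Rightarrow> nat) \<Rightarrow> 'e \<Rightarrow> nat \<Rightarrow> ('v, 'e) wleavitt_gen fmon \<Rightarrow>\<^sub>0 'k::field" where
  "wghost w e i = (if i \<le> w e then gen (WGhost e i) else 0)"

definition wleavitt_rels ::
    "('v, 'e) pre_digraph \<Rightarrow> ('e \<Rightarrow> nat) \<Rightarrow> (('v, 'e) wleavitt_gen fmon \<Rightarrow>\<^sub>0 'k::field) set" where
  "wleavitt_rels E w =
     {gen (WVertex u) * gen (WVertex v) - (if u = v then gen (WVertex u) else 0) | u v.
        u \<in> verts E \<and> v \<in> verts E} \<union>
     {gen (WVertex (tail E e)) * gen (WEdge e i) - gen (WEdge e i) | e i.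
        e \<in> arcs E \<and> 1 \<le> i \<and> i \<le> w e} \<union>
     {gen (WEdge e i) * gen (WVertex (head E e)) - gen (WEdge e i) | e i.
        e \<in> arcs E \<and> 1 \<le> i \<and> i \<le> w e} \<union>
     {gen (WVertex (head E e)) * gen (WGhost e i) - gen (WGhost e i) | e i.
        e \<in> arcs E \<and> 1 \<le> i \<and> i \<le> w e} \<union>
     {gen (WGhost e i) * gen (WVertex (tail E e)) - gen (WGhost e i) | e i.
        e \<in> arcs E \<and> 1 \<le> i \<and> i \<le> w e} \<union>
     {(\<Sum>i = 1..vertex_weight E w v. wghost w e i * wedge w f i)
          - (if e = f then gen (WVertex (head E e)) else 0) | v e f.
        v \<in> verts E \<and> e \<in> out_arcs E v \<and> f \<in> out_arcs E v} \<union>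
     {(\<Sum>e\<in>out_arcs E v. wedge w e i * wghost w e j)
          - (if i = j then gen (WVertex v) else 0) | v i j.
        v \<in> verts E \<and> i \<in> {1..vertex_weight E w v} \<and> j \<in> {1..vertex_weight E w v}}"

definition wleavitt_algebra ::
    "('v, 'e) pre_digraph \<Rightarrow> ('e \<Rightarrow> nat) \<Rightarrow>
     ('k::field, (('v, 'e) wleavitt_gen fmon \<Rightarrow>\<^sub>0 'k) set) module" where
  "wleavitt_algebra E w = presented_algebra (wleavitt_gens E w) (wleavitt_rels E w)"


subsection \<open>The standard grading\<close>

text \<open>
  The grading group is \<open>\<int>\<^sup>n\<close> where \<open>n\<close> is the supremum of the weights, or the direct sum of
  countably many copies of \<open>\<int>\<close> if the weights are unbounded.
\<close>

definition weight_lattice :: "('v, 'e) pre_digraph \<Rightarrow> ('e \<Rightarrow> nat) \<Rightarrow> (nat \<Rightarrow>\<^sub>0 int) set" where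
  "weight_lattice E w =
     {g. Poly_Mapping.keys g \<subseteq> {i. 1 \<le> i \<and> (\<exists>e\<in>arcs E. i \<le> w e)}}"

fun gen_degree :: "('v, 'e) wleavitt_gen \<Rightarrow> nat \<Rightarrow>\<^sub>0 int" where
  "gen_degree (WVertex v) = 0"
| "gen_degree (WEdge e i) = Poly_Mapping.single i 1"
| "gen_degree (WGhost e i) = - Poly_Mapping.single i 1"

definition word_degree :: "('v, 'e) wleavitt_gen fmon \<Rightarrow> nat \<Rightarrow>\<^sub>0 int" where
  "word_degree u = sum_list (map gen_degree (letters u))"

text \<open>The homogeneous component of degree \<open>g\<close>: the image of the combinations of words of degree \<open>g\<close>.\<close>

definition wleavitt_component ::
    "('v, 'e) pre_digraph \<Rightarrow> ('e \<Rightarrow> nat) \<Rightarrow> (nat \<Rightarrow>\<^sub>0 int) \<Rightarrow>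
     (('v, 'e) wleavitt_gen fmon \<Rightarrow>\<^sub>0 'k::field) set set" where
  "wleavitt_component E w g =
     {ideal_generated (free_algebra (wleavitt_gens E w)) (wleavitt_rels E w)
        +>\<^bsub>free_algebra (wleavitt_gens E w)\<^esub> p | p.
      p \<in> carrier (free_algebra (wleavitt_gens E w)) \<and>
      (\<forall>u\<in>Poly_Mapping.keys p. word_degree u = g)}"


section \<open>Labels for the vertices and edges of the unweighted graph\<close>

text \<open>
  The vertices and edges of \<open>F\<close> are linearly independent in \<open>L\<^sub>K(F)\<close>, and \<open>L\<^sub>K(E,w)\<close> is spanned by
  the words in its generators. Hence if \<open>L\<^sub>K(F)\<close> is isomorphic to \<open>L\<^sub>K(E,w)\<close>, then \<open>F\<close> has at most
  as many vertices and edges as the following type has elements, so it is no loss of generality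
  to label them by this type.
\<close>

type_synonym ('v, 'e) label = "('v + 'e) \<times> nat"

end

theory Submission
  imports Defs "HOL-Real_Asymp.Real_Asymp"
begin

text \<open>
  Call an edge heavy if its weight is at least 2, and let \<open>R\<close> consist of the heavy edges and of all edges
  emitted by vertices that can be reached from the range of a heavy edge.

  Suppose that no vertex emits two heavy edges, that a vertex reachable from the range of a heavy
  edge emits at most one edge, and that distinct edges in \<open>R\<close> have distinct ranges. If \<open>e \<in> R\<close> is the
  only edge at its source, the relations for the \<open>e\<^sub>i\<close> say that the \<open>e\<^sub>i\<^sup>*\<close> are the edges emitted by
  \<open>r(e)\<close> in an unweighted Leavitt path algebra. Hence each \<open>e \<in> R\<close> is replaced by \<open>w(e)\<close> edges in
  the opposite direction. If the source \<open>v\<close> of \<open>e\<close> emits further edges, then \<open>v\<close> is first split into the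
  vertices \<open>e\<^sub>1e\<^sub>1\<^sup>*\<close> and \<open>v - e\<^sub>1e\<^sub>1\<^sup>*\<close>.

  If the condition fails, choose a special edge of maximal weight at every vertex. The words without
  factors \<open>\<alpha>\<^sub>i\<alpha>\<^sub>j\<^sup>*\<close> with \<open>\<alpha>\<close> special and \<open>e\<^sub>1\<^sup>*f\<^sub>1\<close> form a basis of the algebra \<open>L\<close>. Among them are two distinct
  closed words \<open>p\<close> and \<open>q\<close> of the same length that start with an edge and end with a ghost edge of
  index 2, where \<open>p\<close> has degree 0. Since these outer letters are not involved in any rewriting, \<open>p\<close> and \<open>q\<close>
  generate a free algebra, so \<open>L\<close> has exponential growth; the powers of \<open>p\<close> are independent elements of
  degree 0; the ideal generated by \<open>p\<close> is spanned by words containing \<open>p\<close>; \<open>p\<close> is not in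
  \<open>p L p\<close>; the left ideals generated by the words \<open>p q\<^sup>k\<close> form a direct sum, and those generated by the
  powers of \<open>p\<close> decrease strictly.
\<close>

section \<open>The free algebra\<close>

text \<open>Why the condition has this form: reversing e gives r(e) the relation that the sum of all
  e_i^* e_i equals r(e), and an unweighted graph allows only one relation of this kind per vertex.
  An edge that left r(e) in its old direction, or a second reversed edge ending there, would call
  for another one. So the edge emitted by r(e) has to be reversed as well, and so on along the path,
  it can have no companions, and ranges must be distinct. At the source of a heavy edge e the
  situation is milder: its companions f have weight 1 and enter only the relation with i = j = 1, in
  which e_1 e_1^* and all f_1 f_1^* add up to v. So it is enough to split off e_1 e_1^* and to leave
  the f as they are. For the converse, independence of the normal words is not drawn from a general
  confluence theorem. The overlaps of the two kinds of redexes are resolved while checking that the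
  relations hold in a module with the normal words as basis.\<close>

lemma poly_mapping_sum_keys:
  fixes f :: "'a \<Rightarrow>\<^sub>0 'k::comm_monoid_add"
  shows "f = (\<Sum>u\<in>Poly_Mapping.keys f. Poly_Mapping.single u (Poly_Mapping.lookup f u))"
  by (rule poly_mapping_eqI)
     (auto simp: lookup_sum lookup_single when_def in_keys_iff)

lemma poly_mapping_keys_induct [case_names zero add]:
  fixes f :: "'a \<Rightarrow>\<^sub>0 'k::comm_monoid_add"
  assumes zero: "P 0"
    and add: "\<And>q u c. u \<in> Poly_Mapping.keys f \<Longrightarrow> P q \<Longrightarrow> P (Poly_Mapping.single u c + q)"
  shows "P f"
proof -
  have "P (\<Sum>u\<in>U. Poly_Mapping.single u (Poly_Mapping.lookup f u))"
    if "finite U" "U \<subseteq> Poly_Mapping.keys f" for U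
    using that by (induction U rule: finite_induct) (auto intro: zero add)
  from this[of "Poly_Mapping.keys f"] show ?thesis
    using poly_mapping_sum_keys[of f] by simp
qed

definition scal :: "'k::field \<Rightarrow> ('x fmon \<Rightarrow>\<^sub>0 'k) \<Rightarrow> 'x fmon \<Rightarrow>\<^sub>0 'k" where
  "scal c p = Poly_Mapping.single 0 c * p"

lemma lookup_scal [simp]: "Poly_Mapping.lookup (scal c p) u = c * Poly_Mapping.lookup p u"
  unfolding scal_def mult_map_scale_conv_mult[symmetric]
  by (simp add: Poly_Mapping.map.rep_eq when_def)

lemma keys_scal: "Poly_Mapping.keys (scal c p) \<subseteq> Poly_Mapping.keys p"
  by (auto simp: in_keys_iff)

lemma scal_add: "scal c (p + q) = scal c p + scal c q"
  by (simp add: scal_def distrib_left)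

lemma scal_diff: "scal c (p - q) = scal c p - scal c q"
  by (simp add: scal_def right_diff_distrib)

lemma add_scal: "scal (c + d) p = scal c p + scal d p"
  by (simp add: scal_def single_add distrib_right)

lemma scal_scal: "scal c (scal d p) = scal (c * d) p"
  by (rule poly_mapping_eqI) simp

lemma scal_zero [simp]: "scal c 0 = 0" "scal 0 p = 0"
  by (simp_all add: scal_def)

lemma scal_one [simp]: "scal 1 p = p"
  by (rule poly_mapping_eqI) simp

lemma scal_minus_one: "scal (- 1) p = - p"
  by (rule poly_mapping_eqI) simp

lemma scal_single: "scal c (Poly_Mapping.single u d) = Poly_Mapping.single u (c * d)"
  by (simp add: scal_def mult_single)

lemma scal_mult_left: "scal c p * q = scal c (p * q)"
  by (simp add: scal_def mult.assoc)

text \<open>Multiples of the empty word are central, which on single words is commutativity of the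
  field.\<close>

lemma scal_mult_right: "p * scal c q = scal c (p * q)"
proof -
  have "p * Poly_Mapping.single 0 c = Poly_Mapping.single 0 c * p"
    by (induction p rule: poly_mapping_keys_induct)
       (simp_all add: distrib_left distrib_right mult_single mult.commute)
  then show ?thesis by (simp add: scal_def flip: mult.assoc)
qed

text \<open>Linear extension of a map given on a basis. Both the homomorphisms between free algebras
  and the operators on the module of normal words are obtained from it.\<close>

definition lext :: "('a \<Rightarrow> 'y fmon \<Rightarrow>\<^sub>0 'k::field) \<Rightarrow> ('a \<Rightarrow>\<^sub>0 'k) \<Rightarrow> 'y fmon \<Rightarrow>\<^sub>0 'k" where
  "lext \<phi> f = (\<Sum>u\<in>Poly_Mapping.keys f. scal (Poly_Mapping.lookup f u) (\<phi> u))"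

lemma lext_superset:
  "finite U \<Longrightarrow> Poly_Mapping.keys f \<subseteq> U \<Longrightarrow>
    lext \<phi> f = (\<Sum>u\<in>U. scal (Poly_Mapping.lookup f u) (\<phi> u))"
  unfolding lext_def by (intro sum.mono_neutral_left) (auto simp: in_keys_iff)

lemma lext_zero [simp]: "lext \<phi> 0 = 0"
  by (simp add: lext_def)

lemma lext_add: "lext \<phi> (f + g) = lext \<phi> f + lext \<phi> g"
proof -
  let ?U = "Poly_Mapping.keys f \<union> Poly_Mapping.keys g"
  have "Poly_Mapping.keys (f + g) \<subseteq> ?U" by (rule keys_add)
  then show ?thesis
    by (simp add: lext_superset[of ?U] lookup_add add_scal sum.distrib)
qed

lemma lext_single [simp]: "lext \<phi> (Poly_Mapping.single u c) = scal c (\<phi> u)"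
  by (simp add: lext_def)

lemma lext_uminus: "lext \<phi> (- f) = - lext \<phi> f"
  using lext_add[of \<phi> f "- f"] by (simp add: eq_neg_iff_add_eq_0 add.commute)

lemma lext_diff: "lext \<phi> (f - g) = lext \<phi> f - lext \<phi> g"
  using lext_add[of \<phi> f "- g"] by (simp add: lext_uminus)

lemma lext_sum: "lext \<phi> (\<Sum>i\<in>A. f i) = (\<Sum>i\<in>A. lext \<phi> (f i))"
  by (induction A rule: infinite_finite_induct) (simp_all add: lext_add)

lemma lext_scal: "lext \<phi> (scal c f) = scal c (lext \<phi> f)"
  by (induction f rule: poly_mapping_keys_induct)
     (simp_all add: scal_add lext_add scal_single scal_scal)

lemma lext_cong: "(\<And>u. u \<in> Poly_Mapping.keys f \<Longrightarrow> \<phi> u = \<psi> u) \<Longrightarrow> lext \<phi> f = lext \<psi> f"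
  by (simp add: lext_def)

definition word :: "'x list \<Rightarrow> 'x fmon \<Rightarrow>\<^sub>0 'k::field" where
  "word xs = Poly_Mapping.single (FMon xs) 1"

lemma FMon_zero: "FMon [] = 0"
  by (simp add: zero_fmon_def)

lemma single_eq_scal_word: "Poly_Mapping.single u c = scal c (word (letters u))"
  by (simp add: word_def scal_single)

lemma word_Nil [simp]: "word [] = 1"
  by (simp add: word_def FMon_zero)

lemma word_append: "word (xs @ ys) = word xs * word ys"
  by (simp add: word_def mult_single plus_fmon_def)

lemma word_single: "word [x] = gen x"
  by (simp add: word_def gen_def)

lemma word_Cons: "word (x # xs) = gen x * word xs"
  using word_append[of "[x]" xs] by (simp add: word_single)

lemma keys_word [simp]: "Poly_Mapping.keys (word xs :: _ \<Rightarrow>\<^sub>0 'k::field) = {FMon xs}"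
  by (simp add: word_def)

lemma lookup_word: "Poly_Mapping.lookup (word xs) u = (if u = FMon xs then 1 else 0)"
  by (simp add: word_def lookup_single when_def)

lemma word_neq_zero [simp]: "word xs \<noteq> (0 :: _ \<Rightarrow>\<^sub>0 'k::field)"
proof
  assume "word xs = (0 :: _ \<Rightarrow>\<^sub>0 'k)"
  then have "Poly_Mapping.keys (word xs :: _ \<Rightarrow>\<^sub>0 'k) = {}" by simp
  then show False by simp
qed

text \<open>The homomorphism given by the universal property of the free ring. It is unital, so the
  empty word goes to 1, although \<open>free_algebra\<close> has only nonempty words;
  \<open>free_hom_in_free\<close> leads back to the non-unital carriers.\<close>

definition free_hom :: "('x \<Rightarrow> 'y fmon \<Rightarrow>\<^sub>0 'k::field) \<Rightarrow> ('x fmon \<Rightarrow>\<^sub>0 'k) \<Rightarrow> 'y fmon \<Rightarrow>\<^sub>0 'k" where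
  "free_hom h = lext (\<lambda>u. prod_list (map h (letters u)))"

lemma free_hom_zero [simp]: "free_hom h 0 = 0"
  and free_hom_add: "free_hom h (f + g) = free_hom h f + free_hom h g"
  and free_hom_diff: "free_hom h (f - g) = free_hom h f - free_hom h g"
  and free_hom_sum: "free_hom h (\<Sum>i\<in>A. f' i) = (\<Sum>i\<in>A. free_hom h (f' i))"
  and free_hom_scal: "free_hom h (scal c f) = scal c (free_hom h f)"
  and free_hom_word: "free_hom h (word xs) = prod_list (map h xs)"
  by (simp_all add: free_hom_def lext_add lext_diff lext_sum lext_scal word_def)

lemma free_hom_gen [simp]: "free_hom h (gen x) = h x"
  using free_hom_word[of h "[x]"] by (simp add: word_single)

lemma free_hom_one [simp]: "free_hom h 1 = 1"
  using free_hom_word[of h "[]"] by simp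

text \<open>The induction step offers only words in the support of \<open>f\<close>, so a condition
  on the letters of \<open>f\<close>, such as membership in \<open>free_algebra X\<close>, is
  available there without being carried along.\<close>

lemma free_induct [case_names zero add]:
  fixes f :: "'x fmon \<Rightarrow>\<^sub>0 'k::field"
  assumes "P 0" "\<And>q xs c. FMon xs \<in> Poly_Mapping.keys f \<Longrightarrow> P q \<Longrightarrow> P (scal c (word xs) + q)"
  shows "P f"
proof (induction f rule: poly_mapping_keys_induct)
  case (add q u c)
  then show ?case using assms(2)[of "letters u" q c] by (simp add: single_eq_scal_word)
qed (fact assms(1))

lemma free_hom_mult: "free_hom h (f * g) = free_hom h f * free_hom h g"
proof (induction f rule: free_induct)
  case (add q xs c)
  have "free_hom h (word xs * g) = free_hom h (word xs) * free_hom h g"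
    by (induction g rule: free_induct)
       (simp_all add: distrib_left free_hom_add free_hom_scal free_hom_word scal_mult_right flip: word_append)
  then show ?case
    using add by (simp add: distrib_right free_hom_add free_hom_scal scal_mult_left)
qed simp

lemma free_hom_prod_list: "free_hom h (prod_list fs) = prod_list (map (free_hom h) fs)"
  by (induction fs) (simp_all add: free_hom_mult)

lemma free_hom_free_hom: "free_hom h (free_hom k f) = free_hom (\<lambda>x. free_hom h (k x)) f"
  by (induction f rule: free_induct)
     (simp_all add: free_hom_add free_hom_scal free_hom_word free_hom_prod_list o_def)

section \<open>The carrier, subspaces and ideals of the free non-unital algebra\<close>

definition unital_words :: "'x set \<Rightarrow> ('x fmon \<Rightarrow>\<^sub>0 'k::field) set" where
  "unital_words X = {p. \<forall>u\<in>Poly_Mapping.keys p. set (letters u) \<subseteq> X}"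

lemma free_carrier:
  "carrier (free_algebra X) = {p. \<forall>u\<in>Poly_Mapping.keys p. letters u \<noteq> [] \<and> set (letters u) \<subseteq> X}"
  by (simp add: free_algebra_def)

lemma free_sel [simp]:
  "x \<otimes>\<^bsub>free_algebra X\<^esub> y = x * y" "x \<oplus>\<^bsub>free_algebra X\<^esub> y = x + y" "\<zero>\<^bsub>free_algebra X\<^esub> = 0"
  "c \<odot>\<^bsub>free_algebra X\<^esub> x = scal c x"
  by (simp_all add: free_algebra_def scal_def)

lemma free_zero [simp]: "0 \<in> carrier (free_algebra X)"
  by (simp add: free_carrier)

lemma free_add: "p \<in> carrier (free_algebra X) \<Longrightarrow> q \<in> carrier (free_algebra X)
    \<Longrightarrow> p + q \<in> carrier (free_algebra X)"
  using keys_add[of p q] by (auto simp: free_carrier)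

lemma free_scal: "p \<in> carrier (free_algebra X) \<Longrightarrow> scal c p \<in> carrier (free_algebra X)"
  using keys_scal[of c p] by (auto simp: free_carrier)

lemma free_uminus: "p \<in> carrier (free_algebra X) \<Longrightarrow> - p \<in> carrier (free_algebra X)"
  using free_scal[of p X "- 1"] by (simp add: scal_minus_one)

lemma free_diff: "p \<in> carrier (free_algebra X) \<Longrightarrow> q \<in> carrier (free_algebra X)
    \<Longrightarrow> p - q \<in> carrier (free_algebra X)"
  using free_add[of p X "- q"] by (simp add: free_uminus)

lemma free_sum: "(\<And>i. i \<in> A \<Longrightarrow> f i \<in> carrier (free_algebra X)) \<Longrightarrow>
    (\<Sum>i\<in>A. f i) \<in> carrier (free_algebra X)"
  by (induction A rule: infinite_finite_induct) (auto intro: free_add)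

lemma free_mult:
  assumes "p \<in> carrier (free_algebra X)" "q \<in> carrier (free_algebra X)"
  shows "p * q \<in> carrier (free_algebra X)"
  using assms keys_mult[of p q] by (fastforce simp: free_carrier plus_fmon_def)

lemma free_word: "word xs \<in> carrier (free_algebra X) \<longleftrightarrow> xs \<noteq> [] \<and> set xs \<subseteq> X"
  by (simp add: free_carrier)

lemma free_gen: "gen x \<in> carrier (free_algebra X) \<longleftrightarrow> x \<in> X"
  using free_word[of "[x]" X] by (simp add: word_single)

lemma free_prod_list:
  "xs \<noteq> [] \<Longrightarrow> (\<And>x. x \<in> set xs \<Longrightarrow> x \<in> carrier (free_algebra X)) \<Longrightarrow>
    prod_list xs \<in> carrier (free_algebra X)"
proof (induction xs rule: list_nonempty_induct)
  case (cons x xs)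
  then show ?case by (auto intro!: free_mult)
qed simp

lemma free_hom_in_free:
  assumes "f \<in> carrier (free_algebra X)" "\<And>x. x \<in> X \<Longrightarrow> h x \<in> carrier (free_algebra Y)"
  shows "free_hom h f \<in> carrier (free_algebra Y)"
proof (induction f rule: free_induct)
  case (add q xs c)
  have "xs \<noteq> []" "set xs \<subseteq> X" using add(1) assms(1) by (fastforce simp: free_carrier)+
  then have "prod_list (map h xs) \<in> carrier (free_algebra Y)"
    using assms(2) by (intro free_prod_list) auto
  then show ?case
    using add by (auto simp: free_hom_add free_hom_scal free_hom_word intro!: free_add free_scal)
qed simp

lemma free_module: "Module.module class_ring (free_algebra X)"
proof (unfold Module.module_def, intro conjI)
  show "cring (class_ring :: 'k::field ring)"
    by (rule domain.axioms(1)[OF field.axioms(1)[OF class_field]])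
  show "abelian_group (free_algebra X)"
  proof (rule abelian_groupI)
    fix x assume "x \<in> carrier (free_algebra X)"
    then show "\<exists>y\<in>carrier (free_algebra X). y \<oplus>\<^bsub>free_algebra X\<^esub> x = \<zero>\<^bsub>free_algebra X\<^esub>"
      by (intro bexI[of _ "- x"]) (auto simp: free_uminus)
  qed (auto simp: free_add algebra_simps)
  show "module_axioms class_ring (free_algebra X)"
    by standard (auto simp: free_scal scal_add add_scal scal_scal)
qed

text \<open>Negatives are multiples by -1, so the subgroup condition reduces to closure under sums.
  The statement is general because it serves free algebras, their quotients and subspaces of the
  quotients.\<close>

lemma (in Module.module) lin_subspace_iff:
  "Module.submodule V R M \<longleftrightarrow> V \<subseteq> carrier M \<and> \<zero>\<^bsub>M\<^esub> \<in> V \<and> (\<forall>x\<in>V. \<forall>y\<in>V. x \<oplus>\<^bsub>M\<^esub> y \<in> V)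
     \<and> (\<forall>c\<in>carrier R. \<forall>x\<in>V. c \<odot>\<^bsub>M\<^esub> x \<in> V)"
proof
  assume s: "Module.submodule V R M"
  then show "V \<subseteq> carrier M \<and> \<zero>\<^bsub>M\<^esub> \<in> V \<and> (\<forall>x\<in>V. \<forall>y\<in>V. x \<oplus>\<^bsub>M\<^esub> y \<in> V)
     \<and> (\<forall>c\<in>carrier R. \<forall>x\<in>V. c \<odot>\<^bsub>M\<^esub> x \<in> V)"
    unfolding Module.submodule_def Module.submodule_axioms_def
    using subgroup.subset[of V "add_monoid M"] subgroup.one_closed[of V "add_monoid M"]
      subgroup.m_closed[of V "add_monoid M"] by auto
next
  assume a: "V \<subseteq> carrier M \<and> \<zero>\<^bsub>M\<^esub> \<in> V \<and> (\<forall>x\<in>V. \<forall>y\<in>V. x \<oplus>\<^bsub>M\<^esub> y \<in> V)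
     \<and> (\<forall>c\<in>carrier R. \<forall>x\<in>V. c \<odot>\<^bsub>M\<^esub> x \<in> V)"
  show "Module.submodule V R M"
  proof (rule submoduleI)
    fix x assume x: "x \<in> V"
    then have "\<ominus>\<^bsub>M\<^esub> x = (\<ominus>\<^bsub>R\<^esub> \<one>\<^bsub>R\<^esub>) \<odot>\<^bsub>M\<^esub> x" using a by (auto simp: smult_l_minus)
    then show "\<ominus>\<^bsub>M\<^esub> x \<in> V" using a x by auto
  qed (use a in auto)
qed

lemma free_subspace_iff:
  "lin_subspace (free_algebra X) V \<longleftrightarrow> V \<subseteq> carrier (free_algebra X) \<and> 0 \<in> V \<and>
     (\<forall>x\<in>V. \<forall>y\<in>V. x + y \<in> V) \<and> (\<forall>c. \<forall>x\<in>V. scal c x \<in> V)"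
  by (subst module.lin_subspace_iff[OF free_module]) simp

lemma free_ideal_iff:
  "two_sided_ideal (free_algebra X) V \<longleftrightarrow> V \<subseteq> carrier (free_algebra X) \<and> 0 \<in> V \<and>
     (\<forall>x\<in>V. \<forall>y\<in>V. x + y \<in> V) \<and> (\<forall>c. \<forall>x\<in>V. scal c x \<in> V) \<and>
     (\<forall>a\<in>carrier (free_algebra X). \<forall>x\<in>V. a * x \<in> V \<and> x * a \<in> V)"
  by (auto simp: two_sided_ideal_def free_subspace_iff)

section \<open>Presentations\<close>

locale presentation =
  fixes X :: "'x set" and R :: "('x fmon \<Rightarrow>\<^sub>0 'k::field) set"
  assumes rels: "R \<subseteq> carrier (free_algebra X)"
begin

abbreviation C :: "('x fmon \<Rightarrow>\<^sub>0 'k) set" where "C \<equiv> carrier (free_algebra X)"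
definition I where "I = ideal_generated (free_algebra X) R"
definition A where "A = presented_algebra X R"
definition proj where "proj f = I +>\<^bsub>free_algebra X\<^esub> f"

lemma ideal_I: "two_sided_ideal (free_algebra X) I"
proof -
  \<comment> \<open>The carrier is itself an ideal that contains \<open>R\<close>; this puts the
    intersection inside \<open>C\<close>.\<close>
  have top: "two_sided_ideal (free_algebra X) C"
    by (auto simp: free_ideal_iff free_add free_scal free_mult)
  show ?thesis
    unfolding free_ideal_iff I_def ideal_generated_def
    using rels top by (auto simp: free_ideal_iff)
qed

lemma R_sub_I: "R \<subseteq> I"
  by (auto simp: I_def ideal_generated_def)

lemma I_least: "two_sided_ideal (free_algebra X) V \<Longrightarrow> R \<subseteq> V \<Longrightarrow> I \<subseteq> V"
  by (auto simp: I_def ideal_generated_def)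

lemma I_C: "I \<subseteq> C" and I_zero: "0 \<in> I"
  and I_add: "x \<in> I \<Longrightarrow> y \<in> I \<Longrightarrow> x + y \<in> I"
  and I_scal: "x \<in> I \<Longrightarrow> scal c x \<in> I"
  and I_mult_left: "a \<in> C \<Longrightarrow> x \<in> I \<Longrightarrow> a * x \<in> I"
  and I_mult_right: "a \<in> C \<Longrightarrow> x \<in> I \<Longrightarrow> x * a \<in> I"
  using ideal_I by (auto simp: free_ideal_iff)

lemma I_uminus: "x \<in> I \<Longrightarrow> - x \<in> I"
  using I_scal[of x "- 1"] by (simp add: scal_minus_one)

lemma I_diff: "x \<in> I \<Longrightarrow> y \<in> I \<Longrightarrow> x - y \<in> I"
  using I_add[of x "- y"] by (simp add: I_uminus)

lemma proj_eq: "proj f = {y. y - f \<in> I}"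
proof -
  have "y \<in> proj f \<longleftrightarrow> y - f \<in> I" for y
    by (auto simp: proj_def a_r_coset_def r_coset_def intro!: bexI[of _ "y - f"])
  then show ?thesis by blast
qed

lemma proj_eq_iff: "proj f = proj g \<longleftrightarrow> f - g \<in> I"
proof
  assume "proj f = proj g"
  moreover have "f \<in> proj f" using I_zero by (simp add: proj_eq)
  ultimately have "f \<in> proj g" by simp
  then show "f - g \<in> I" by (simp add: proj_eq)
next
  assume a: "f - g \<in> I"
  have "y - f \<in> I \<longleftrightarrow> y - g \<in> I" for y
    using I_add[OF _ a, of "y - f"] I_diff[OF _ a, of "y - g"] by (auto simp: algebra_simps)
  then show "proj f = proj g" by (simp add: proj_eq)
qed

lemma proj_zero: "proj 0 = I"
  by (simp add: proj_eq)

lemma proj_sub: "f \<in> C \<Longrightarrow> proj f \<subseteq> C"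
  using I_C free_add by (fastforce simp: proj_eq)

lemma proj_self: "f \<in> proj f"
  by (simp add: proj_eq I_zero)

text \<open>Products and scalar multiples in the quotient are unions over all representatives. Such
  a union is a single coset once every representative yields the same one.\<close>

lemma proj_collapse: "S \<noteq> {} \<Longrightarrow> (\<And>y. y \<in> S \<Longrightarrow> F y = proj g) \<Longrightarrow> (\<Union>y\<in>S. F y) = proj g"
  by auto

lemma carrier_A: "carrier A = proj ` C"
  by (auto simp: A_def presented_algebra_def quotient_algebra_def A_RCOSETS_def RCOSETS_def
      proj_def I_def a_r_coset_def)

lemma A_zero: "\<zero>\<^bsub>A\<^esub> = proj 0"
  by (simp add: A_def presented_algebra_def quotient_algebra_def proj_zero) (simp add: I_def)

lemma A_add: "proj f \<oplus>\<^bsub>A\<^esub> proj g = proj (f + g)"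
proof -
  have "proj f \<oplus>\<^bsub>A\<^esub> proj g = {a + b | a b. a \<in> proj f \<and> b \<in> proj g}"
    by (auto simp: A_def presented_algebra_def quotient_algebra_def set_add_def set_mult_def)
  also have "\<dots> = proj (f + g)"
  proof -
    have "\<exists>a b. y = a + b \<and> a - f \<in> I \<and> b - g \<in> I" if "y - (f + g) \<in> I" for y
      using that by (intro exI[of _ "y - g"] exI[of _ g]) (auto simp: algebra_simps I_zero)
    moreover have "a + b - (f + g) \<in> I" if "a - f \<in> I" "b - g \<in> I" for a b
      using I_add[OF that] by (simp add: algebra_simps)
    ultimately show ?thesis by (auto simp: proj_eq)
  qed
  finally show ?thesis .
qed

lemma mult_cong:
  assumes "a - f \<in> I" "b - g \<in> I" "a \<in> C" "b \<in> C" "f \<in> C" "g \<in> C"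
  shows "a * b - f * g \<in> I"
proof -
  have "a * b - f * g = (a - f) * b + f * (b - g)" by (simp add: algebra_simps)
  then show ?thesis using assms by (simp add: I_add I_mult_left I_mult_right)
qed

lemma A_mult:
  assumes "f \<in> C" "g \<in> C"
  shows "proj f \<otimes>\<^bsub>A\<^esub> proj g = proj (f * g)"
proof -
  have "proj f \<otimes>\<^bsub>A\<^esub> proj g = (\<Union>a\<in>proj f. \<Union>b\<in>proj g. proj (a * b))"
    by (simp add: A_def presented_algebra_def quotient_algebra_def rcoset_mult_def proj_def I_def)
  also have "\<dots> = proj (f * g)"
  proof (intro proj_collapse)
    fix a b assume "a \<in> proj f" "b \<in> proj g"
    then show "proj (a * b) = proj (f * g)"
      using assms mult_cong proj_sub by (auto simp: proj_eq_iff) (auto simp: proj_eq subset_iff)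
  qed (use proj_self in blast)+
  finally show ?thesis .
qed

lemma A_smult: "c \<odot>\<^bsub>A\<^esub> proj f = proj (scal c f)"
proof -
  have "c \<odot>\<^bsub>A\<^esub> proj f = (\<Union>x\<in>proj f. proj (scal c x))"
    by (simp add: A_def presented_algebra_def quotient_algebra_def proj_def I_def)
  also have "\<dots> = proj (scal c f)"
  proof (intro proj_collapse)
    fix x assume "x \<in> proj f"
    then show "proj (scal c x) = proj (scal c f)"
      using I_scal[of "x - f" c] by (simp add: proj_eq_iff scal_diff) (simp add: proj_eq scal_diff)
  qed (use proj_self in blast)
  finally show ?thesis .
qed

lemma A_module: "Module.module class_ring A"
proof (unfold Module.module_def, intro conjI)
  show "cring (class_ring :: 'k::field ring)"
    by (rule domain.axioms(1)[OF field.axioms(1)[OF class_field]])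
  show "abelian_group A"
  proof (rule abelian_groupI)
    fix x assume "x \<in> carrier A"
    then obtain f where "f \<in> C" "x = proj f" by (auto simp: carrier_A)
    then show "\<exists>y\<in>carrier A. y \<oplus>\<^bsub>A\<^esub> x = \<zero>\<^bsub>A\<^esub>"
      by (intro bexI[of _ "proj (- f)"]) (auto simp: free_uminus carrier_A A_add A_zero)
  qed (auto simp: carrier_A A_add A_zero free_add algebra_simps)
  show "module_axioms class_ring A"
    by standard (auto simp: carrier_A A_add A_smult free_scal scal_add add_scal scal_scal)
qed

lemma A_subspace_iff:
  "lin_subspace A V \<longleftrightarrow> V \<subseteq> carrier A \<and> \<zero>\<^bsub>A\<^esub> \<in> V \<and> (\<forall>x\<in>V. \<forall>y\<in>V. x \<oplus>\<^bsub>A\<^esub> y \<in> V)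
     \<and> (\<forall>c. \<forall>x\<in>V. c \<odot>\<^bsub>A\<^esub> x \<in> V)"
  by (subst module.lin_subspace_iff[OF A_module]) simp

text \<open>A map out of the quotient evaluates \<open>T\<close> at a chosen representative in
  \<open>C\<close>; \<open>lift_proj\<close> removes the choice when \<open>T\<close> is constant on
  cosets.\<close>

definition lift :: "(('x fmon \<Rightarrow>\<^sub>0 'k) \<Rightarrow> 'z) \<Rightarrow> ('x fmon \<Rightarrow>\<^sub>0 'k) set \<Rightarrow> 'z" where
  "lift T x = T (SOME f. f \<in> C \<and> proj f = x)"

lemma lift_proj:
  assumes "f \<in> C" "\<And>f g. f \<in> C \<Longrightarrow> g \<in> C \<Longrightarrow> f - g \<in> I \<Longrightarrow> T f = T g"
  shows "lift T (proj f) = T f"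
proof -
  have "(SOME g. g \<in> C \<and> proj g = proj f) \<in> C \<and> proj (SOME g. g \<in> C \<and> proj g = proj f) = proj f"
    by (rule someI[of _ f]) (use assms in auto)
  then show ?thesis unfolding lift_def using assms by (auto simp: proj_eq_iff)
qed

text \<open>Killing the letters outside \<open>X\<close> extends \<open>I\<close> to an ideal of the whole ring, so that computations
  modulo the relations need no membership in the carrier.\<close>

definition J :: "('x fmon \<Rightarrow>\<^sub>0 'k) set" where
  "J = {f. free_hom (\<lambda>x. if x \<in> X then gen x else 0) f \<in> I}"

abbreviation restr where "restr \<equiv> free_hom (\<lambda>x. if x \<in> X then gen x else (0 :: 'x fmon \<Rightarrow>\<^sub>0 'k))"

lemma restr_word:
  "restr (word xs) = (if set xs \<subseteq> X then word xs else 0)"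
  by (induction xs) (simp_all add: word_Cons free_hom_mult)

lemma restr_id: "f \<in> unital_words X \<Longrightarrow> restr f = f"
proof -
  assume f: "f \<in> unital_words X"
  have "restr f = lext (\<lambda>u. word (letters u)) f"
    using f by (subst free_hom_def, intro lext_cong)
      (auto simp: unital_words_def restr_word simp flip: free_hom_word)
  also have "lext (\<lambda>u. word (letters u)) f = f"
    by (induction f rule: poly_mapping_keys_induct)
       (simp_all add: lext_add flip: single_eq_scal_word)
  finally show ?thesis by simp
qed

lemma C_unital: "f \<in> C \<Longrightarrow> f \<in> unital_words X"
  by (auto simp: free_carrier unital_words_def)

lemma J_iff: "f \<in> C \<Longrightarrow> f \<in> J \<longleftrightarrow> f \<in> I"
  by (simp add: J_def restr_id C_unital)

lemma J_zero [simp]: "0 \<in> J"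
  and J_add: "f \<in> J \<Longrightarrow> g \<in> J \<Longrightarrow> f + g \<in> J"
  and J_diff: "f \<in> J \<Longrightarrow> g \<in> J \<Longrightarrow> f - g \<in> J"
  and J_scal: "f \<in> J \<Longrightarrow> scal c f \<in> J"
  by (simp_all add: J_def free_hom_add free_hom_diff free_hom_scal I_zero I_add I_diff I_scal)

lemma J_mult_left: "f \<in> J \<Longrightarrow> a * f \<in> J"
proof (induction a rule: free_induct)
  case (add q xs c)
  \<comment> \<open>The empty word is not in \<open>C\<close>, so the ideal property does not cover
    it; it acts as 1.\<close>
  have "restr (word xs) * restr f \<in> I"
    using add by (cases "xs = []") (auto simp: restr_word J_def I_zero free_word intro!: I_mult_left)
  then show ?case
    using add by (auto simp: distrib_right scal_mult_left intro!: J_add J_scal) (simp add: J_def free_hom_mult)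
qed simp

lemma J_mult_right: "f \<in> J \<Longrightarrow> f * a \<in> J"
proof (induction a rule: free_induct)
  case (add q xs c)
  have "restr f * restr (word xs) \<in> I"
    using add by (cases "xs = []") (auto simp: restr_word J_def I_zero free_word intro!: I_mult_right)
  then show ?case
    using add by (auto simp: distrib_left scal_mult_right intro!: J_add J_scal) (simp add: J_def free_hom_mult)
qed simp

lemma R_J: "r \<in> R \<Longrightarrow> r \<in> J"
  using R_sub_I rels J_iff by auto

definition eqv :: "('x fmon \<Rightarrow>\<^sub>0 'k) \<Rightarrow> ('x fmon \<Rightarrow>\<^sub>0 'k) \<Rightarrow> bool" (infix \<open>\<sim>\<close> 50) where
  "f \<sim> g \<longleftrightarrow> f - g \<in> J"

lemma eqv_refl [simp, intro]: "f \<sim> f" by (simp add: eqv_def)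

lemma eqv_sym: "f \<sim> g \<Longrightarrow> g \<sim> f"
  using J_diff[of 0 "f - g"] by (simp add: eqv_def)

lemma eqv_trans [trans]: "f \<sim> g \<Longrightarrow> g \<sim> h \<Longrightarrow> f \<sim> h"
  using J_add[of "f - g" "g - h"] by (simp add: eqv_def)

lemma eqv_eq_trans [trans]: "f \<sim> g \<Longrightarrow> g = h \<Longrightarrow> f \<sim> h" "f = g \<Longrightarrow> g \<sim> h \<Longrightarrow> f \<sim> h"
  by simp_all

lemma eqv_add: "f \<sim> g \<Longrightarrow> f' \<sim> g' \<Longrightarrow> f + f' \<sim> g + g'"
  using J_add[of "f - g" "f' - g'"] by (simp add: eqv_def algebra_simps)

lemma eqv_diff: "f \<sim> g \<Longrightarrow> f' \<sim> g' \<Longrightarrow> f - f' \<sim> g - g'"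
  using J_diff[of "f - g" "f' - g'"] by (simp add: eqv_def algebra_simps)

lemma eqv_scal: "f \<sim> g \<Longrightarrow> scal c f \<sim> scal c g"
  using J_scal[of "f - g" c] by (simp add: eqv_def scal_diff)

lemma eqv_mult: "f \<sim> g \<Longrightarrow> f' \<sim> g' \<Longrightarrow> f * f' \<sim> g * g'"
  using J_add[OF J_mult_right[of "f - g" f'] J_mult_left[of "f' - g'" g]]
  by (simp add: eqv_def algebra_simps)

lemma eqv_sum: "(\<And>i. i \<in> S \<Longrightarrow> f i \<sim> g i) \<Longrightarrow> sum f S \<sim> sum g S"
  by (induction S rule: infinite_finite_induct) (auto intro: eqv_add)

lemma eqv_prod_list:
  "(\<And>x. x \<in> set xs \<Longrightarrow> f x \<sim> g x) \<Longrightarrow> prod_list (map f xs) \<sim> prod_list (map g xs)"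
  by (induction xs) (auto intro: eqv_mult)

text \<open>Congruence passes to products and sums, so a check on generators suffices. This reduces
  both inverse laws in \<open>presented_algebra_iso\<close> to generators.\<close>

lemma free_hom_eqv_self:
  assumes "f \<in> C" "\<And>x. x \<in> X \<Longrightarrow> h x \<sim> gen x"
  shows "free_hom h f \<sim> f"
proof (induction f rule: free_induct)
  case (add q xs c)
  have "set xs \<subseteq> X" using add(1) assms(1) by (fastforce simp: free_carrier)+
  then have "prod_list (map h xs) \<sim> prod_list (map gen xs)"
    using assms(2) by (intro eqv_prod_list) auto
  also have "prod_list (map gen xs) = (word xs :: _ \<Rightarrow>\<^sub>0 'k)"
    by (induction xs) (simp_all add: word_Cons)
  finally show ?case using add by (auto simp: free_hom_add free_hom_scal free_hom_word intro!: eqv_add eqv_scal)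
qed simp

end

text \<open>The two algebras are compared by substitutions \<open>h\<close> and \<open>k\<close> for
  the generators. All conditions are stated with \<open>J\<close>, where calculations are free of
  carrier conditions; on \<open>C\<close> it agrees with \<open>I\<close>.\<close>

lemma presented_algebra_iso:
  fixes R :: "('x fmon \<Rightarrow>\<^sub>0 'k::field) set" and S :: "('y fmon \<Rightarrow>\<^sub>0 'k) set"
  assumes "presentation X R" "presentation Y S"
    and h: "\<And>x. x \<in> X \<Longrightarrow> h x \<in> carrier (free_algebra Y)"
    and k: "\<And>y. y \<in> Y \<Longrightarrow> k y \<in> carrier (free_algebra X)"
    and hR: "\<And>r. r \<in> R \<Longrightarrow> free_hom h r \<in> presentation.J Y S"
    and kS: "\<And>s. s \<in> S \<Longrightarrow> free_hom k s \<in> presentation.J X R"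
    and hom_k_h: "\<And>x. x \<in> X \<Longrightarrow> free_hom k (h x) - gen x \<in> presentation.J X R"
    and hom_h_k: "\<And>y. y \<in> Y \<Longrightarrow> free_hom h (k y) - gen y \<in> presentation.J Y S"
  shows "algebra_iso (presented_algebra X R) (presented_algebra Y S)"
proof -
  interpret X: presentation X R by fact
  interpret Y: presentation Y S by fact
  \<comment> \<open>The preimage of \<open>Y.J\<close> in \<open>X.C\<close> is an ideal that
    contains \<open>R\<close>, and \<open>X.I\<close> is the least such ideal.\<close>
  have hJ: "free_hom h f \<in> Y.J" if "f \<in> X.I" for f
  proof -
    have "two_sided_ideal (free_algebra X) {f \<in> X.C. free_hom h f \<in> Y.J}"
      by (auto simp: free_ideal_iff free_add free_scal free_mult free_hom_add free_hom_scal free_hom_mult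
          intro: Y.J_add Y.J_scal Y.J_mult_left Y.J_mult_right)
    then have "X.I \<subseteq> {f \<in> X.C. free_hom h f \<in> Y.J}"
      using X.rels hR by (intro X.I_least) auto
    with that show ?thesis by auto
  qed
  have kJ: "free_hom k f \<in> X.J" if "f \<in> Y.I" for f
  proof -
    have "two_sided_ideal (free_algebra Y) {f \<in> Y.C. free_hom k f \<in> X.J}"
      by (auto simp: free_ideal_iff free_add free_scal free_mult free_hom_add free_hom_scal free_hom_mult
          intro: X.J_add X.J_scal X.J_mult_left X.J_mult_right)
    then have "Y.I \<subseteq> {f \<in> Y.C. free_hom k f \<in> X.J}"
      using Y.rels kS by (intro Y.I_least) auto
    with that show ?thesis by auto
  qed
  have hC: "free_hom h f \<in> Y.C" if "f \<in> X.C" for f using that h by (rule free_hom_in_free)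
  have kC: "free_hom k f \<in> X.C" if "f \<in> Y.C" for f using that k by (rule free_hom_in_free)
  define \<phi> where "\<phi> = X.lift (\<lambda>f. Y.proj (free_hom h f))"
  have \<phi>: "\<phi> (X.proj f) = Y.proj (free_hom h f)" if "f \<in> X.C" for f
    unfolding \<phi>_def
  proof (rule X.lift_proj[OF that])
    fix f g assume "f \<in> X.C" "g \<in> X.C" "f - g \<in> X.I"
    then show "Y.proj (free_hom h f) = Y.proj (free_hom h g)"
      using hJ[of "f - g"] hC[of "f - g"] by (simp add: Y.proj_eq_iff free_hom_diff Y.J_iff free_diff)
  qed
  have kh': "free_hom k (free_hom h f) - f \<in> X.J" if "f \<in> X.C" for f
    using X.free_hom_eqv_self[OF that, of "\<lambda>x. free_hom k (h x)"] hom_k_h by (simp add: X.eqv_def free_hom_free_hom)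
  have hk': "free_hom h (free_hom k f) - f \<in> Y.J" if "f \<in> Y.C" for f
    using Y.free_hom_eqv_self[OF that, of "\<lambda>x. free_hom h (k x)"] hom_h_k by (simp add: Y.eqv_def free_hom_free_hom)
  have "algebra_iso X.A Y.A"
    unfolding algebra_iso_def
  proof (intro bexI[of _ \<phi>] conjI ballI)
    show "bij_betw \<phi> (carrier X.A) (carrier Y.A)"
    proof (rule bij_betwI')
      fix x y assume "x \<in> carrier X.A" "y \<in> carrier X.A"
      then obtain f g where fg: "x = X.proj f" "y = X.proj g" "f \<in> X.C" "g \<in> X.C"
        by (auto simp: X.carrier_A)
      show "\<phi> x = \<phi> y \<longleftrightarrow> x = y"
      proof
        assume "\<phi> x = \<phi> y"
        then have "free_hom h f - free_hom h g \<in> Y.I" using fg by (simp add: \<phi> Y.proj_eq_iff)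
        then have "free_hom k (free_hom h (f - g)) \<in> X.J"
          using kJ[of "free_hom h f - free_hom h g"] by (simp add: free_hom_diff)
        then have "f - g \<in> X.J"
          using X.J_diff[of "free_hom k (free_hom h (f - g))", OF _ kh'[of "f - g"]] fg
          by (simp add: free_diff)
        then show "x = y" using fg by (simp add: X.J_iff free_diff X.proj_eq_iff)
      qed simp
    next
      fix x assume "x \<in> carrier X.A"
      then show "\<phi> x \<in> carrier Y.A" by (auto simp: X.carrier_A Y.carrier_A \<phi> hC)
    next
      fix y assume "y \<in> carrier Y.A"
      then obtain f where f: "y = Y.proj f" "f \<in> Y.C" by (auto simp: Y.carrier_A)
      have "Y.proj (free_hom h (free_hom k f)) = Y.proj f"
        using hk'[OF f(2)] f hC kC by (simp add: Y.proj_eq_iff Y.J_iff free_diff)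
      then show "\<exists>x\<in>carrier X.A. y = \<phi> x"
        using f kC by (intro bexI[of _ "X.proj (free_hom k f)"]) (auto simp: X.carrier_A \<phi>)
    qed
    show "\<phi> \<in> LinearCombinations.module_hom class_ring X.A Y.A"
      by (auto simp: LinearCombinations.module_hom_def X.carrier_A Y.carrier_A \<phi> hC X.A_add Y.A_add
          X.A_smult Y.A_smult free_add free_scal free_hom_add free_hom_scal)
    fix x y assume "x \<in> carrier X.A" "y \<in> carrier X.A"
    then show "\<phi> (x \<otimes>\<^bsub>X.A\<^esub> y) = \<phi> x \<otimes>\<^bsub>Y.A\<^esub> \<phi> y"
      by (auto simp: X.carrier_A \<phi> X.A_mult Y.A_mult hC free_mult free_hom_mult)
  qed
  then show ?thesis by (simp add: X.A_def Y.A_def)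
qed

section \<open>Leavitt path algebras\<close>

lemma presentation_leavitt:
  assumes "wf_digraph F" "row_finite F"
  shows "presentation (leavitt_gens F) (leavitt_rels F :: (_ \<Rightarrow>\<^sub>0 'k::field) set)"
proof
  interpret wf_digraph F by fact
  show "leavitt_rels F \<subseteq> carrier (free_algebra (leavitt_gens F) :: ('k, _) module)"
    unfolding leavitt_rels_def
    by (auto intro!: free_diff free_mult free_sum simp: free_gen leavitt_gens_def)
qed

text \<open>The parameter \<open>K\<close> only fixes the field: it keeps the types of all statements of a locale
  linked to each other.\<close>

locale row_finite_graph = wf_digraph F for F :: "('v, 'e) pre_digraph" +
  fixes K :: "'k::field itself"
  assumes rf: "row_finite F"
begin

lemma pres: "presentation (leavitt_gens F) (leavitt_rels F :: (_ \<Rightarrow>\<^sub>0 'k) set)"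
  by (rule presentation_leavitt[OF wf_digraph_axioms rf])

abbreviation eqF :: "(('v, 'e) leavitt_gen fmon \<Rightarrow>\<^sub>0 'k) \<Rightarrow> _ \<Rightarrow> bool" (infix \<open>\<simeq>\<close> 50) where
  "f \<simeq> g \<equiv> presentation.eqv (leavitt_gens F) (leavitt_rels F) f g"

lemmas eqF_trans [trans] = presentation.eqv_trans[OF pres] presentation.eqv_eq_trans[OF pres]
lemmas eqF_sym = presentation.eqv_sym[OF pres]
lemmas eqF_mult = presentation.eqv_mult[OF pres]
lemmas eqF_refl [simp, intro] = presentation.eqv_refl[OF pres]

lemma eqF_rel: "f - g \<in> leavitt_rels F \<Longrightarrow> f \<simeq> g"
  using presentation.R_J[OF pres] by (simp add: presentation.eqv_def[OF pres])

lemma F_vertices: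
  assumes "u \<in> verts F" "v \<in> verts F"
  shows "gen (LVertex u) * gen (LVertex v) \<simeq> (if u = v then gen (LVertex u) else 0)"
  by (rule eqF_rel, unfold leavitt_rels_def, rule UnI1, rule UnI1, rule UnI1, rule UnI1, rule UnI1, rule UnI1) (use assms in blast)

lemma F_edge:
  assumes "e \<in> arcs F"
  shows "gen (LVertex (tail F e)) * gen (LEdge e) \<simeq> gen (LEdge e)"
    and "gen (LEdge e) * gen (LVertex (head F e)) \<simeq> gen (LEdge e)"
    and "gen (LVertex (head F e)) * gen (LGhost e) \<simeq> gen (LGhost e)"
    and "gen (LGhost e) * gen (LVertex (tail F e)) \<simeq> gen (LGhost e)"
proof -
  show "gen (LVertex (tail F e)) * gen (LEdge e) \<simeq> gen (LEdge e)"
    by (rule eqF_rel, unfold leavitt_rels_def, rule UnI1, rule UnI1, rule UnI1, rule UnI1, rule UnI1, rule UnI2) (use assms in blast)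
  show "gen (LEdge e) * gen (LVertex (head F e)) \<simeq> gen (LEdge e)"
    by (rule eqF_rel, unfold leavitt_rels_def, rule UnI1, rule UnI1, rule UnI1, rule UnI1, rule UnI2) (use assms in blast)
  show "gen (LVertex (head F e)) * gen (LGhost e) \<simeq> gen (LGhost e)"
    by (rule eqF_rel, unfold leavitt_rels_def, rule UnI1, rule UnI1, rule UnI1, rule UnI2) (use assms in blast)
  show "gen (LGhost e) * gen (LVertex (tail F e)) \<simeq> gen (LGhost e)"
    by (rule eqF_rel, unfold leavitt_rels_def, rule UnI1, rule UnI1, rule UnI2) (use assms in blast)
qed

text \<open>The product vanishes where the two local units meet: x y = (x p)(q y) contains p
  q.\<close>

lemma F_mult_zero:
  assumes "x * p \<simeq> x" "q * y \<simeq> y" "p * q \<simeq> 0"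
  shows "x * y \<simeq> 0"
proof -
  have "x * y \<simeq> (x * p) * (q * y)" by (intro eqF_mult eqF_sym[OF assms(1)] eqF_sym[OF assms(2)])
  also have "\<dots> = x * ((p * q) * y)" by (simp add: mult.assoc)
  also have "\<dots> \<simeq> x * (0 * y)" by (intro eqF_mult assms(3) eqF_refl)
  finally show ?thesis by simp
qed

lemma F_ghost_edge:
  assumes "e \<in> arcs F" "f \<in> arcs F"
  shows "gen (LGhost e) * gen (LEdge f) \<simeq> (if e = f then gen (LVertex (head F e)) else 0)"
proof (cases "tail F e = tail F f")
  case True
  show ?thesis
  proof (rule eqF_rel)
    have "tail F e \<in> verts F \<and> e \<in> out_arcs F (tail F e) \<and> f \<in> out_arcs F (tail F e)"
      using assms True by (auto simp: out_arcs_def)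
    note m = this
    show "gen (LGhost e) * gen (LEdge f) - (if e = f then gen (LVertex (head F e)) else 0)
        \<in> leavitt_rels F"
      unfolding leavitt_rels_def by (rule UnI1, rule UnI2) (use m in blast)
  qed
next
  case False
  \<comment> \<open>The presentation has this relation only for a common source; for different
    sources the two vertices are orthogonal.\<close>
  then have "gen (LGhost e) * gen (LEdge f) \<simeq> 0"
    using F_vertices[of "tail F e" "tail F f"] assms
    by (intro F_mult_zero[OF F_edge(4) F_edge(1)]) auto
  with False show ?thesis by auto
qed

lemma F_edge_ghost:
  assumes "v \<in> verts F" "out_arcs F v \<noteq> {}"
  shows "(\<Sum>e\<in>out_arcs F v. gen (LEdge e) * gen (LGhost e)) \<simeq> gen (LVertex v)"
  by (rule eqF_rel, unfold leavitt_rels_def, rule UnI2) (use assms in blast)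

end

section \<open>Weighted Leavitt path algebras\<close>

locale row_finite_weighted =
  fixes E :: "('v, 'e) pre_digraph" and w :: "'e \<Rightarrow> nat" and K :: "'k::field itself"
  assumes weighted: "weighted_digraph E w" and rf: "row_finite E"
begin

sublocale wf_digraph E
  using weighted by (simp add: weighted_digraph_def)

lemma w_ge_1: "e \<in> arcs E \<Longrightarrow> 1 \<le> w e"
  using weighted by (simp add: weighted_digraph_def)

lemma finite_out [simp]: "finite (out_arcs E v)"
proof (cases "v \<in> verts E")
  case False
  then have "out_arcs E v = {}" by (auto simp: out_arcs_def)
  then show ?thesis by simp
qed (use rf in \<open>simp add: row_finite_def\<close>)

abbreviation vw where "vw \<equiv> vertex_weight E w"

lemma w_le_vw: "e \<in> arcs E \<Longrightarrow> w e \<le> vw (tail E e)"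
  unfolding vertex_weight_def by (intro Max_ge finite.insertI finite_imageI finite_out) auto

text \<open>The maximum is taken over 0 and the weights, so a positive value must come from an
  edge.\<close>

lemma vw_attained:
  assumes "i \<in> {1..vw v}"
  obtains e where "e \<in> arcs E" "tail E e = v" "w e = vw v"
proof -
  have "vw v \<in> insert 0 (w ` out_arcs E v)"
    unfolding vertex_weight_def by (intro Max_in) auto
  then show ?thesis using assms that by (auto simp: out_arcs_def)
qed

lemma wedge_in_C: "e \<in> arcs E \<Longrightarrow> 1 \<le> i \<Longrightarrow> wedge w e i \<in> carrier (free_algebra (wleavitt_gens E w))"
  by (auto simp: wedge_def free_gen wleavitt_gens_def)

lemma wghost_in_C: "e \<in> arcs E \<Longrightarrow> 1 \<le> i \<Longrightarrow> wghost w e i \<in> carrier (free_algebra (wleavitt_gens E w))"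
  by (auto simp: wghost_def free_gen wleavitt_gens_def)

lemma pres: "presentation (wleavitt_gens E w) (wleavitt_rels E w :: (_ \<Rightarrow>\<^sub>0 'k) set)"
proof
  show "wleavitt_rels E w \<subseteq> carrier (free_algebra (wleavitt_gens E w) :: ('k, _) module)"
    unfolding wleavitt_rels_def
    by (auto intro!: free_diff free_mult free_sum wedge_in_C wghost_in_C)
       (auto simp: free_gen wleavitt_gens_def)
qed

abbreviation eqW :: "(('v, 'e) wleavitt_gen fmon \<Rightarrow>\<^sub>0 'k) \<Rightarrow> _ \<Rightarrow> bool" (infix \<open>\<approx>\<close> 50) where
  "f \<approx> g \<equiv> presentation.eqv (wleavitt_gens E w) (wleavitt_rels E w) f g"

lemmas eqW_trans [trans] = presentation.eqv_trans[OF pres] presentation.eqv_eq_trans[OF pres]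
lemmas eqW_sym = presentation.eqv_sym[OF pres]
lemmas eqW_diff = presentation.eqv_diff[OF pres]
lemmas eqW_mult = presentation.eqv_mult[OF pres]
lemmas eqW_sum = presentation.eqv_sum[OF pres]
lemmas eqW_refl [simp, intro] = presentation.eqv_refl[OF pres]

lemma eqW_rel: "f - g \<in> wleavitt_rels E w \<Longrightarrow> f \<approx> g"
  using presentation.R_J[OF pres] by (simp add: presentation.eqv_def[OF pres])

abbreviation V :: "'v \<Rightarrow> ('v, 'e) wleavitt_gen fmon \<Rightarrow>\<^sub>0 'k" where "V v \<equiv> gen (WVertex v)"
abbreviation X :: "'e \<Rightarrow> nat \<Rightarrow> ('v, 'e) wleavitt_gen fmon \<Rightarrow>\<^sub>0 'k" where "X \<equiv> wedge w"
abbreviation Y :: "'e \<Rightarrow> nat \<Rightarrow> ('v, 'e) wleavitt_gen fmon \<Rightarrow>\<^sub>0 'k" where "Y \<equiv> wghost w"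

lemma W_vertices:
  assumes "u \<in> verts E" "v \<in> verts E"
  shows "V u * V v \<approx> (if u = v then V u else 0)"
  by (rule eqW_rel, unfold wleavitt_rels_def, rule UnI1, rule UnI1, rule UnI1, rule UnI1, rule UnI1, rule UnI1) (use assms in blast)

text \<open>Above the weight of \<open>e\<close>, both \<open>X e i\<close> and \<open>Y e i\<close>
  are zero by convention, so all positive indices can be treated alike.\<close>

lemma W_edge:
  assumes "e \<in> arcs E" "1 \<le> i"
  shows "V (tail E e) * X e i \<approx> X e i"
    and "X e i * V (head E e) \<approx> X e i"
    and "V (head E e) * Y e i \<approx> Y e i"
    and "Y e i * V (tail E e) \<approx> Y e i"
proof -
  have "V (tail E e) * X e i \<approx> X e i \<and> X e i * V (head E e) \<approx> X e i \<and>
      V (head E e) * Y e i \<approx> Y e i \<and> Y e i * V (tail E e) \<approx> Y e i"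
  proof (cases "i \<le> w e")
    case True
    then have XY: "X e i = gen (WEdge e i)" "Y e i = gen (WGhost e i)"
      by (simp_all add: wedge_def wghost_def)
    show ?thesis unfolding XY
    proof (intro conjI)
      show "V (tail E e) * gen (WEdge e i) \<approx> gen (WEdge e i)"
        by (rule eqW_rel, unfold wleavitt_rels_def, rule UnI1, rule UnI1, rule UnI1, rule UnI1, rule UnI1, rule UnI2) (use assms True in blast)
      show "gen (WEdge e i) * V (head E e) \<approx> gen (WEdge e i)"
        by (rule eqW_rel, unfold wleavitt_rels_def, rule UnI1, rule UnI1, rule UnI1, rule UnI1, rule UnI2) (use assms True in blast)
      show "V (head E e) * gen (WGhost e i) \<approx> gen (WGhost e i)"
        by (rule eqW_rel, unfold wleavitt_rels_def, rule UnI1, rule UnI1, rule UnI1, rule UnI2) (use assms True in blast)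
      show "gen (WGhost e i) * V (tail E e) \<approx> gen (WGhost e i)"
        by (rule eqW_rel, unfold wleavitt_rels_def, rule UnI1, rule UnI1, rule UnI2) (use assms True in blast)
    qed
  qed (simp add: wedge_def wghost_def)
  then show "V (tail E e) * X e i \<approx> X e i" "X e i * V (head E e) \<approx> X e i"
    "V (head E e) * Y e i \<approx> Y e i" "Y e i * V (tail E e) \<approx> Y e i" by auto
qed

lemma W_ghost_edge:
  assumes "e \<in> arcs E" "f \<in> arcs E" "tail E e = tail E f"
  shows "(\<Sum>i = 1..vw (tail E e). Y e i * X f i) \<approx> (if e = f then V (head E e) else 0)"
proof (rule eqW_rel)
  have "tail E e \<in> verts E \<and> e \<in> out_arcs E (tail E e) \<and> f \<in> out_arcs E (tail E e)"
    using assms by (auto simp: out_arcs_def)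
  note m = this
  show "(\<Sum>i = 1..vw (tail E e). Y e i * X f i) - (if e = f then V (head E e) else 0)
      \<in> wleavitt_rels E w"
    unfolding wleavitt_rels_def by (rule UnI1, rule UnI2) (use m in blast)
qed

lemma W_edge_ghost:
  assumes "i \<in> {1..vw v}" "j \<in> {1..vw v}"
  shows "(\<Sum>e\<in>out_arcs E v. X e i * Y e j) \<approx> (if i = j then V v else 0)"
proof (rule eqW_rel)
  have "v \<in> verts E" using vw_attained[OF assms(1)] by (metis tail_in_verts)
  with assms have m: "v \<in> verts E \<and> i \<in> {1..vw v} \<and> j \<in> {1..vw v}" by blast
  show "(\<Sum>e\<in>out_arcs E v. X e i * Y e j) - (if i = j then V v else 0)
      \<in> wleavitt_rels E w"
    unfolding wleavitt_rels_def by (rule UnI2) (use m in blast)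
qed

lemma W_mult_zero:
  assumes "x * p \<approx> x" "q * y \<approx> y" "p * q \<approx> 0"
  shows "x * y \<approx> 0"
proof -
  have "x * y \<approx> (x * p) * (q * y)" by (intro eqW_mult eqW_sym[OF assms(1)] eqW_sym[OF assms(2)])
  also have "\<dots> = x * ((p * q) * y)" by (simp add: mult.assoc)
  also have "\<dots> \<approx> x * (0 * y)" by (intro eqW_mult assms(3) eqW_refl)
  finally show ?thesis by simp
qed

section \<open>Reversing edges\<close>

definition heavy :: "'e set" where
  "heavy = {e \<in> arcs E. 1 < w e}"

text \<open>The closure is reflexive, so the ranges of the heavy edges themselves belong to the
  set.\<close>

definition below :: "'v set" where
  "below = {u. \<exists>e\<in>heavy. (head E e, u) \<in> {(tail E f, head E f) | f. f \<in> arcs E}\<^sup>*}"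

text \<open>The set R of the overview.\<close>

definition reversed :: "'e set" where
  "reversed = {e \<in> arcs E. e \<in> heavy \<or> tail E e \<in> below}"

definition good :: bool where
  "good \<longleftrightarrow> (\<forall>e\<in>heavy. \<forall>f\<in>heavy. tail E e = tail E f \<longrightarrow> e = f) \<and>
     (\<forall>e\<in>arcs E. \<forall>f\<in>arcs E. tail E e \<in> below \<longrightarrow> tail E e = tail E f \<longrightarrow> e = f) \<and>
     inj_on (head E) reversed"

lemma rev_arc: "e \<in> reversed \<Longrightarrow> e \<in> arcs E"
  by (simp add: reversed_def)

lemma rev_head_below: "e \<in> reversed \<Longrightarrow> head E e \<in> below"
proof -
  assume e: "e \<in> reversed"
  show ?thesis
  proof (cases "e \<in> heavy")
    case True
    then show ?thesis by (auto simp: below_def)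
  next
    case False
    then have "tail E e \<in> below" "e \<in> arcs E" using e by (auto simp: reversed_def)
    then show ?thesis unfolding below_def by (auto intro: rtrancl_into_rtrancl)
  qed
qed

lemma not_rev_weight: "e \<in> arcs E \<Longrightarrow> e \<notin> reversed \<Longrightarrow> w e = 1"
  using w_ge_1[of e] by (auto simp: reversed_def heavy_def)

end

locale good_graph = row_finite_weighted E w K
  for E :: "('v, 'e) pre_digraph" and w :: "'e \<Rightarrow> nat" and K :: "'k::field itself" +
  assumes good: good
begin

lemma below_unique: "e \<in> arcs E \<Longrightarrow> f \<in> arcs E \<Longrightarrow> tail E e \<in> below \<Longrightarrow> tail E f = tail E e \<Longrightarrow> f = e"
  using good unfolding good_def by metis

text \<open>A source in \<open>below\<close> emits a single edge. At any other source a reversed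
  edge must be heavy, and no vertex emits two heavy edges.\<close>

lemma rev_unique: "e \<in> reversed \<Longrightarrow> f \<in> reversed \<Longrightarrow> tail E e = tail E f \<Longrightarrow> e = f"
proof -
  assume a: "e \<in> reversed" "f \<in> reversed" "tail E e = tail E f"
  show "e = f"
  proof (cases "tail E e \<in> below")
    case True
    then show ?thesis using below_unique[of e f] a rev_arc by metis
  next
    case False
    then have "e \<in> heavy" "f \<in> heavy" using a by (simp_all add: reversed_def)
    then show ?thesis using good a(3) unfolding good_def by blast
  qed
qed

lemma rev_head_inj: "e \<in> reversed \<Longrightarrow> f \<in> reversed \<Longrightarrow> head E e = head E f \<Longrightarrow> e = f"
  using good unfolding good_def by (metis inj_onD)

text \<open>If \<open>e \<in> reversed\<close> is not the only edge at \<open>v\<close>, then \<open>v\<close> has to be split into the orthogonal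
  idempotents \<open>e\<^sub>1e\<^sub>1\<^sup>*\<close>, which is the part with index 1, and \<open>v - e\<^sub>1e\<^sub>1\<^sup>*\<close>, the part with index 0. An edge
  into \<open>v\<close> becomes two edges, except for the reversed \<open>e\<^sub>1\<close>, which ends in part 1 only.\<close>

definition split :: "'v \<Rightarrow> bool" where
  "split v \<longleftrightarrow> (\<exists>e\<in>reversed. \<exists>f\<in>arcs E. tail E e = v \<and> tail E f = v \<and> f \<noteq> e)"

definition parts :: "'v \<Rightarrow> nat set" where
  "parts v = (if split v then {0, 1} else {0})"

text \<open>Ends of an edge after the reversal, with the parts of split vertices not yet taken into
  account.\<close>

definition src :: "'e \<Rightarrow> 'v" where
  "src e = (if e \<in> reversed then head E e else tail E e)"

definition tgt :: "'e \<Rightarrow> 'v" where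
  "tgt e = (if e \<in> reversed then tail E e else head E e)"

definition copies :: "'e \<Rightarrow> nat \<Rightarrow> nat set" where
  "copies e i = (if e \<in> reversed \<and> i = 1 \<and> split (tail E e) then {1} else parts (tgt e))"

lemma finite_parts [simp]: "finite (parts v)" and finite_copies [simp]: "finite (copies e i)"
  by (auto simp: parts_def copies_def)

lemma zero_in_parts [simp]: "0 \<in> parts v"
  by (simp add: parts_def)

lemma copies_sub: "copies e i \<subseteq> parts (tgt e)"
  by (auto simp: copies_def parts_def tgt_def)

lemma copies_lt: "c \<in> copies e i \<Longrightarrow> c < 2"
  by (auto simp: copies_def parts_def split: if_splits)

lemma src_vert: "e \<in> arcs E \<Longrightarrow> src e \<in> verts E" and tgt_vert: "e \<in> arcs E \<Longrightarrow> tgt e \<in> verts E"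
  by (auto simp: src_def tgt_def)

lemma split_not_below: "split v \<Longrightarrow> v \<notin> below"
proof
  assume "split v" "v \<in> below"
  then obtain e f where "e \<in> reversed" "f \<in> arcs E" "tail E e = v" "tail E f = v" "f \<noteq> e"
    by (auto simp: split_def)
  then show False using below_unique[of e f] \<open>v \<in> below\<close> by (auto simp: reversed_def)
qed

text \<open>The range of a reversed edge lies in \<open>below\<close>, where vertices emit at most
  one edge. This is why all edges of \<open>F\<close>, reversed ones included, can be made to start
  in part 0.\<close>

lemma rev_head_not_split: "e \<in> reversed \<Longrightarrow> \<not> split (head E e)"
  using split_not_below rev_head_below by blast

lemma parts_head_rev: "e \<in> reversed \<Longrightarrow> parts (head E e) = {0}"
  using rev_head_not_split by (simp add: parts_def)

lemma split_other:
  "e \<in> reversed \<Longrightarrow> f \<in> arcs E \<Longrightarrow> tail E f = tail E e \<Longrightarrow> f \<noteq> e \<Longrightarrow> split (tail E e) \<and> f \<notin> reversed"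
  unfolding split_def using rev_unique[of e f] by metis

text \<open>An edge in its old direction that starts at the range of a reversed edge would have its
  source in \<open>below\<close> and hence be reversed; two reversed edges never share a range. So
  after the reversal a vertex emits either a single reversed edge or only edges in their old
  direction.\<close>

lemma same_src_rev: "e \<in> arcs E \<Longrightarrow> f \<in> arcs E \<Longrightarrow> src e = src f \<Longrightarrow> e \<in> reversed \<Longrightarrow> f = e"
proof -
  assume a: "e \<in> arcs E" "f \<in> arcs E" "src e = src f" "e \<in> reversed"
  have "f \<in> reversed"
  proof (rule ccontr)
    assume "f \<notin> reversed"
    then have "tail E f = head E e" using a by (simp add: src_def)
    then show False using rev_head_below[OF a(4)] a(2) \<open>f \<notin> reversed\<close> by (simp add: reversed_def)
  qed
  then show ?thesis using rev_head_inj[of e f] a by (simp add: src_def)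
qed

text \<open>The companions of a reversed edge at its source are not reversed, hence of weight 1, so
  the reversed edge has the maximal weight there.\<close>

lemma vw_rev: "e \<in> reversed \<Longrightarrow> vw (tail E e) = w e"
proof -
  assume e: "e \<in> reversed"
  have "1 \<in> {1..vw (tail E e)}"
    using w_le_vw[of e] w_ge_1[of e] rev_arc[OF e] by simp
  then obtain f where f: "f \<in> arcs E" "tail E f = tail E e" "w f = vw (tail E e)"
    by (rule vw_attained)
  show ?thesis
  proof (cases "f = e")
    case False
    then have "w f = 1" using split_other[OF e f(1,2)] not_rev_weight f(1) by auto
    then show ?thesis using f(3) w_le_vw[of e] w_ge_1[of e] rev_arc[OF e] by simp
  qed (use f in simp)
qed

lemma vw_not_rev: "i \<in> {1..vw v} \<Longrightarrow> (\<And>e. e \<in> reversed \<Longrightarrow> tail E e \<noteq> v) \<Longrightarrow> vw v = 1"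
proof -
  assume a: "i \<in> {1..vw v}" "\<And>e. e \<in> reversed \<Longrightarrow> tail E e \<noteq> v"
  then obtain e where "e \<in> arcs E" "tail E e = v" "w e = vw v" by (elim vw_attained)
  with a(2) show "vw v = 1" using not_rev_weight[of e] by auto
qed

text \<open>The edge \<open>(Inr e, 2 * i + c)\<close> is the copy of \<open>e\<^sub>i\<close> (of \<open>e\<^sub>i\<^sup>*\<close> if \<open>e\<close> is reversed) that ends in
  part \<open>c < 2\<close> of its range.\<close>

definition F :: "(('v, 'e) label, ('v, 'e) label) pre_digraph" where
  "F = \<lparr>verts = {(Inl v, c) | v c. v \<in> verts E \<and> c \<in> parts v},
    arcs = {(Inr e, 2 * i + c) | e i c. e \<in> arcs E \<and> 1 \<le> i \<and> i \<le> w e \<and> c \<in> copies e i},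
    tail = (\<lambda>(x, n). (Inl (src (projr x)), 0)),
    head = (\<lambda>(x, n). (Inl (tgt (projr x)), n mod 2))\<rparr>"

lemma F_sel [simp]:
  "tail F (Inr e, n) = (Inl (src e), 0)" "head F (Inr e, n) = (Inl (tgt e), n mod 2)"
  by (simp_all add: F_def)

lemma F_vert: "(Inl v, c) \<in> verts F \<longleftrightarrow> v \<in> verts E \<and> c \<in> parts v"
  by (simp add: F_def)

lemma code_inj: "c < 2 \<Longrightarrow> d < 2 \<Longrightarrow> 2 * i + c = 2 * j + d \<Longrightarrow> i = j \<and> c = (d :: nat)"
  by presburger

lemma F_arc:
  assumes "c < 2"
  shows "(Inr e, 2 * i + c) \<in> arcs F \<longleftrightarrow> e \<in> arcs E \<and> 1 \<le> i \<and> i \<le> w e \<and> c \<in> copies e i"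
proof
  assume "(Inr e, 2 * i + c) \<in> arcs F"
  then obtain j d where "2 * i + c = 2 * j + d" "e \<in> arcs E" "1 \<le> j" "j \<le> w e" "d \<in> copies e j"
    by (auto simp: F_def)
  then show "e \<in> arcs E \<and> 1 \<le> i \<and> i \<le> w e \<and> c \<in> copies e i"
    using code_inj[OF assms copies_lt, of d e j i j] by simp
qed (auto simp: F_def)

lemma F_verts: "verts F = {(Inl v, c) | v c. v \<in> verts E \<and> c \<in> parts v}"
  and F_arcs: "arcs F = {(Inr e, 2 * i + c) | e i c. e \<in> arcs E \<and> 1 \<le> i \<and> i \<le> w e \<and> c \<in> copies e i}"
  by (simp_all add: F_def)

lemma copies_mod: "c \<in> copies e i \<Longrightarrow> (2 * i + c) mod 2 = c"
  using copies_lt[of c e i] by simp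

lemma F_wf: "wf_digraph F"
proof
  fix x assume "x \<in> arcs F"
  then obtain e i c where x: "x = (Inr e, 2 * i + c)" "e \<in> arcs E" "c \<in> copies e i"
    by (auto simp: F_arcs)
  show "tail F x \<in> verts F" "head F x \<in> verts F"
    using x copies_mod[OF x(3)] copies_sub[of e i] by (auto simp: F_vert src_vert tgt_vert)
qed

definition arc_ix :: "'v \<Rightarrow> ('e \<times> nat \<times> nat) set" where
  "arc_ix v = (SIGMA e : {e \<in> arcs E. src e = v}. SIGMA i : {1..w e}. copies e i)"

definition code :: "'e \<times> nat \<times> nat \<Rightarrow> ('v, 'e) label" where
  "code = (\<lambda>(e, i, c). (Inr e, 2 * i + c))"

lemma F_out_arcs: "out_arcs F (Inl v, 0) = code ` arc_ix v"
proof (intro equalityI subsetI)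
  fix x assume x: "x \<in> out_arcs F (Inl v, 0)"
  then obtain e i c where "x = (Inr e, 2 * i + c)" "e \<in> arcs E" "1 \<le> i" "i \<le> w e" "c \<in> copies e i"
    by (auto simp: out_arcs_def F_arcs)
  with x show "x \<in> code ` arc_ix v"
    by (intro image_eqI[of _ _ "(e, i, c)"]) (simp_all add: code_def arc_ix_def)
next
  fix x assume "x \<in> code ` arc_ix v"
  then obtain e i c where "x = (Inr e, 2 * i + c)" "(e, i, c) \<in> arc_ix v"
    by (auto simp: code_def)
  then show "x \<in> out_arcs F (Inl v, 0)"
    using copies_lt[of c e i] by (simp add: out_arcs_def F_arc arc_ix_def)
qed

lemma inj_code: "inj_on code (arc_ix v)"
proof (rule inj_onI)
  fix x y assume "x \<in> arc_ix v" "y \<in> arc_ix v" and eq: "code x = code y"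
  then obtain e i c f j d where xy: "x = (e, i, c)" "y = (f, j, d)" "c \<in> copies e i" "d \<in> copies f j"
    by (auto simp: arc_ix_def)
  then have "e = f" "2 * i + c = 2 * j + d" using eq by (simp_all add: code_def)
  then show "x = y" using code_inj[OF copies_lt[OF xy(3)] copies_lt[OF xy(4)]] xy by simp
qed

lemma finite_src: "finite {e \<in> arcs E. src e = v}"
proof (cases "\<exists>e\<in>arcs E. src e = v \<and> e \<in> reversed")
  case True
  then obtain e where e: "e \<in> arcs E" "src e = v" "e \<in> reversed" by blast
  have "{e \<in> arcs E. src e = v} \<subseteq> {e}"
  proof
    fix f assume "f \<in> {e \<in> arcs E. src e = v}"
    then show "f \<in> {e}" using same_src_rev[of e f] e by simp
  qed
  then show ?thesis by (rule finite_subset) simp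
next
  case False
  then have "{e \<in> arcs E. src e = v} \<subseteq> out_arcs E v"
    unfolding src_def out_arcs_def by fastforce
  then show ?thesis by (rule finite_subset) simp
qed

lemma F_row_finite: "row_finite F"
  unfolding row_finite_def
proof
  fix x assume "x \<in> verts F"
  then obtain v c where x: "x = (Inl v, c)" by (auto simp: F_verts)
  show "finite (out_arcs F x)"
  proof (cases "c = 0")
    case True
    then show ?thesis
      unfolding x True F_out_arcs arc_ix_def by (intro finite_imageI finite_SigmaI finite_src finite_copies finite_atLeastAtMost)
  next
    case False
    \<comment> \<open>Every edge of \<open>F\<close> starts in part 0, so part 1 of a split vertex
      is a sink.\<close>
    then have "out_arcs F x = {}" by (auto simp: x out_arcs_def F_arcs)
    then show ?thesis by simp
  qed
qed

lemma F_graph: "row_finite_graph F"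
  by (rule row_finite_graph.intro[OF F_wf row_finite_graph_axioms.intro[OF F_row_finite]])

end

section \<open>The homomorphism to the Leavitt path algebra of the reversed graph\<close>

context good_graph begin

declare One_nat_def [simp del]

abbreviation eqG :: "((('v, 'e) label, ('v, 'e) label) leavitt_gen fmon \<Rightarrow>\<^sub>0 'k) \<Rightarrow> _ \<Rightarrow> bool"
    (infix \<open>\<simeq>\<close> 50) where
  "f \<simeq> g \<equiv> presentation.eqv (leavitt_gens F) (leavitt_rels F) f g"

lemma presF: "presentation (leavitt_gens F) (leavitt_rels F :: (_ \<Rightarrow>\<^sub>0 'k) set)"
  by (rule row_finite_graph.pres[OF F_graph])

lemmas eqG_trans [trans] = presentation.eqv_trans[OF presF] presentation.eqv_eq_trans[OF presF]
lemmas eqG_sym = presentation.eqv_sym[OF presF]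
lemmas eqG_add = presentation.eqv_add[OF presF]
lemmas eqG_diff = presentation.eqv_diff[OF presF]
lemmas eqG_mult = presentation.eqv_mult[OF presF]
lemmas eqG_sum = presentation.eqv_sum[OF presF]
lemmas eqG_refl [simp, intro] = presentation.eqv_refl[OF presF]
lemmas G_mult_zero = row_finite_graph.F_mult_zero[OF F_graph, where ?'k = 'k]

abbreviation N :: "'v \<Rightarrow> nat \<Rightarrow> (('v, 'e) label, ('v, 'e) label) leavitt_gen fmon \<Rightarrow>\<^sub>0 'k" where
  "N v c \<equiv> gen (LVertex (Inl v, c))"
abbreviation a :: "'e \<Rightarrow> nat \<Rightarrow> nat \<Rightarrow> (('v, 'e) label, ('v, 'e) label) leavitt_gen fmon \<Rightarrow>\<^sub>0 'k" where
  "a e i c \<equiv> gen (LEdge (Inr e, 2 * i + c))"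
abbreviation b :: "'e \<Rightarrow> nat \<Rightarrow> nat \<Rightarrow> (('v, 'e) label, ('v, 'e) label) leavitt_gen fmon \<Rightarrow>\<^sub>0 'k" where
  "b e i c \<equiv> gen (LGhost (Inr e, 2 * i + c))"

definition ix :: "'e \<Rightarrow> nat \<Rightarrow> nat \<Rightarrow> bool" where
  "ix e i c \<longleftrightarrow> e \<in> arcs E \<and> 1 \<le> i \<and> i \<le> w e \<and> c \<in> copies e i"

lemma ix_arc: "ix e i c \<Longrightarrow> (Inr e, 2 * i + c) \<in> arcs F"
  using copies_lt[of c e i] by (simp add: ix_def F_arc)

lemma ix_mod: "ix e i c \<Longrightarrow> (2 * i + c) mod 2 = c"
  using copies_mod[of c e i] by (simp only: ix_def)

lemma ix_parts: "ix e i c \<Longrightarrow> c \<in> parts (tgt e)"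
  using copies_sub by (auto simp: ix_def)

lemma N_mult:
  assumes "u \<in> verts E" "v \<in> verts E" "c \<in> parts u" "d \<in> parts v"
  shows "N u c * N v d \<simeq> (if u = v \<and> c = d then N u c else 0)"
  using row_finite_graph.F_vertices[OF F_graph, of "(Inl u, c)" "(Inl v, d)"] assms
  by (simp add: F_vert)

lemma ab_absorb:
  assumes "ix e i c"
  shows "N (src e) 0 * a e i c \<simeq> a e i c" "a e i c * N (tgt e) c \<simeq> a e i c"
    "N (tgt e) c * b e i c \<simeq> b e i c" "b e i c * N (src e) 0 \<simeq> b e i c"
  using row_finite_graph.F_edge[OF F_graph ix_arc[OF assms]] ix_mod[OF assms] by simp_all

lemma ghost_edge_copies:
  assumes "ix e i c" "ix f j d"
  shows "b e i c * a f j d \<simeq> (if e = f \<and> i = j \<and> c = d then N (tgt e) c else 0)"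
proof -
  have "(Inr e, 2 * i + c) = (Inr f, 2 * j + d) \<longleftrightarrow> e = f \<and> i = j \<and> c = d"
    using code_inj[of c d i j] copies_lt[of c e i] copies_lt[of d f j] assms by (auto simp: ix_def)
  note eq = this
  show ?thesis
    using row_finite_graph.F_ghost_edge[OF F_graph ix_arc[OF assms(1)] ix_arc[OF assms(2)]]
    unfolding F_sel ix_mod[OF assms(1)] eq .
qed

text \<open>Relation (iv) of \<open>F\<close> at part 0 of \<open>src e0\<close>, with the edges of
  \<open>F\<close> sorted by original edge, index and part. The edge \<open>e0\<close> witnesses
  that this vertex is not a sink.\<close>

lemma edge_ghost_copies:
  assumes "e0 \<in> arcs E"
  shows "(\<Sum>e | e \<in> arcs E \<and> src e = src e0. \<Sum>i = 1..w e. \<Sum>c\<in>copies e i. a e i c * b e i c)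
    \<simeq> N (src e0) 0"
proof -
  let ?v = "src e0"
  have "copies e0 1 \<noteq> {}" by (auto simp: copies_def parts_def)
  then obtain c where "c \<in> copies e0 1" by blast
  then have "(e0, 1, c) \<in> arc_ix ?v" using assms w_ge_1[OF assms] by (simp add: arc_ix_def)
  then have "out_arcs F (Inl ?v, 0) \<noteq> {}" unfolding F_out_arcs by blast
  moreover have "(Inl ?v, 0) \<in> verts F" using src_vert[OF assms] by (simp add: F_vert)
  ultimately have "(\<Sum>x\<in>out_arcs F (Inl ?v, 0). gen (LEdge x) * gen (LGhost x)) \<simeq> N ?v 0"
    by (intro row_finite_graph.F_edge_ghost[OF F_graph])
  also have "(\<Sum>x\<in>out_arcs F (Inl ?v, 0). gen (LEdge x) * gen (LGhost x)) =
      (\<Sum>(e, i, c)\<in>arc_ix ?v. a e i c * b e i c)"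
    unfolding F_out_arcs sum.reindex[OF inj_code] by (intro sum.cong) (auto simp: code_def)
  also have "\<dots> = (\<Sum>e | e \<in> arcs E \<and> src e = ?v. \<Sum>i = 1..w e. \<Sum>c\<in>copies e i. a e i c * b e i c)"
    unfolding arc_ix_def using finite_src by (simp add: sum.Sigma split_beta)
  finally show ?thesis .
qed

lemma src_fiber_rev: "e \<in> reversed \<Longrightarrow> {f. f \<in> arcs E \<and> src f = src e} = {e}"
  using same_src_rev[of e] rev_arc[of e] by auto

lemma src_fiber:
  assumes "e \<in> arcs E" "e \<notin> reversed"
  shows "{f. f \<in> arcs E \<and> src f = src e} = {f \<in> out_arcs E (tail E e). f \<notin> reversed}"
proof -
  have "f \<in> arcs E \<and> src f = src e \<longleftrightarrow> f \<in> out_arcs E (tail E e) \<and> f \<notin> reversed" for f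
  proof (cases "f \<in> reversed")
    case True
    then show ?thesis using same_src_rev[of f e] assms by metis
  qed (use assms in \<open>simp add: src_def\<close>)
  then show ?thesis by simp
qed

lemma edge_ghost_copies_reversed:
  assumes "e \<in> reversed"
  shows "(\<Sum>i = 1..w e. \<Sum>c\<in>copies e i. a e i c * b e i c) \<simeq> N (head E e) 0"
  using edge_ghost_copies[OF rev_arc[OF assms]] unfolding src_fiber_rev[OF assms] using assms by (simp add: src_def)

lemma edge_ghost_copies_kept:
  assumes "e \<in> arcs E" "e \<notin> reversed"
  shows "(\<Sum>f | f \<in> out_arcs E (tail E e) \<and> f \<notin> reversed. \<Sum>c\<in>copies f 1. a f 1 c * b f 1 c)
    \<simeq> N (tail E e) 0"
proof -
  have "(\<Sum>f | f \<in> out_arcs E (tail E e) \<and> f \<notin> reversed. \<Sum>c\<in>copies f 1. a f 1 c * b f 1 c) =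
      (\<Sum>f | f \<in> out_arcs E (tail E e) \<and> f \<notin> reversed. \<Sum>i = 1..w f. \<Sum>c\<in>copies f i. a f i c * b f i c)"
    by (rule sum.cong[OF refl]) (simp add: not_rev_weight)
  also have "\<dots> \<simeq> N (tail E e) 0"
    using edge_ghost_copies[OF assms(1)] unfolding src_fiber[OF assms] using assms by (simp add: src_def)
  finally show ?thesis .
qed

text \<open>Summing over the parts of the range undoes the splitting: \<open>A e i\<close>,
  \<open>B e i\<close> and \<open>VV v\<close> play the roles of an edge, its ghost and a vertex in
  a graph with reversed edges but unsplit vertices.\<close>

definition A :: "'e \<Rightarrow> nat \<Rightarrow> (('v, 'e) label, ('v, 'e) label) leavitt_gen fmon \<Rightarrow>\<^sub>0 'k" where
  "A e i = (\<Sum>c\<in>copies e i. a e i c)"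
definition B :: "'e \<Rightarrow> nat \<Rightarrow> (('v, 'e) label, ('v, 'e) label) leavitt_gen fmon \<Rightarrow>\<^sub>0 'k" where
  "B e i = (\<Sum>c\<in>copies e i. b e i c)"
definition VV :: "'v \<Rightarrow> (('v, 'e) label, ('v, 'e) label) leavitt_gen fmon \<Rightarrow>\<^sub>0 'k" where
  "VV v = (\<Sum>c\<in>parts v. N v c)"

lemma sum_mult_delta:
  assumes "finite S" "c \<in> S" "\<And>d. d \<in> S \<Longrightarrow> f d \<simeq> (if d = c then y else 0)"
  shows "(\<Sum>d\<in>S. f d) \<simeq> y"
proof -
  have "(\<Sum>d\<in>S. f d) \<simeq> (\<Sum>d\<in>S. if d = c then y else 0)" by (rule eqG_sum) (rule assms(3))
  also have "\<dots> = y" using assms by simp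
  finally show ?thesis .
qed

text \<open>One summand of \<open>VV v\<close> absorbs \<open>y\<close>; the others are orthogonal
  to that summand and therefore kill \<open>y\<close>.\<close>

lemma VV_left:
  assumes "v \<in> verts E" "c \<in> parts v" "N v c * y \<simeq> y"
  shows "VV v * y \<simeq> y"
  unfolding VV_def sum_distrib_right
proof (rule sum_mult_delta[OF finite_parts assms(2)])
  fix d assume d: "d \<in> parts v"
  have "N v d * y \<simeq> N v d * (N v c * y)" by (intro eqG_mult eqG_refl eqG_sym[OF assms(3)])
  also have "\<dots> = (N v d * N v c) * y" by (simp add: mult.assoc)
  also have "\<dots> \<simeq> (if d = c then N v c else 0) * y"
    using N_mult[OF assms(1,1) d assms(2)] by (intro eqG_mult eqG_refl) (auto split: if_splits)
  also have "\<dots> \<simeq> (if d = c then y else 0)" using assms(3) by simp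
  finally show "N v d * y \<simeq> (if d = c then y else 0)" .
qed

lemma VV_right:
  assumes "v \<in> verts E" "c \<in> parts v" "y * N v c \<simeq> y"
  shows "y * VV v \<simeq> y"
  unfolding VV_def sum_distrib_left
proof (rule sum_mult_delta[OF finite_parts assms(2)])
  fix d assume d: "d \<in> parts v"
  have "y * N v d \<simeq> (y * N v c) * N v d" by (intro eqG_mult eqG_refl eqG_sym[OF assms(3)])
  also have "\<dots> = y * (N v c * N v d)" by (simp add: mult.assoc)
  also have "\<dots> \<simeq> y * (if d = c then N v c else 0)"
    using N_mult[OF assms(1,1) assms(2) d] by (intro eqG_mult eqG_refl) (auto split: if_splits)
  also have "\<dots> \<simeq> (if d = c then y else 0)" using assms(3) by simp
  finally show "y * N v d \<simeq> (if d = c then y else 0)" .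
qed

lemma VV_mult:
  assumes "u \<in> verts E" "v \<in> verts E"
  shows "VV u * VV v \<simeq> (if u = v then VV u else 0)"
proof (cases "u = v")
  case True
  have "VV u * VV u = (\<Sum>c\<in>parts u. VV u * N u c)" by (simp add: VV_def[of u] sum_distrib_left)
  also have "\<dots> \<simeq> (\<Sum>c\<in>parts u. N u c)"
  proof (rule eqG_sum)
    fix c assume "c \<in> parts u"
    then show "VV u * N u c \<simeq> N u c"
      using N_mult[OF assms(1,1), of c c] by (intro VV_left[OF assms(1)]) auto
  qed
  finally show ?thesis using True by (simp add: VV_def)
next
  case False
  have "VV u * VV v = (\<Sum>c\<in>parts u. \<Sum>d\<in>parts v. N u c * N v d)"
    by (simp add: VV_def sum_product)
  also have "\<dots> \<simeq> (\<Sum>c\<in>parts u. \<Sum>d\<in>parts v. 0)"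
    using N_mult[OF assms] False by (intro eqG_sum) simp
  finally show ?thesis using False by simp
qed

lemma AB_absorb:
  assumes "e \<in> arcs E" "1 \<le> i" "i \<le> w e"
  shows "VV (src e) * A e i \<simeq> A e i" "A e i * VV (tgt e) \<simeq> A e i"
    "VV (tgt e) * B e i \<simeq> B e i" "B e i * VV (src e) \<simeq> B e i"
proof -
  have ix: "ix e i c" if "c \<in> copies e i" for c using that assms by (simp add: ix_def)
  note s = src_vert[OF assms(1)] and t = tgt_vert[OF assms(1)]
  show "VV (src e) * A e i \<simeq> A e i"
    unfolding A_def sum_distrib_left by (intro eqG_sum VV_left[OF s zero_in_parts ab_absorb(1)[OF ix]])
  show "A e i * VV (tgt e) \<simeq> A e i"
    unfolding A_def sum_distrib_right by (intro eqG_sum VV_right[OF t ix_parts[OF ix] ab_absorb(2)[OF ix]])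
  show "VV (tgt e) * B e i \<simeq> B e i"
    unfolding B_def sum_distrib_left by (intro eqG_sum VV_left[OF t ix_parts[OF ix] ab_absorb(3)[OF ix]])
  show "B e i * VV (src e) \<simeq> B e i"
    unfolding B_def sum_distrib_right by (intro eqG_sum VV_right[OF s zero_in_parts ab_absorb(4)[OF ix]])
qed

lemma BA_mult:
  assumes "e \<in> arcs E" "1 \<le> i" "i \<le> w e" "f \<in> arcs E" "1 \<le> j" "j \<le> w f"
  shows "B e i * A f j \<simeq> (if e = f \<and> i = j then \<Sum>c\<in>copies e i. N (tgt e) c else 0)"
proof -
  have "B e i * A f j = (\<Sum>c\<in>copies e i. \<Sum>d\<in>copies f j. b e i c * a f j d)"
    by (simp add: A_def B_def sum_product)
  also have "\<dots> \<simeq> (\<Sum>c\<in>copies e i. \<Sum>d\<in>copies f j. if e = f \<and> i = j \<and> c = d then N (tgt e) c else 0)"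
    using assms by (intro eqG_sum ghost_edge_copies) (simp_all add: ix_def)
  also have "\<dots> = (if e = f \<and> i = j then \<Sum>c\<in>copies e i. N (tgt e) c else 0)"
    by (cases "e = f \<and> i = j") (auto intro: sum.cong)
  finally show ?thesis .
qed

text \<open>The mixed terms vanish because different parts of the range are orthogonal.\<close>

lemma AB_mult:
  assumes "e \<in> arcs E" "1 \<le> i" "i \<le> w e"
  shows "A e i * B e i \<simeq> (\<Sum>c\<in>copies e i. a e i c * b e i c)"
proof -
  have "A e i * B e i = (\<Sum>c\<in>copies e i. \<Sum>d\<in>copies e i. a e i c * b e i d)"
    by (simp add: A_def B_def sum_product)
  also have "\<dots> \<simeq> (\<Sum>c\<in>copies e i. a e i c * b e i c)"
  proof (intro eqG_sum sum_mult_delta finite_copies)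
    fix c d assume cd: "c \<in> copies e i" "d \<in> copies e i"
    then have ix: "ix e i c" "ix e i d" using assms by (simp_all add: ix_def)
    show "a e i c * b e i d \<simeq> (if d = c then a e i c * b e i c else 0)"
    proof (cases "d = c")
      case False
      have "a e i c * b e i d \<simeq> 0"
        using N_mult[OF tgt_vert tgt_vert, OF assms(1) assms(1) ix_parts ix_parts, OF ix] False
        by (intro G_mult_zero[OF ab_absorb(2)[OF ix(1)] ab_absorb(3)[OF ix(2)]]) simp
      with False show ?thesis by simp
    qed simp
  qed
  finally show ?thesis .
qed

text \<open>The reversed copy of index 1 ends in part 1 of the split vertex, while the edges kept in
  their direction start in part 0 of it.\<close>

lemma AB_orthogonal:
  assumes "e \<in> reversed" "f \<in> arcs E" "f \<notin> reversed" "tail E f = tail E e"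
  shows "A e 1 * A f 1 \<simeq> 0" "B f 1 * B e 1 \<simeq> 0"
proof -
  have s: "split (tail E e)" using split_other[of e f] assms by auto
  then have c: "copies e 1 = {1}" "1 \<in> parts (tail E e)" using assms by (simp_all add: copies_def parts_def)
  have ixe: "ix e 1 1" using c assms w_ge_1[of e] rev_arc by (simp add: ix_def)
  have ixf: "ix f 1 d" if "d \<in> copies f 1" for d using that assms w_ge_1[of f] by (simp add: ix_def)
  have v: "tail E e \<in> verts E" using rev_arc[OF assms(1)] by simp
  have st: "tgt e = tail E e" "src f = tail E e" using assms by (simp_all add: tgt_def src_def)
  have "A e 1 * A f 1 = (\<Sum>d\<in>copies f 1. a e 1 1 * a f 1 d)"
    by (simp add: A_def c sum_distrib_left)
  also have "\<dots> \<simeq> (\<Sum>d\<in>copies f 1. 0)"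
  proof (rule eqG_sum)
    fix d assume d: "d \<in> copies f 1"
    have "N (tail E e) 1 * N (tail E e) 0 \<simeq> 0" using N_mult[OF v v c(2) zero_in_parts] by simp
    then show "a e 1 1 * a f 1 d \<simeq> 0"
      using G_mult_zero[OF ab_absorb(2)[OF ixe] ab_absorb(1)[OF ixf[OF d]]] st by metis
  qed
  finally show "A e 1 * A f 1 \<simeq> 0" by simp
  have "B f 1 * B e 1 = (\<Sum>d\<in>copies f 1. b f 1 d * b e 1 1)"
    by (simp add: B_def c sum_distrib_right)
  also have "\<dots> \<simeq> (\<Sum>d\<in>copies f 1. 0)"
  proof (rule eqG_sum)
    fix d assume d: "d \<in> copies f 1"
    have "N (tail E e) 0 * N (tail E e) 1 \<simeq> 0" using N_mult[OF v v zero_in_parts c(2)] by simp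
    then show "b f 1 d * b e 1 1 \<simeq> 0"
      using G_mult_zero[OF ab_absorb(4)[OF ixf[OF d]] ab_absorb(3)[OF ixe]] st by metis
  qed
  finally show "B f 1 * B e 1 \<simeq> 0" by simp
qed

text \<open>For a reversed edge the roles of edges and ghost edges are exchanged.\<close>

fun h :: "('v, 'e) wleavitt_gen \<Rightarrow> (('v, 'e) label, ('v, 'e) label) leavitt_gen fmon \<Rightarrow>\<^sub>0 'k" where
  "h (WVertex v) = VV v"
| "h (WEdge e i) = (if e \<in> reversed then B e i else A e i)"
| "h (WGhost e i) = (if e \<in> reversed then A e i else B e i)"

lemma hom_wedge: "free_hom h (X e i) = (if i \<le> w e then h (WEdge e i) else 0)"
  and hom_wghost: "free_hom h (Y e i) = (if i \<le> w e then h (WGhost e i) else 0)"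
  by (simp_all add: wedge_def wghost_def del: h.simps)

lemma sum_first:
  fixes g :: "nat \<Rightarrow> 'z::comm_monoid_add"
  assumes "1 \<le> n" "\<And>i. 1 < i \<Longrightarrow> g i = 0"
  shows "(\<Sum>i = 1..n. g i) = g 1"
proof -
  have "(\<Sum>i = 1..n. g i) = (\<Sum>i\<in>{1}. g i)"
    using assms by (intro sum.mono_neutral_right) auto
  then show ?thesis by simp
qed

lemma sum_upto:
  fixes g :: "nat \<Rightarrow> 'z::comm_monoid_add"
  assumes "m \<le> n" "\<And>i. m < i \<Longrightarrow> g i = 0"
  shows "(\<Sum>i = 1..n. g i) = (\<Sum>i = 1..m. g i)"
  using assms by (intro sum.mono_neutral_right) auto

text \<open>For a reversed edge e = f this is relation (iv) of \<open>F\<close> at r(e). In all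
  other cases one of the edges has weight 1, so only the term i = 1 remains, and its value comes
  from relation (iii) of \<open>F\<close> or from \<open>AB_orthogonal\<close>.\<close>

lemma h_ghost_edge:
  assumes "e \<in> arcs E" "f \<in> arcs E" "tail E e = tail E f"
  shows "(\<Sum>i = 1..vw (tail E e). free_hom h (Y e i) * free_hom h (X f i))
    \<simeq> (if e = f then VV (head E e) else 0)"
proof (cases "e \<in> reversed \<and> f = e")
  case True
  then have e: "e \<in> reversed" by simp
  have "(\<Sum>i = 1..vw (tail E e). free_hom h (Y e i) * free_hom h (X f i)) = (\<Sum>i = 1..w e. A e i * B e i)"
    using True w_le_vw[OF assms(1)]
    by (subst sum_upto[of "w e"]) (auto simp: hom_wedge hom_wghost intro!: sum.cong)
  also have "\<dots> \<simeq> (\<Sum>i = 1..w e. \<Sum>c\<in>copies e i. a e i c * b e i c)"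
    using assms by (intro eqG_sum AB_mult) auto
  also have "\<dots> \<simeq> N (head E e) 0" by (rule edge_ghost_copies_reversed[OF e])
  finally show ?thesis using True parts_head_rev[OF e] by (simp add: VV_def)
next
  case False
  then have nr: "e \<notin> reversed \<or> f \<notin> reversed" using rev_unique[of e f] assms by auto
  have w: "i \<le> 1" if "i \<le> w e" "i \<le> w f" for i
    using nr that not_rev_weight assms by (metis)
  have "(\<Sum>i = 1..vw (tail E e). free_hom h (Y e i) * free_hom h (X f i)) =
      h (WGhost e 1) * h (WEdge f 1)"
    using w w_le_vw[OF assms(1)] w_ge_1[OF assms(1)] w_ge_1[OF assms(2)]
    by (subst sum_first) (force simp: hom_wedge hom_wghost)+
  also have "\<dots> \<simeq> (if e = f then VV (head E e) else 0)"
  proof (cases "e \<in> reversed \<or> f \<in> reversed")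
    case True
    then show ?thesis using AB_orthogonal[of e f] AB_orthogonal[of f e] nr assms by auto
  next
    case nn: False
    then have "copies e 1 = parts (head E e)" "tgt e = head E e" by (simp_all add: copies_def tgt_def)
    then show ?thesis
      using BA_mult[of e 1 f 1] nn assms w_ge_1 by (cases "e = f") (simp_all add: VV_def)
  qed
  finally show ?thesis .
qed

text \<open>For i = j the reversed edge at v contributes all parts of v, except that at a split
  vertex with i = j = 1 it contributes part 1 only. The edges in \<open>T\<close> have weight 1 and
  supply the missing part 0 exactly there. Without a reversed edge, v is not split and
  \<open>T\<close> alone gives its only part.\<close>

lemma h_edge_ghost:
  assumes "i \<in> {1..vw v}" "j \<in> {1..vw v}"
  shows "(\<Sum>e\<in>out_arcs E v. free_hom h (X e i) * free_hom h (Y e j)) \<simeq> (if i = j then VV v else 0)"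
proof -
  define T where "T = {f. f \<in> out_arcs E v \<and> f \<notin> reversed}"
  have Tsum: "(\<Sum>f\<in>T. free_hom h (X f i) * free_hom h (Y f j)) \<simeq> (if i = 1 \<and> j = 1 \<and> T \<noteq> {} then N v 0 else 0)"
  proof (cases "i = 1 \<and> j = 1 \<and> T \<noteq> {}")
    case True
    then obtain f0 where f0: "f0 \<in> arcs E" "f0 \<notin> reversed" "tail E f0 = v" by (auto simp: T_def)
    have "(\<Sum>f\<in>T. free_hom h (X f i) * free_hom h (Y f j)) = (\<Sum>f\<in>T. A f 1 * B f 1)"
      using True w_ge_1 by (intro sum.cong) (auto simp: T_def hom_wedge hom_wghost)
    also have "\<dots> \<simeq> (\<Sum>f\<in>T. \<Sum>c\<in>copies f 1. a f 1 c * b f 1 c)"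
      using w_ge_1 by (intro eqG_sum AB_mult) (auto simp: T_def)
    also have "\<dots> \<simeq> N v 0" using edge_ghost_copies_kept[OF f0(1,2)] f0(3) by (simp add: T_def)
    finally show ?thesis using True by simp
  next
    case False
    have "(\<Sum>f\<in>T. free_hom h (X f i) * free_hom h (Y f j)) = (\<Sum>f\<in>T. 0)"
    proof (rule sum.cong[OF refl])
      fix f assume "f \<in> T"
      then have "w f = 1" using not_rev_weight by (auto simp: T_def)
      moreover have "1 < i \<or> 1 < j" using False \<open>f \<in> T\<close> assms by auto
      ultimately show "free_hom h (X f i) * free_hom h (Y f j) = 0" by (auto simp: hom_wedge hom_wghost)
    qed
    also have "\<dots> \<simeq> (if i = 1 \<and> j = 1 \<and> T \<noteq> {} then N v 0 else 0)"
      by (simp only: False if_False sum.neutral_const eqG_refl)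
    finally show ?thesis .
  qed
  show ?thesis
  proof (cases "\<exists>e\<in>reversed. tail E e = v")
    case False
    then have nr: "f \<notin> reversed" if "tail E f = v" for f using that by blast
    have T: "out_arcs E v = T" using nr by (auto simp: T_def)
    have "vw v = 1" using vw_not_rev[OF assms(1)] False by blast
    then have ij: "i = 1" "j = 1" using assms by auto
    obtain e where "e \<in> arcs E" "tail E e = v" using vw_attained[OF assms(1)] by blast
    then have "T \<noteq> {}" using T by auto
    moreover have "\<not> split v" using False by (auto simp: split_def)
    ultimately show ?thesis using Tsum ij by (simp add: T VV_def parts_def)
  next
    case True
    then obtain e where e: "e \<in> reversed" and te: "tail E e = v" by blast
    have ea: "e \<in> arcs E" using rev_arc[OF e] .
    have vwe: "vw v = w e" using vw_rev[OF e] te by simp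
    have tgt: "tgt e = v" using e te by (simp add: tgt_def)
    have T: "out_arcs E v = insert e T" "e \<notin> T"
    proof -
      have "f = e" if "f \<in> out_arcs E v" "f \<in> reversed" for f
        using rev_unique[OF e that(2)] that(1) unfolding te by simp
      moreover have "e \<in> out_arcs E v" using ea te by simp
      ultimately show "out_arcs E v = insert e T" unfolding T_def by blast
    qed (simp add: T_def e)
    have fT: "finite T" using T(1) finite_out[of v] by simp
    have Tsplit: "T \<noteq> {} \<longleftrightarrow> split v"
    proof
      assume "T \<noteq> {}"
      then obtain f where "f \<in> arcs E" "tail E f = v" "f \<notin> reversed" by (auto simp: T_def)
      then show "split v" using split_other[OF e, of f] te e by metis
    next
      assume "split v"
      then obtain e' f where "e' \<in> reversed" "f \<in> arcs E" "tail E e' = v" "tail E f = v" "f \<noteq> e'"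
        by (auto simp: split_def)
      then have "f \<in> T" using split_other[of e' f] by (simp add: T_def)
      then show "T \<noteq> {}" by blast
    qed
    have "free_hom h (X e i) * free_hom h (Y e j) = B e i * A e j"
      using assms vwe e by (simp add: hom_wedge hom_wghost)
    also have "\<dots> \<simeq> (if i = j then \<Sum>c\<in>copies e i. N v c else 0)"
      using BA_mult[of e i e j] ea assms vwe tgt by (cases "i = j") simp_all
    finally have "(\<Sum>e\<in>out_arcs E v. free_hom h (X e i) * free_hom h (Y e j)) \<simeq>
        (if i = j then \<Sum>c\<in>copies e i. N v c else 0) + (if i = 1 \<and> j = 1 \<and> T \<noteq> {} then N v 0 else 0)"
      unfolding T(1) sum.insert[OF fT T(2)] by (intro eqG_add Tsum)
    also have "\<dots> = (if i = j then VV v else 0)"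
      using Tsplit e te tgt by (auto simp: copies_def VV_def parts_def)
    finally show ?thesis .
  qed
qed

end

section \<open>Counterparts in the weighted algebra of the vertices and edges of the reversed
  graph\<close>

context good_graph begin

lemma eqW_mid: "y \<approx> y' \<Longrightarrow> x * y * z \<approx> x * y' * z"
  by (intro eqW_mult eqW_refl)

lemma W_sum_single:
  assumes "finite S" "e \<in> S" "\<And>f. f \<in> S \<Longrightarrow> f \<noteq> e \<Longrightarrow> g f = 0"
  shows "sum g S = g e"
  using assms by (subst sum.remove[of S e]) auto

lemma rev_range: "e \<in> reversed \<Longrightarrow> 1 \<le> i \<Longrightarrow> i \<le> w e \<Longrightarrow> i \<in> {1..vw (tail E e)}"
  by (simp add: vw_rev)

text \<open>The companions of a reversed edge have weight 1, so they enter relation (iv) only for i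
  = j = 1. In every other case, or without companions, the sum consists of the term of
  \<open>e\<close> alone.\<close>

lemma W_XY:
  assumes "e \<in> reversed" "1 \<le> i" "i \<le> w e" "1 \<le> j" "j \<le> w e" "\<not> split (tail E e) \<or> i \<noteq> 1 \<or> j \<noteq> 1"
  shows "X e i * Y e j \<approx> (if i = j then V (tail E e) else 0)"
proof -
  have e: "e \<in> out_arcs E (tail E e)" using rev_arc[OF assms(1)] by simp
  have "X f i * Y f j = 0" if "f \<in> out_arcs E (tail E e)" "f \<noteq> e" for f
  proof -
    have "split (tail E e) \<and> f \<notin> reversed" using that assms(1) by (intro split_other) auto
    moreover from this have "w f = 1" using that not_rev_weight[of f] by auto
    ultimately show ?thesis using assms by (auto simp: wedge_def wghost_def)
  qed
  then have "(\<Sum>f\<in>out_arcs E (tail E e). X f i * Y f j) = X e i * Y e j"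
    by (intro W_sum_single e finite_out)
  then show ?thesis
    using W_edge_ghost[OF rev_range rev_range, OF assms(1,2,3) assms(1,4,5)] by simp
qed

lemma W_YX:
  assumes "e \<in> reversed"
  shows "(\<Sum>i = 1..w e. Y e i * X e i) \<approx> V (head E e)"
  using W_ghost_edge[of e e] rev_arc[OF assms] vw_rev[OF assms] by simp

lemma W_YX_light:
  assumes "e \<in> arcs E" "f \<in> arcs E" "tail E e = tail E f" "e \<notin> reversed \<or> f \<notin> reversed"
  shows "Y e 1 * X f 1 \<approx> (if e = f then V (head E e) else 0)"
proof -
  have w: "w e = 1 \<or> w f = 1" using assms not_rev_weight by blast
  have "(\<Sum>i = 1..vw (tail E e). Y e i * X f i) = Y e 1 * X f 1"
    using w w_le_vw[OF assms(1)] w_ge_1[OF assms(1)]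
    by (subst sum_first) (auto simp: wedge_def wghost_def)
  then show ?thesis using W_ghost_edge[OF assms(1,2,3)] by simp
qed

lemma W_XY_light:
  assumes "e \<in> arcs E" "tail E e = v" "\<not> (\<exists>e\<in>reversed. tail E e = v)"
  shows "(\<Sum>f\<in>out_arcs E v. X f 1 * Y f 1) \<approx> V v"
  using W_edge_ghost[of 1 v 1] w_le_vw[OF assms(1)] w_ge_1[OF assms(1)] assms(2) by simp

lemma W_XY_split:
  assumes "e \<in> reversed"
  shows "X e 1 * Y e 1 + (\<Sum>f | f \<in> out_arcs E (tail E e) \<and> f \<notin> reversed. X f 1 * Y f 1) \<approx> V (tail E e)"
proof -
  let ?T = "{f. f \<in> out_arcs E (tail E e) \<and> f \<notin> reversed}"
  have T: "out_arcs E (tail E e) = insert e ?T" "e \<notin> ?T" "finite ?T"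
  proof -
    show "out_arcs E (tail E e) = insert e ?T"
    proof (intro equalityI subsetI)
      fix f assume "f \<in> out_arcs E (tail E e)"
      then show "f \<in> insert e ?T" using rev_unique[OF assms, of f] by auto
    qed (use rev_arc[OF assms] in auto)
    show "finite ?T" by (rule finite_subset[OF _ finite_out[of "tail E e"]]) blast
  qed (use assms in auto)
  have "(\<Sum>f\<in>out_arcs E (tail E e). X f 1 * Y f 1) \<approx> V (tail E e)"
    using W_edge_ghost[of 1 "tail E e" 1] rev_range[OF assms, of 1] w_ge_1[OF rev_arc[OF assms]]
    by simp
  then show ?thesis using T(2,3) by (subst (asm) T(1)) simp
qed

text \<open>Multiplying relation (iii) for e by e_1 on the left leaves only the term i = 1, since
  e_1 e_i^* = 0 for i > 1; the second law is symmetric. In particular e_1 e_1^* is idempotent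
  although e has companions.\<close>

lemma W_XYX:
  assumes "e \<in> reversed" "split (tail E e)"
  shows "X e 1 * Y e 1 * X e 1 \<approx> X e 1" "Y e 1 * X e 1 * Y e 1 \<approx> Y e 1"
proof -
  note ea = rev_arc[OF assms(1)] and w1 = w_ge_1[OF rev_arc[OF assms(1)]]
  have "X e 1 * Y e 1 * X e 1 = (\<Sum>i = 1..w e. X e 1 * Y e i * X e i) - (\<Sum>i = 2..w e. X e 1 * Y e i * X e i)"
    using sum.atLeast_Suc_atMost[of 1 "w e" "\<lambda>i. X e 1 * Y e i * X e i"] w1 by (simp add: numeral_2_eq_2 One_nat_def)
  also have "\<dots> \<approx> (\<Sum>i = 1..w e. X e 1 * Y e i * X e i) - (\<Sum>i = 2..w e. 0 * X e i)"
  proof (intro eqW_diff eqW_sum eqW_mult eqW_refl)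
    fix i assume "i \<in> {2..w e}"
    then show "X e 1 * Y e i \<approx> 0" using W_XY[OF assms(1), of 1 i] by simp
  qed
  also have "\<dots> = X e 1 * (\<Sum>i = 1..w e. Y e i * X e i)" by (simp add: sum_distrib_left mult.assoc)
  also have "\<dots> \<approx> X e 1 * V (head E e)" by (intro eqW_mult eqW_refl W_YX[OF assms(1)])
  also have "\<dots> \<approx> X e 1" by (rule W_edge[OF ea]) simp
  finally show "X e 1 * Y e 1 * X e 1 \<approx> X e 1" .
  have "Y e 1 * X e 1 * Y e 1 = (\<Sum>i = 1..w e. Y e i * X e i * Y e 1) - (\<Sum>i = 2..w e. Y e i * X e i * Y e 1)"
    using sum.atLeast_Suc_atMost[of 1 "w e" "\<lambda>i. Y e i * X e i * Y e 1"] w1 by (simp add: numeral_2_eq_2 One_nat_def)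
  also have "\<dots> \<approx> (\<Sum>i = 1..w e. Y e i * X e i * Y e 1) - (\<Sum>i = 2..w e. Y e i * 0)"
    unfolding mult.assoc
  proof (intro eqW_diff eqW_sum eqW_mult eqW_refl)
    fix i assume "i \<in> {2..w e}"
    then show "X e i * Y e 1 \<approx> 0" using W_XY[OF assms(1), of i 1] by simp
  qed
  also have "\<dots> = (\<Sum>i = 1..w e. Y e i * X e i) * Y e 1" by (simp add: sum_distrib_right)
  also have "\<dots> \<approx> V (head E e) * Y e 1" by (intro eqW_mult eqW_refl W_YX[OF assms(1)])
  also have "\<dots> \<approx> Y e 1" by (rule W_edge[OF ea]) simp
  finally show "Y e 1 * X e 1 * Y e 1 \<approx> Y e 1" .
qed

text \<open>The idempotents into which \<open>v\<close> splits, for \<open>c\<close> equal to 0 or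
  1. The chosen edge is the only reversed edge at \<open>v\<close>, so the choice has no
  influence.\<close>

definition q :: "'v \<Rightarrow> nat \<Rightarrow> ('v, 'e) wleavitt_gen fmon \<Rightarrow>\<^sub>0 'k" where
  "q v c = (if split v then let e = (SOME e. e \<in> reversed \<and> tail E e = v) in
     if c = 1 then X e 1 * Y e 1 else V v - X e 1 * Y e 1 else V v)"

lemma q_split:
  assumes "e \<in> reversed" "split (tail E e)"
  shows "q (tail E e) 1 = X e 1 * Y e 1" "q (tail E e) 0 = V (tail E e) - X e 1 * Y e 1"
proof -
  have "(SOME f. f \<in> reversed \<and> tail E f = tail E e) = e"
    by (rule some_equality) (use assms rev_unique in auto)
  then show "q (tail E e) 1 = X e 1 * Y e 1" "q (tail E e) 0 = V (tail E e) - X e 1 * Y e 1"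
    using assms by (simp_all add: q_def)
qed

lemma q_not_split: "\<not> split v \<Longrightarrow> q v c = V v"
  by (simp add: q_def)

lemma sum_q: "(\<Sum>c\<in>parts v. q v c) = V v"
  by (simp add: parts_def q_def Let_def)

lemma split_rev:
  assumes "split v"
  obtains e where "e \<in> reversed" "tail E e = v"
  using assms by (auto simp: split_def)

lemma Vq:
  assumes "v \<in> verts E"
  shows "V v * q v c \<approx> q v c" "q v c * V v \<approx> q v c"
proof -
  have V: "V v * V v \<approx> V v" using W_vertices[OF assms assms] by simp
  have "V v * q v c \<approx> q v c \<and> q v c * V v \<approx> q v c"
  proof (cases "split v")
    case True
    then obtain e where e: "e \<in> reversed" "tail E e = v" by (rule split_rev)
    note W = W_edge[OF rev_arc[OF e(1)], of 1, unfolded e(2)]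
    have l: "V v * (X e 1 * Y e 1) \<approx> X e 1 * Y e 1"
      unfolding mult.assoc[symmetric] by (intro eqW_mult eqW_refl W) simp
    have r: "X e 1 * Y e 1 * V v \<approx> X e 1 * Y e 1"
      unfolding mult.assoc by (intro eqW_mult eqW_refl W) simp
    have "q v c = X e 1 * Y e 1 \<or> q v c = V v - X e 1 * Y e 1"
      using True q_split[OF e(1)] e(2) by (auto simp: q_def Let_def)
    then show ?thesis
      using l r eqW_diff[OF V l] eqW_diff[OF V r] by (auto simp: right_diff_distrib left_diff_distrib)
  qed (use V in \<open>simp add: q_not_split\<close>)
  then show "V v * q v c \<approx> q v c" "q v c * V v \<approx> q v c" by auto
qed

lemma qq:
  assumes "v \<in> verts E" "c \<in> parts v" "d \<in> parts v"
  shows "q v c * q v d \<approx> (if c = d then q v c else 0)"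
proof (cases "split v")
  case True
  then obtain e where e: "e \<in> reversed" "tail E e = v" by (rule split_rev)
  let ?p = "X e 1 * Y e 1"
  have V: "V v * V v \<approx> V v" using W_vertices[OF assms(1,1)] by simp
  have q: "q v 1 = ?p" "q v 0 = V v - ?p" using q_split[OF e(1)] e(2) True by auto
  have p: "V v * ?p \<approx> ?p" "?p * V v \<approx> ?p" using Vq[OF assms(1), of 1] by (simp_all add: q)
  have pp: "?p * ?p \<approx> ?p"
    using eqW_mult[OF W_XYX(1)[OF e(1)] eqW_refl[of "Y e 1"]] True e(2) by (simp add: mult.assoc)
  have "V v * V v - V v * ?p - (?p * V v - ?p * ?p) \<approx> V v - ?p - (?p - ?p)"
    by (intro eqW_diff V p pp)
  moreover have "?p * V v - ?p * ?p \<approx> ?p - ?p" "V v * ?p - ?p * ?p \<approx> ?p - ?p"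
    by (intro eqW_diff p pp)+
  moreover have "c = 0 \<or> c = 1" "d = 0 \<or> d = 1" using assms True by (auto simp: parts_def)
  ultimately show ?thesis
    using pp by (elim disjE) (simp_all add: q algebra_simps)
next
  case False
  then show ?thesis
    using W_vertices[OF assms(1,1)] assms by (simp add: q_not_split parts_def)
qed

lemma qq_distinct:
  assumes "u \<in> verts E" "v \<in> verts E" "u \<noteq> v"
  shows "q u c * q v d \<approx> 0"
  using W_vertices[OF assms(1,2)] assms(3)
  by (intro W_mult_zero[OF Vq(2)[OF assms(1)] Vq(1)[OF assms(2)]]) simp

text \<open>The edge of the reversed graph, before its range is split, as an element of the weighted
  algebra; \<open>Zs\<close> is its ghost.\<close>

definition Z :: "'e \<Rightarrow> nat \<Rightarrow> ('v, 'e) wleavitt_gen fmon \<Rightarrow>\<^sub>0 'k" where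
  "Z e i = (if e \<in> reversed then Y e i else X e i)"
definition Zs :: "'e \<Rightarrow> nat \<Rightarrow> ('v, 'e) wleavitt_gen fmon \<Rightarrow>\<^sub>0 'k" where
  "Zs e i = (if e \<in> reversed then X e i else Y e i)"

lemma VZ:
  assumes "e \<in> arcs E" "1 \<le> i"
  shows "V (src e) * Z e i \<approx> Z e i" "Z e i * V (tgt e) \<approx> Z e i"
    "V (tgt e) * Zs e i \<approx> Zs e i" "Zs e i * V (src e) \<approx> Zs e i"
  using W_edge[OF assms] by (auto simp: src_def tgt_def Z_def Zs_def)

text \<open>An edge e with a split source is a companion of the reversed edge f there. Then f_1^*
  e_1 and e_1^* f_1 vanish by relation (iii), so subtracting f_1 f_1^* from the vertex changes
  nothing.\<close>

lemma qZ:
  assumes "e \<in> arcs E" "1 \<le> i" "i \<le> w e"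
  shows "q (src e) 0 * Z e i \<approx> Z e i" "Zs e i * q (src e) 0 \<approx> Zs e i"
proof -
  have "q (src e) 0 * Z e i \<approx> Z e i \<and> Zs e i * q (src e) 0 \<approx> Zs e i"
  proof (cases "split (src e)")
    case True
    then have e: "e \<notin> reversed" using rev_head_not_split[of e] by (auto simp: src_def)
    then have i: "i = 1" and s: "src e = tail E e" using not_rev_weight assms by (auto simp: src_def)
    obtain f where f: "f \<in> reversed" "tail E f = tail E e" using True s by (metis split_rev)
    then have ne: "f \<noteq> e" using e by auto
    have q: "q (src e) 0 = V (tail E e) - X f 1 * Y f 1" using q_split(2)[OF f(1)] True s f(2) by simp
    have z: "Y f 1 * X e 1 \<approx> 0" "Y e 1 * X f 1 \<approx> 0"
      using W_YX_light[of f e] W_YX_light[of e f] f e ne rev_arc assms by auto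
    have "V (tail E e) * X e 1 - X f 1 * (Y f 1 * X e 1) \<approx> X e 1 - X f 1 * 0"
      using W_edge(1)[OF assms(1)] by (intro eqW_diff eqW_mult z eqW_refl) simp
    moreover have "Y e 1 * V (tail E e) - (Y e 1 * X f 1) * Y f 1 \<approx> Y e 1 - 0 * Y f 1"
      using W_edge(4)[OF assms(1)] by (intro eqW_diff eqW_mult z eqW_refl) simp
    ultimately show ?thesis
      using e by (simp add: q i Z_def Zs_def left_diff_distrib right_diff_distrib mult.assoc)
  qed (use VZ[OF assms(1,2)] in \<open>simp add: q_not_split\<close>)
  then show "q (src e) 0 * Z e i \<approx> Z e i" "Zs e i * q (src e) 0 \<approx> Zs e i" by auto
qed

text \<open>If \<open>copies e i\<close> contains all parts, the idempotents add up to the vertex.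
  In the exceptional case only e_1 e_1^* is left, and \<open>W_XYX\<close> is the absorption law for
  it.\<close>

lemma Zq:
  assumes "e \<in> arcs E" "1 \<le> i" "i \<le> w e"
  shows "Z e i * (\<Sum>c\<in>copies e i. q (tgt e) c) \<approx> Z e i"
    "(\<Sum>c\<in>copies e i. q (tgt e) c) * Zs e i \<approx> Zs e i"
proof -
  have "Z e i * (\<Sum>c\<in>copies e i. q (tgt e) c) \<approx> Z e i \<and>
    (\<Sum>c\<in>copies e i. q (tgt e) c) * Zs e i \<approx> Zs e i"
  proof (cases "e \<in> reversed \<and> i = 1 \<and> split (tail E e)")
    case True
    then show ?thesis
      using W_XYX[of e] q_split(1)[of e]
      by (simp add: copies_def tgt_def Z_def Zs_def mult.assoc)
  next
    case False
    then have "copies e i = parts (tgt e)" by (auto simp: copies_def)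
    then show ?thesis using VZ[OF assms(1,2)] by (simp add: sum_q)
  qed
  then show "Z e i * (\<Sum>c\<in>copies e i. q (tgt e) c) \<approx> Z e i"
    "(\<Sum>c\<in>copies e i. q (tgt e) c) * Zs e i \<approx> Zs e i" by auto
qed

lemma qVq:
  assumes "v \<in> verts E" "c \<in> parts v" "d \<in> parts v"
  shows "q v c * V v * q v d \<approx> (if c = d then q v c else 0)"
  using eqW_trans(1)[OF eqW_mult[OF Vq(2)[OF assms(1)] eqW_refl] qq[OF assms]] .

text \<open>For a reversed edge at a split vertex and i = j = 1, relation (iv) does not evaluate e_1
  e_1^* to the vertex. But there both copies carry part 1, and e_1 e_1^* is itself the idempotent of
  that part.\<close>

lemma ZsZ:
  assumes "ix e i c" "ix f j d" "src e = src f"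
  shows "q (tgt e) c * (Zs e i * Z f j) * q (tgt f) d \<approx>
    (if e = f \<and> i = j \<and> c = d then q (tgt e) c else 0)"
proof -
  have ef: "e \<in> arcs E" "f \<in> arcs E" "1 \<le> i" "i \<le> w e" "1 \<le> j" "j \<le> w f"
    using assms by (auto simp: ix_def)
  note t = tgt_vert[OF ef(1)]
  show ?thesis
  proof (cases "e \<in> reversed")
    case True
    then have f: "f = e" using same_src_rev ef assms by metis
    have tg: "tgt e = tail E e" using True by (simp add: tgt_def)
    have z: "Zs e i * Z f j = X e i * Y e j" using True f by (simp add: Z_def Zs_def)
    show ?thesis
    proof (cases "\<not> split (tail E e) \<or> i \<noteq> 1 \<or> j \<noteq> 1")
      case nt: True
      have "q (tgt e) c * (Zs e i * Z f j) * q (tgt f) d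
          \<approx> q (tgt e) c * (if i = j then V (tgt e) else 0) * q (tgt f) d"
        unfolding z tg by (intro eqW_mid W_XY True ef(3,4,5) nt) (use ef f in simp)
      also have "\<dots> \<approx> (if e = f \<and> i = j \<and> c = d then q (tgt e) c else 0)"
        using qVq[OF t ix_parts[OF assms(1)] ix_parts[OF assms(2), unfolded f]] f
        by (cases "i = j"; cases "c = d") simp_all
      finally show ?thesis .
    next
      case False
      then have s: "split (tail E e)" "i = 1" "j = 1" by auto
      then have c: "c = 1" "d = 1" using assms True f by (auto simp: ix_def copies_def)
      have p1: "1 \<in> parts (tail E e)" using s by (simp add: parts_def)
      have "q (tail E e) 1 * q (tail E e) 1 * q (tail E e) 1 \<approx> q (tail E e) 1 * q (tail E e) 1"
        using qq[OF t p1[folded tg] p1[folded tg]] tg by (intro eqW_mult eqW_refl) simp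
      also have "\<dots> \<approx> q (tail E e) 1" using qq[OF t p1[folded tg] p1[folded tg]] tg by simp
      finally show ?thesis using f s c tg q_split(1)[OF True s(1)] z by simp
    qed
  next
    case False
    then have nf: "f \<notin> reversed" using same_src_rev ef assms by metis
    have ij: "i = 1" "j = 1" using ef not_rev_weight[of e] not_rev_weight[of f] False nf by auto
    have tl: "tail E e = tail E f" using assms(3) False nf by (simp add: src_def)
    have tg: "tgt e = head E e" using False by (simp add: tgt_def)
    have "q (tgt e) c * (Zs e i * Z f j) * q (tgt f) d
          \<approx> q (tgt e) c * (if e = f then V (tgt e) else 0) * q (tgt f) d"
      using W_YX_light[OF ef(1,2) tl] False nf tg
      by (intro eqW_mid; cases "e = f") (simp_all add: Z_def Zs_def ij)
    also have "\<dots> \<approx> (if e = f \<and> i = j \<and> c = d then q (tgt e) c else 0)"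
      using qVq[OF t ix_parts[OF assms(1)], of d] ix_parts[OF assms(2)] ij by (cases "e = f") auto
    finally show ?thesis .
  qed
qed

text \<open>At the range of a reversed edge this is relation (iii) of that edge. At a vertex whose
  edges keep their direction it is relation (iv) for i = j = 1, with the term e_1 e_1^* of a
  reversed edge, if there is one, moved to the right; this is where part 0 comes from.\<close>

lemma ZZs:
  assumes "e0 \<in> arcs E"
  shows "(\<Sum>e | e \<in> arcs E \<and> src e = src e0. \<Sum>i = 1..w e. Z e i * Zs e i) \<approx> q (src e0) 0"
proof (cases "e0 \<in> reversed")
  case True
  then show ?thesis
    unfolding src_fiber_rev[OF True]
    using W_YX[OF True] rev_head_not_split[OF True] by (simp add: Z_def Zs_def src_def q_not_split)
next
  case False
  let ?v = "tail E e0"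
  let ?T = "{f \<in> out_arcs E ?v. f \<notin> reversed}"
  have "(\<Sum>e | e \<in> arcs E \<and> src e = src e0. \<Sum>i = 1..w e. Z e i * Zs e i) = (\<Sum>f\<in>?T. X f 1 * Y f 1)"
    unfolding src_fiber[OF assms False]
    by (rule sum.cong[OF refl]) (simp add: not_rev_weight Z_def Zs_def)
  also have "\<dots> \<approx> q ?v 0"
  proof (cases "\<exists>e\<in>reversed. tail E e = ?v")
    case True
    then obtain e where e: "e \<in> reversed" "tail E e = ?v" by blast
    then have s: "split ?v" using split_other[of e e0] assms False by auto
    have "X e 1 * Y e 1 + (\<Sum>f\<in>?T. X f 1 * Y f 1) - X e 1 * Y e 1 \<approx> V ?v - X e 1 * Y e 1"
      using W_XY_split[OF e(1)] e(2) by (intro eqW_diff eqW_refl) simp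
    then show ?thesis using q_split(2)[OF e(1)] s e(2) by simp
  next
    case nr: False
    then have "?T = out_arcs E ?v" by auto
    moreover have "\<not> split ?v" using nr by (auto simp: split_def)
    ultimately show ?thesis using W_XY_light[OF assms refl nr] by (simp add: q_not_split)
  qed
  finally show ?thesis using False by (simp add: src_def)
qed

text \<open>Division by 2 and its remainder decode index and part from a label; the factor
  \<open>q\<close> cuts the range down to that part.\<close>

fun k :: "(('v, 'e) label, ('v, 'e) label) leavitt_gen \<Rightarrow> ('v, 'e) wleavitt_gen fmon \<Rightarrow>\<^sub>0 'k" where
  "k (LVertex x) = q (projl (fst x)) (snd x)"
| "k (LEdge x) = Z (projr (fst x)) (snd x div 2) * q (tgt (projr (fst x))) (snd x mod 2)"
| "k (LGhost x) = q (tgt (projr (fst x))) (snd x mod 2) * Zs (projr (fst x)) (snd x div 2)"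

lemma k_ix:
  assumes "ix e i c"
  shows "k (LEdge (Inr e, 2 * i + c)) = Z e i * q (tgt e) c" "k (LGhost (Inr e, 2 * i + c)) = q (tgt e) c * Zs e i"
proof -
  have "(2 * i + c) div 2 = i" using copies_lt[of c e i] assms by (simp add: ix_def)
  then show "k (LEdge (Inr e, 2 * i + c)) = Z e i * q (tgt e) c"
    "k (LGhost (Inr e, 2 * i + c)) = q (tgt e) c * Zs e i"
    using ix_mod[OF assms] by simp_all
qed

end

section \<open>The two homomorphisms respect the relations and are mutually inverse\<close>

context good_graph begin

lemma VV_in: "v \<in> verts E \<Longrightarrow> VV v \<in> carrier (free_algebra (leavitt_gens F))"
  unfolding VV_def by (intro free_sum) (auto simp: free_gen leavitt_gens_def F_vert)

lemma A_in:
  assumes "e \<in> arcs E" "1 \<le> i" "i \<le> w e"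
  shows "A e i \<in> carrier (free_algebra (leavitt_gens F))" "B e i \<in> carrier (free_algebra (leavitt_gens F))"
  unfolding A_def B_def using assms ix_arc
  by (auto intro!: free_sum simp: free_gen leavitt_gens_def ix_def)

lemma h_in: "x \<in> wleavitt_gens E w \<Longrightarrow> h x \<in> carrier (free_algebra (leavitt_gens F))"
  by (auto simp: wleavitt_gens_def VV_in A_in)

lemma V_in: "v \<in> verts E \<Longrightarrow> V v \<in> carrier (free_algebra (wleavitt_gens E w))"
  by (simp add: free_gen wleavitt_gens_def)

lemma q_in: "v \<in> verts E \<Longrightarrow> q v c \<in> carrier (free_algebra (wleavitt_gens E w))"
proof -
  assume v: "v \<in> verts E"
  show ?thesis
  proof (cases "split v")
    case True
    then obtain e where e: "e \<in> reversed" "tail E e = v" by (rule split_rev)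
    have "X e 1 * Y e 1 \<in> carrier (free_algebra (wleavitt_gens E w))"
      using rev_arc[OF e(1)] by (intro free_mult wedge_in_C wghost_in_C) auto
    moreover have "q v c = X e 1 * Y e 1 \<or> q v c = V v - X e 1 * Y e 1"
      using True q_split[OF e(1)] e(2) by (auto simp: q_def Let_def)
    ultimately show ?thesis using V_in[OF v] by (auto intro: free_diff)
  qed (simp add: q_not_split V_in[OF v])
qed

lemma F_arcE:
  assumes "x \<in> arcs F"
  obtains e i c where "x = (Inr e, 2 * i + c)" "ix e i c"
  using assms by (auto simp: F_arcs ix_def)

lemma F_vertE:
  assumes "x \<in> verts F"
  obtains v c where "x = (Inl v, c)" "v \<in> verts E" "c \<in> parts v"
  using assms by (auto simp: F_verts)

lemma Z_in:
  assumes "e \<in> arcs E" "1 \<le> i"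
  shows "Z e i \<in> carrier (free_algebra (wleavitt_gens E w))"
    "Zs e i \<in> carrier (free_algebra (wleavitt_gens E w))"
  using assms by (simp_all add: Z_def Zs_def wedge_in_C wghost_in_C)

lemma k_in:
  assumes "x \<in> leavitt_gens F"
  shows "k x \<in> carrier (free_algebra (wleavitt_gens E w))"
  using assms unfolding leavitt_gens_def
proof (elim UnE imageE)
  fix v assume "x = LVertex v" "v \<in> verts F"
  then show ?thesis by (auto elim!: F_vertE intro: q_in)
next
  fix e assume e: "x = LEdge e" "e \<in> arcs F"
  from e(2) obtain f i c where "e = (Inr f, 2 * i + c)" and ix: "ix f i c" by (rule F_arcE)
  then have "k x = Z f i * q (tgt f) c" using k_ix(1)[OF ix] e by simp
  then show ?thesis using ix tgt_vert by (auto simp: ix_def intro!: free_mult Z_in q_in)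
next
  fix e assume e: "x = LGhost e" "e \<in> arcs F"
  from e(2) obtain f i c where "e = (Inr f, 2 * i + c)" and ix: "ix f i c" by (rule F_arcE)
  then have "k x = q (tgt f) c * Zs f i" using k_ix(2)[OF ix] e by simp
  then show ?thesis using ix tgt_vert by (auto simp: ix_def intro!: free_mult Z_in q_in)
qed

lemma h_edge:
  assumes "e \<in> arcs E" "1 \<le> i" "i \<le> w e"
  shows "VV (tail E e) * h (WEdge e i) \<simeq> h (WEdge e i)" "h (WEdge e i) * VV (head E e) \<simeq> h (WEdge e i)"
    "VV (head E e) * h (WGhost e i) \<simeq> h (WGhost e i)" "h (WGhost e i) * VV (tail E e) \<simeq> h (WGhost e i)"
  using AB_absorb[OF assms] by (auto simp: src_def tgt_def)

lemma eqG_J: "f \<simeq> g \<Longrightarrow> f - g \<in> presentation.J (leavitt_gens F) (leavitt_rels F)"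
  by (simp add: presentation.eqv_def[OF presF])

lemma eqW_J: "f \<approx> g \<Longrightarrow> f - g \<in> presentation.J (wleavitt_gens E w) (wleavitt_rels E w)"
  by (simp add: presentation.eqv_def[OF pres])

lemma h_rels:
  assumes "r \<in> wleavitt_rels E w"
  shows "free_hom h r \<in> presentation.J (leavitt_gens F) (leavitt_rels F :: (_ \<Rightarrow>\<^sub>0 'k) set)"
  using assms unfolding wleavitt_rels_def
proof (elim UnE CollectE exE conjE)
  fix u v assume "r = V u * V v - (if u = v then V u else 0)" "u \<in> verts E" "v \<in> verts E"
  then show ?thesis
    using eqG_J[OF VV_mult[of u v]] by (cases "u = v") (simp_all add: free_hom_diff free_hom_mult)
next
  fix e i assume "r = V (tail E e) * gen (WEdge e i) - gen (WEdge e i)" "e \<in> arcs E" "1 \<le> i" "i \<le> w e"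
  then show ?thesis
    using eqG_J[OF h_edge(1)[of e i]] by (simp add: free_hom_diff free_hom_mult del: h.simps(2,3))
next
  fix e i assume "r = gen (WEdge e i) * V (head E e) - gen (WEdge e i)" "e \<in> arcs E" "1 \<le> i" "i \<le> w e"
  then show ?thesis
    using eqG_J[OF h_edge(2)[of e i]] by (simp add: free_hom_diff free_hom_mult del: h.simps(2,3))
next
  fix e i assume "r = V (head E e) * gen (WGhost e i) - gen (WGhost e i)" "e \<in> arcs E" "1 \<le> i" "i \<le> w e"
  then show ?thesis
    using eqG_J[OF h_edge(3)[of e i]] by (simp add: free_hom_diff free_hom_mult del: h.simps(2,3))
next
  fix e i assume "r = gen (WGhost e i) * V (tail E e) - gen (WGhost e i)" "e \<in> arcs E" "1 \<le> i" "i \<le> w e"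
  then show ?thesis
    using eqG_J[OF h_edge(4)[of e i]] by (simp add: free_hom_diff free_hom_mult del: h.simps(2,3))
next
  fix v e f assume r: "r = (\<Sum>i = 1..vw v. Y e i * X f i) - (if e = f then V (head E e) else 0)"
    "v \<in> verts E" "e \<in> out_arcs E v" "f \<in> out_arcs E v"
  then have "e \<in> arcs E" "f \<in> arcs E" "tail E e = tail E f" "v = tail E e" by auto
  note ef = this
  have "free_hom h r = (\<Sum>i = 1..vw (tail E e). free_hom h (Y e i) * free_hom h (X f i))
      - (if e = f then VV (head E e) else 0)"
    unfolding r(1) ef(4) by (cases "e = f") (simp_all add: free_hom_diff free_hom_mult free_hom_sum)
  then show ?thesis using eqG_J[OF h_ghost_edge[OF ef(1,2,3)]] by simp
next
  fix v i j assume r: "r = (\<Sum>e\<in>out_arcs E v. X e i * Y e j) - (if i = j then V v else 0)"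
    "v \<in> verts E" "i \<in> {1..vw v}" "j \<in> {1..vw v}"
  have "free_hom h r = (\<Sum>e\<in>out_arcs E v. free_hom h (X e i) * free_hom h (Y e j))
      - (if i = j then VV v else 0)"
    unfolding r(1) by (cases "i = j") (simp_all add: free_hom_diff free_hom_mult free_hom_sum)
  then show ?thesis using eqG_J[OF h_edge_ghost[OF r(3,4)]] by simp
qed

lemma k_vert: "k (LVertex (Inl v, c)) = q v c"
  by simp

lemma q_idem: "v \<in> verts E \<Longrightarrow> c \<in> parts v \<Longrightarrow> q v c * q v c \<approx> q v c"
  using qq[of v c c] by simp

lemma k_edge:
  assumes "ix e i c"
  shows "q (src e) 0 * (Z e i * q (tgt e) c) \<approx> Z e i * q (tgt e) c"
    "Z e i * q (tgt e) c * q (tgt e) c \<approx> Z e i * q (tgt e) c"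
    "q (tgt e) c * (q (tgt e) c * Zs e i) \<approx> q (tgt e) c * Zs e i"
    "q (tgt e) c * Zs e i * q (src e) 0 \<approx> q (tgt e) c * Zs e i"
proof -
  have e: "e \<in> arcs E" "1 \<le> i" "i \<le> w e" using assms by (auto simp: ix_def)
  note q = q_idem[OF tgt_vert[OF e(1)] ix_parts[OF assms]]
  show "q (src e) 0 * (Z e i * q (tgt e) c) \<approx> Z e i * q (tgt e) c"
    unfolding mult.assoc[symmetric] by (intro eqW_mult eqW_refl qZ e)
  show "Z e i * q (tgt e) c * q (tgt e) c \<approx> Z e i * q (tgt e) c"
    unfolding mult.assoc by (intro eqW_mult eqW_refl q)
  show "q (tgt e) c * (q (tgt e) c * Zs e i) \<approx> q (tgt e) c * Zs e i"
    unfolding mult.assoc[symmetric] by (intro eqW_mult eqW_refl q)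
  show "q (tgt e) c * Zs e i * q (src e) 0 \<approx> q (tgt e) c * Zs e i"
    unfolding mult.assoc by (intro eqW_mult eqW_refl qZ e)
qed

text \<open>Idempotence merges the two inner factors, \<open>Zq\<close> removes the sum over the
  parts, and \<open>ZZs\<close> remains.\<close>

lemma k_sum:
  assumes "e0 \<in> arcs E"
  shows "(\<Sum>e | e \<in> arcs E \<and> src e = src e0. \<Sum>i = 1..w e. \<Sum>c\<in>copies e i.
      (Z e i * q (tgt e) c) * (q (tgt e) c * Zs e i)) \<approx> q (src e0) 0"
proof -
  have "(\<Sum>e | e \<in> arcs E \<and> src e = src e0. \<Sum>i = 1..w e. \<Sum>c\<in>copies e i.
      (Z e i * q (tgt e) c) * (q (tgt e) c * Zs e i)) \<approx>
    (\<Sum>e | e \<in> arcs E \<and> src e = src e0. \<Sum>i = 1..w e. Z e i * Zs e i)"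
  proof (intro eqW_sum)
    fix e i assume "e \<in> {e. e \<in> arcs E \<and> src e = src e0}" "i \<in> {1..w e}"
    then have e: "e \<in> arcs E" "1 \<le> i" "i \<le> w e" by auto
    have "(\<Sum>c\<in>copies e i. (Z e i * q (tgt e) c) * (q (tgt e) c * Zs e i)) \<approx>
        (\<Sum>c\<in>copies e i. Z e i * (q (tgt e) c * Zs e i))"
    proof (intro eqW_sum)
      fix c assume "c \<in> copies e i"
      then have ix: "ix e i c" using e by (simp add: ix_def)
      show "(Z e i * q (tgt e) c) * (q (tgt e) c * Zs e i) \<approx> Z e i * (q (tgt e) c * Zs e i)"
        using eqW_mult[OF eqW_refl[of "Z e i"] k_edge(3)[OF ix]] by (simp add: mult.assoc)
    qed
    also have "\<dots> = Z e i * ((\<Sum>c\<in>copies e i. q (tgt e) c) * Zs e i)"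
      by (simp add: sum_distrib_left sum_distrib_right)
    also have "\<dots> \<approx> Z e i * Zs e i" by (intro eqW_mult eqW_refl Zq e)
    finally show "(\<Sum>c\<in>copies e i. (Z e i * q (tgt e) c) * (q (tgt e) c * Zs e i)) \<approx> Z e i * Zs e i" .
  qed
  also have "\<dots> \<approx> q (src e0) 0" by (rule ZZs[OF assms])
  finally show ?thesis .
qed

lemma k_rels:
  assumes "r \<in> leavitt_rels F"
  shows "free_hom k r \<in> presentation.J (wleavitt_gens E w) (wleavitt_rels E w :: (_ \<Rightarrow>\<^sub>0 'k) set)"
  using assms unfolding leavitt_rels_def
proof (elim UnE CollectE exE conjE)
  fix x y assume r: "r = gen (LVertex x) * gen (LVertex y) - (if x = y then gen (LVertex x) else 0)"
    and "x \<in> verts F" "y \<in> verts F"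
  then obtain u c v d where xy: "x = (Inl u, c)" "u \<in> verts E" "c \<in> parts u"
    "y = (Inl v, d)" "v \<in> verts E" "d \<in> parts v" by (elim F_vertE) blast
  have "q u c * q v d \<approx> (if x = y then q u c else 0)"
    using qq[of u c d] qq_distinct[of u v c d] xy by (cases "u = v"; cases "c = d") auto
  moreover have "free_hom k r = q u c * q v d - (if x = y then q u c else 0)"
    unfolding r by (cases "u = v \<and> c = d") (auto simp: free_hom_diff free_hom_mult xy)
  ultimately show ?thesis using eqW_J by simp
next
  fix x assume r: "r = gen (LVertex (tail F x)) * gen (LEdge x) - gen (LEdge x)" and "x \<in> arcs F"
  then obtain e i c where x: "x = (Inr e, 2 * i + c)" "ix e i c" by (elim F_arcE)
  show ?thesis
    using eqW_J[OF k_edge(1)[OF x(2)]] unfolding r x(1)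
    by (simp only: free_hom_diff free_hom_mult free_hom_gen k_ix[OF x(2)] F_sel k_vert)
next
  fix x assume r: "r = gen (LEdge x) * gen (LVertex (head F x)) - gen (LEdge x)" and "x \<in> arcs F"
  then obtain e i c where x: "x = (Inr e, 2 * i + c)" "ix e i c" by (elim F_arcE)
  show ?thesis
    using eqW_J[OF k_edge(2)[OF x(2)]] unfolding r x(1)
    by (simp only: free_hom_diff free_hom_mult free_hom_gen k_ix[OF x(2)] F_sel k_vert ix_mod[OF x(2)])
next
  fix x assume r: "r = gen (LVertex (head F x)) * gen (LGhost x) - gen (LGhost x)" and "x \<in> arcs F"
  then obtain e i c where x: "x = (Inr e, 2 * i + c)" "ix e i c" by (elim F_arcE)
  show ?thesis
    using eqW_J[OF k_edge(3)[OF x(2)]] unfolding r x(1)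
    by (simp only: free_hom_diff free_hom_mult free_hom_gen k_ix[OF x(2)] F_sel k_vert ix_mod[OF x(2)])
next
  fix x assume r: "r = gen (LGhost x) * gen (LVertex (tail F x)) - gen (LGhost x)" and "x \<in> arcs F"
  then obtain e i c where x: "x = (Inr e, 2 * i + c)" "ix e i c" by (elim F_arcE)
  show ?thesis
    using eqW_J[OF k_edge(4)[OF x(2)]] unfolding r x(1)
    by (simp only: free_hom_diff free_hom_mult free_hom_gen k_ix[OF x(2)] F_sel k_vert ix_mod[OF x(2)])
next
  fix v x y
  assume r: "r = gen (LGhost x) * gen (LEdge y) - (if x = y then gen (LVertex (head F x)) else 0)"
    and v: "v \<in> verts F" "x \<in> out_arcs F v" "y \<in> out_arcs F v"
  then have "x \<in> arcs F" "y \<in> arcs F" by simp_all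
  then obtain e i c f j d where x: "x = (Inr e, 2 * i + c)" "ix e i c"
    and y: "y = (Inr f, 2 * j + d)" "ix f j d" by (elim F_arcE) blast
  have "tail F x = tail F y" using v by simp
  then have s: "src e = src f" by (simp add: x y)
  have eq: "x = y \<longleftrightarrow> e = f \<and> i = j \<and> c = d"
    using code_inj[of c d i j] copies_lt[of c e i] copies_lt[of d f j] x y by (auto simp: ix_def)
  have "free_hom k (gen (LGhost x) * gen (LEdge y)) = q (tgt e) c * (Zs e i * Z f j) * q (tgt f) d"
    by (simp only: free_hom_mult free_hom_gen x(1) y(1) k_ix[OF x(2)] k_ix[OF y(2)] mult.assoc)
  moreover have "free_hom k (gen (LVertex (head F x))) = q (tgt e) c"
    by (simp only: free_hom_gen x(1) F_sel k_vert ix_mod[OF x(2)])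
  ultimately have "free_hom k r = q (tgt e) c * (Zs e i * Z f j) * q (tgt f) d - (if x = y then q (tgt e) c else 0)"
    unfolding r by (simp only: free_hom_diff if_distrib[of "free_hom k"] free_hom_zero)
  then show ?thesis using eqW_J[OF ZsZ[OF x(2) y(2) s]] unfolding eq by simp
next
  fix x assume r: "r = (\<Sum>y\<in>out_arcs F x. gen (LEdge y) * gen (LGhost y)) - gen (LVertex x)"
    and x: "x \<in> verts F" "out_arcs F x \<noteq> {}"
  from x(2) obtain y where "y \<in> out_arcs F x" by blast
  then have y: "y \<in> arcs F" "tail F y = x" by simp_all
  from y(1) obtain e0 i0 c0 where e0: "y = (Inr e0, 2 * i0 + c0)" "ix e0 i0 c0" by (rule F_arcE)
  have xe: "x = (Inl (src e0), 0)" using y e0 by simp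
  have ea: "e0 \<in> arcs E" using e0 by (simp add: ix_def)
  have "free_hom k (\<Sum>y\<in>out_arcs F x. gen (LEdge y) * gen (LGhost y)) =
      (\<Sum>y\<in>arc_ix (src e0). k (LEdge (code y)) * k (LGhost (code y)))"
    unfolding xe F_out_arcs sum.reindex[OF inj_code]
    by (simp add: free_hom_sum free_hom_mult del: k.simps)
  also have "\<dots> = (\<Sum>(e, i, c)\<in>arc_ix (src e0). (Z e i * q (tgt e) c) * (q (tgt e) c * Zs e i))"
  proof (rule sum.cong[OF refl], clarify)
    fix e i c assume "(e, i, c) \<in> arc_ix (src e0)"
    then have "ix e i c" by (simp add: arc_ix_def ix_def)
    then show "k (LEdge (code (e, i, c))) * k (LGhost (code (e, i, c))) =
        (Z e i * q (tgt e) c) * (q (tgt e) c * Zs e i)"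
      by (simp only: code_def prod.case k_ix)
  qed
  also have "\<dots> = (\<Sum>e | e \<in> arcs E \<and> src e = src e0. \<Sum>i = 1..w e. \<Sum>c\<in>copies e i.
      (Z e i * q (tgt e) c) * (q (tgt e) c * Zs e i))"
    unfolding arc_ix_def using finite_src by (simp add: sum.Sigma split_beta)
  finally show ?thesis
    using eqW_J[OF k_sum[OF ea]] unfolding r by (simp only: free_hom_diff free_hom_gen xe k_vert)
qed

lemma hom_k_sum: "free_hom k (A e i) = (\<Sum>c\<in>copies e i. k (LEdge (Inr e, 2 * i + c)))"
  "free_hom k (B e i) = (\<Sum>c\<in>copies e i. k (LGhost (Inr e, 2 * i + c)))"
  by (simp_all add: A_def B_def free_hom_sum del: k.simps)

text \<open>Summing over the copies restores the whole range of an edge by \<open>Zq\<close>; for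
  vertices \<open>sum_q\<close> does the same.\<close>

lemma hom_k_h:
  assumes "x \<in> wleavitt_gens E w"
  shows "free_hom k (h x) \<approx> gen x"
proof -
  have Zk: "free_hom k (A e i) \<approx> Z e i" "free_hom k (B e i) \<approx> Zs e i"
    if e: "e \<in> arcs E" "1 \<le> i" "i \<le> w e" for e i
  proof -
    have ix: "ix e i c" if "c \<in> copies e i" for c using that e by (simp add: ix_def)
    have "free_hom k (A e i) = Z e i * (\<Sum>c\<in>copies e i. q (tgt e) c)"
      "free_hom k (B e i) = (\<Sum>c\<in>copies e i. q (tgt e) c) * Zs e i"
      unfolding hom_k_sum sum_distrib_left sum_distrib_right
      by (rule sum.cong[OF refl], simp only: k_ix[OF ix])+
    then show "free_hom k (A e i) \<approx> Z e i" "free_hom k (B e i) \<approx> Zs e i"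
      using Zq[OF e] by simp_all
  qed
  show ?thesis
    using assms[unfolded wleavitt_gens_def]
  proof (elim UnE imageE CollectE exE conjE)
    fix v assume "x = WVertex v"
    then show ?thesis by (simp add: VV_def free_hom_sum sum_q)
  next
    fix e i assume "x = WEdge e i" "e \<in> arcs E" "1 \<le> i" "i \<le> w e"
    then show ?thesis using Zk[of e i] by (cases "e \<in> reversed") (simp_all add: Z_def Zs_def wedge_def)
  next
    fix e i assume "x = WGhost e i" "e \<in> arcs E" "1 \<le> i" "i \<le> w e"
    then show ?thesis using Zk[of e i] by (cases "e \<in> reversed") (simp_all add: Z_def Zs_def wghost_def)
  qed
qed

text \<open>At a split vertex e_1 has a single copy, which ends in part 1, so e_1 e_1^* goes to part
  1. Part 0 is what remains of \<open>VV v\<close>.\<close>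

lemma hom_h_q:
  assumes "v \<in> verts E" "c \<in> parts v"
  shows "free_hom h (q v c) \<simeq> N v c"
proof (cases "split v")
  case True
  then obtain e where e: "e \<in> reversed" "tail E e = v" by (rule split_rev)
  have ea: "e \<in> arcs E" and w1: "1 \<le> w e" using rev_arc[OF e(1)] w_ge_1 by auto
  have cp: "copies e 1 = {1}" "tgt e = v" using e True by (simp_all add: copies_def tgt_def)
  have "free_hom h (X e 1 * Y e 1) = B e 1 * A e 1"
    using e w1 by (simp add: free_hom_mult hom_wedge hom_wghost)
  also have "\<dots> \<simeq> N v 1" using BA_mult[of e 1 e 1] ea w1 by (simp add: cp)
  finally have 1: "free_hom h (X e 1 * Y e 1) \<simeq> N v 1" .
  have "free_hom h (V v) - free_hom h (X e 1 * Y e 1) \<simeq> (N v 0 + N v 1) - N v 1"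
    using True by (intro eqG_diff 1) (simp add: VV_def parts_def)
  moreover have "c = 0 \<or> c = 1" using assms True by (auto simp: parts_def)
  moreover have "q v 1 = X e 1 * Y e 1" "q v 0 = V v - X e 1 * Y e 1"
    using q_split[OF e(1)] True e(2) by simp_all
  ultimately show ?thesis using 1 by (elim disjE) (simp_all add: free_hom_diff)
next
  case False
  then show ?thesis using assms by (simp add: q_not_split VV_def parts_def)
qed

lemma sum_delta_eqG:
  assumes "ix e i c" "\<And>d. d \<in> copies e i \<Longrightarrow> f d \<simeq> (if d = c then y else 0)"
  shows "(\<Sum>d\<in>copies e i. f d) \<simeq> y"
  using assms by (intro sum_mult_delta[of _ c]) (auto simp: ix_def)

lemma hom_h_k:
  assumes "x \<in> leavitt_gens F"
  shows "free_hom h (k x) \<simeq> gen x"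
  using assms[unfolded leavitt_gens_def]
proof (elim UnE imageE)
  fix v assume "x = LVertex v" "v \<in> verts F"
  then show ?thesis by (auto elim!: F_vertE intro: hom_h_q)
next
  fix e' assume e': "x = LEdge e'" "e' \<in> arcs F"
  then obtain e i c where x: "e' = (Inr e, 2 * i + c)" and ix: "ix e i c" by (elim F_arcE)
  have e: "e \<in> arcs E" "1 \<le> i" "i \<le> w e" using ix by (auto simp: ix_def)
  have "free_hom h (k x) = free_hom h (Z e i) * free_hom h (q (tgt e) c)"
    unfolding e' x k_ix[OF ix] by (rule free_hom_mult)
  also have "free_hom h (Z e i) = A e i" using e by (simp add: Z_def hom_wedge hom_wghost)
  also have "A e i * free_hom h (q (tgt e) c) \<simeq> A e i * N (tgt e) c"
    by (intro eqG_mult eqG_refl hom_h_q tgt_vert e ix_parts[OF ix])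
  also have "A e i * N (tgt e) c = (\<Sum>d\<in>copies e i. a e i d * N (tgt e) c)"
    by (simp add: A_def sum_distrib_right)
  also have "\<dots> \<simeq> a e i c"
  proof (rule sum_delta_eqG[OF ix])
    fix d assume "d \<in> copies e i"
    then have ixd: "ix e i d" using e by (simp add: ix_def)
    have "a e i d * N (tgt e) c \<simeq> (a e i d * N (tgt e) d) * N (tgt e) c"
      by (intro eqG_mult eqG_refl eqG_sym[OF ab_absorb(2)[OF ixd]])
    also have "\<dots> = a e i d * (N (tgt e) d * N (tgt e) c)" by (simp add: mult.assoc)
    also have "\<dots> \<simeq> a e i d * (if d = c then N (tgt e) d else 0)"
      using N_mult[OF tgt_vert tgt_vert ix_parts[OF ixd] ix_parts[OF ix], OF e(1) e(1)]
      by (intro eqG_mult eqG_refl) simp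
    also have "\<dots> \<simeq> (if d = c then a e i c else 0)" using ab_absorb(2)[OF ixd] by (cases "d = c") simp_all
    finally show "a e i d * N (tgt e) c \<simeq> (if d = c then a e i c else 0)" .
  qed
  finally show ?thesis by (simp only: e' x)
next
  fix e' assume e': "x = LGhost e'" "e' \<in> arcs F"
  then obtain e i c where x: "e' = (Inr e, 2 * i + c)" and ix: "ix e i c" by (elim F_arcE)
  have e: "e \<in> arcs E" "1 \<le> i" "i \<le> w e" using ix by (auto simp: ix_def)
  have "free_hom h (k x) = free_hom h (q (tgt e) c) * free_hom h (Zs e i)"
    unfolding e' x k_ix[OF ix] by (rule free_hom_mult)
  also have "free_hom h (Zs e i) = B e i" using e by (simp add: Zs_def hom_wedge hom_wghost)
  also have "free_hom h (q (tgt e) c) * B e i \<simeq> N (tgt e) c * B e i"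
    by (intro eqG_mult eqG_refl hom_h_q tgt_vert e ix_parts[OF ix])
  also have "N (tgt e) c * B e i = (\<Sum>d\<in>copies e i. N (tgt e) c * b e i d)"
    by (simp add: B_def sum_distrib_left)
  also have "\<dots> \<simeq> b e i c"
  proof (rule sum_delta_eqG[OF ix])
    fix d assume "d \<in> copies e i"
    then have ixd: "ix e i d" using e by (simp add: ix_def)
    have "N (tgt e) c * b e i d \<simeq> N (tgt e) c * (N (tgt e) d * b e i d)"
      by (intro eqG_mult eqG_refl eqG_sym[OF ab_absorb(3)[OF ixd]])
    also have "\<dots> = (N (tgt e) c * N (tgt e) d) * b e i d" by (simp add: mult.assoc)
    also have "\<dots> \<simeq> (if d = c then N (tgt e) d else 0) * b e i d"
      using N_mult[OF tgt_vert tgt_vert ix_parts[OF ix] ix_parts[OF ixd], OF e(1) e(1)]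
      by (intro eqG_mult eqG_refl) (auto split: if_splits)
    also have "\<dots> \<simeq> (if d = c then b e i c else 0)" using ab_absorb(3)[OF ixd] by (cases "d = c") simp_all
    finally show "N (tgt e) c * b e i d \<simeq> (if d = c then b e i c else 0)" .
  qed
  finally show ?thesis by (simp only: e' x)
qed

theorem good_iso: "algebra_iso (wleavitt_algebra E w :: ('k, _) module) (leavitt_algebra F)"
  unfolding wleavitt_algebra_def leavitt_algebra_def
  by (rule presented_algebra_iso[OF pres presF, of h k])
     (blast intro: h_in k_in h_rels k_rels eqW_J[OF hom_k_h] eqG_J[OF hom_h_k])+

end

section \<open>Normal forms\<close>

lemma word_degree_append:
  "word_degree (FMon (xs @ ys)) = word_degree (FMon xs) + word_degree (FMon ys)"
  by (simp add: word_degree_def)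

context row_finite_weighted begin

declare One_nat_def [simp del]

fun lsrc :: "('v, 'e) wleavitt_gen \<Rightarrow> 'v" where
  "lsrc (WVertex v) = v" | "lsrc (WEdge e i) = tail E e" | "lsrc (WGhost e i) = head E e"

fun ltgt :: "('v, 'e) wleavitt_gen \<Rightarrow> 'v" where
  "ltgt (WVertex v) = v" | "ltgt (WEdge e i) = head E e" | "ltgt (WGhost e i) = tail E e"

text \<open>The choice depends on the source only, so each vertex that emits edges has one special
  edge. Its maximal weight makes e_i e_j^* a word for all i and j up to the weight of the vertex, so
  that relation (iv) can be solved for it.\<close>

definition special :: "'e \<Rightarrow> bool" where
  "special e \<longleftrightarrow> e = (SOME f. f \<in> arcs E \<and> tail E f = tail E e \<and> w f = vw (tail E e))"

lemma special_unique: "special e \<Longrightarrow> special f \<Longrightarrow> tail E e = tail E f \<Longrightarrow> e = f"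
  unfolding special_def by metis

lemma special_exists:
  assumes "i \<in> {1..vw v}"
  obtains e where "special e" "e \<in> arcs E" "tail E e = v" "w e = vw v"
proof -
  let ?P = "\<lambda>f. f \<in> arcs E \<and> tail E f = v \<and> w f = vw v"
  have "\<exists>f. ?P f" using vw_attained[OF assms] by blast
  then have P: "?P (SOME f. ?P f)" by (rule someI_ex)
  then have "special (SOME f. ?P f)" by (simp add: special_def)
  with P show ?thesis using that by blast
qed

text \<open>Left sides of the rewriting rules: relation (iv) is solved for the special edge,
  relation (iii) for the index 1, which every edge has. Whether the letters are composable is tested
  separately.\<close>

fun redex :: "('v, 'e) wleavitt_gen \<Rightarrow> ('v, 'e) wleavitt_gen \<Rightarrow> bool" where
  "redex (WEdge e i) (WGhost f j) \<longleftrightarrow> e = f \<and> special e"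
| "redex (WGhost e i) (WEdge f j) \<longleftrightarrow> i = 1 \<and> j = 1"
| "redex _ _ \<longleftrightarrow> False"

definition letter :: "('v, 'e) wleavitt_gen \<Rightarrow> bool" where
  "letter x \<longleftrightarrow> (\<exists>e i. e \<in> arcs E \<and> 1 \<le> i \<and> i \<le> w e \<and> (x = WEdge e i \<or> x = WGhost e i))"

lemma letter_simps [simp]:
  "letter (WEdge e i) \<longleftrightarrow> e \<in> arcs E \<and> 1 \<le> i \<and> i \<le> w e"
  "letter (WGhost e i) \<longleftrightarrow> e \<in> arcs E \<and> 1 \<le> i \<and> i \<le> w e"
  "\<not> letter (WVertex v)"
  by (auto simp: letter_def)

lemma letter_gens: "letter x \<Longrightarrow> x \<in> wleavitt_gens E w"
  by (auto simp: letter_def wleavitt_gens_def)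

lemma gens_cases:
  assumes "x \<in> wleavitt_gens E w"
  obtains v where "x = WVertex v" "v \<in> verts E" | "letter x"
  using assms by (auto simp: wleavitt_gens_def)

end

text \<open>The normal words that end at \<open>s\<close> are made the basis of a left module (which is \<open>L s\<close>); the empty
  word stands for \<open>s\<close>. Multiplying a normal word by a generator creates at most one redex, and a single
  rewriting step removes it.\<close>

locale normal_forms = row_finite_weighted E w K
  for E :: "('v, 'e) pre_digraph" and w :: "'e \<Rightarrow> nat" and K :: "'k::field itself" +
  fixes s :: 'v
begin

abbreviation wsrc :: "('v, 'e) wleavitt_gen list \<Rightarrow> 'v" where
  "wsrc l \<equiv> (case l of [] \<Rightarrow> s | x # _ \<Rightarrow> lsrc x)"

fun normal :: "('v, 'e) wleavitt_gen list \<Rightarrow> bool" where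
  "normal [] \<longleftrightarrow> True"
| "normal (x # l) \<longleftrightarrow> letter x \<and> ltgt x = wsrc l \<and> normal l \<and> (l = [] \<or> \<not> redex x (hd l))"

text \<open>One rewriting step at the left end of a word. What replaces a redex is the rest of its
  relation: relation (iv) without the special edge, relation (iii) without the index 1.\<close>

fun red :: "('v, 'e) wleavitt_gen \<Rightarrow> ('v, 'e) wleavitt_gen list \<Rightarrow>
    ('v, 'e) wleavitt_gen fmon \<Rightarrow>\<^sub>0 'k" where
  "red (WVertex v) l = (if v = wsrc l then word l else 0)"
| "red (WEdge e i) l = (if head E e \<noteq> wsrc l then 0
     else if l \<noteq> [] \<and> redex (WEdge e i) (hd l) then (case hd l of WGhost f j \<Rightarrow>
       (if i = j then word (tl l) else 0)
         - (\<Sum>g\<in>out_arcs E (tail E e) - {e}. X g i * Y g j * word (tl l)))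
     else word (WEdge e i # l))"
| "red (WGhost e i) l = (if tail E e \<noteq> wsrc l then 0
     else if l \<noteq> [] \<and> redex (WGhost e i) (hd l) then (case hd l of WEdge f j \<Rightarrow>
       (if e = f then word (tl l) else 0)
         - (\<Sum>k = 2..vw (tail E e). Y e k * X f k * word (tl l)))
     else word (WGhost e i # l))"

definition act :: "('v, 'e) wleavitt_gen \<Rightarrow> (('v, 'e) wleavitt_gen fmon \<Rightarrow>\<^sub>0 'k) \<Rightarrow>
    ('v, 'e) wleavitt_gen fmon \<Rightarrow>\<^sub>0 'k" where
  "act x = lext (\<lambda>u. red x (letters u))"

text \<open>The last letter of a word acts first, which gives a left module over the free ring. The
  relations are not yet imposed; they will hold on normal words only.\<close>

definition Act :: "(('v, 'e) wleavitt_gen fmon \<Rightarrow>\<^sub>0 'k) \<Rightarrow> (('v, 'e) wleavitt_gen fmon \<Rightarrow>\<^sub>0 'k) \<Rightarrow>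
    ('v, 'e) wleavitt_gen fmon \<Rightarrow>\<^sub>0 'k" where
  "Act f m = lext (\<lambda>u. foldr act (letters u) m) f"

lemma act_add: "act x (m + n) = act x m + act x n"
  and act_scal: "act x (scal c m) = scal c (act x m)"
  and act_zero [simp]: "act x 0 = 0"
  and act_word: "act x (word l) = red x l"
  by (simp_all add: act_def lext_add lext_scal word_def)

lemma foldr_act_add: "foldr act l (m + n) = foldr act l m + foldr act l n"
  and foldr_act_scal: "foldr act l (scal c m) = scal c (foldr act l m)"
  and foldr_act_zero: "foldr act l 0 = 0"
  by (induction l) (simp_all add: act_add act_scal)

lemma Act_zero [simp]: "Act 0 m = 0"
  and Act_add: "Act (f + g) m = Act f m + Act g m"
  and Act_diff: "Act (f - g) m = Act f m - Act g m"
  and Act_sum: "Act (\<Sum>i\<in>A. f' i) m = (\<Sum>i\<in>A. Act (f' i) m)"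
  and Act_scal: "Act (scal c f) m = scal c (Act f m)"
  and Act_word: "Act (word l) m = foldr act l m"
  by (simp_all add: Act_def lext_add lext_diff lext_sum lext_scal word_def)

lemma Act_one [simp]: "Act 1 m = m"
  using Act_word[of "[]" m] by simp

lemma Act_gen: "Act (gen x) m = act x m"
  using Act_word[of "[x]" m] by (simp add: word_single)

lemma Act_add_right: "Act f (m + n) = Act f m + Act f n"
  by (induction f rule: free_induct)
     (simp_all add: Act_add Act_scal Act_word foldr_act_add scal_add)

lemma Act_scal_right: "Act f (scal c m) = scal c (Act f m)"
  by (induction f rule: free_induct)
     (simp_all add: Act_add Act_scal Act_word foldr_act_scal scal_add scal_scal mult.commute)

lemma Act_zero_right [simp]: "Act f 0 = 0"
  using Act_scal_right[of f 0 0] by simp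

lemma Act_diff_right: "Act f (m - n) = Act f m - Act f n"
  using Act_add_right[of f "m - n" n] by (simp add: algebra_simps)

lemma Act_sum_right: "Act f (\<Sum>i\<in>A. g i) = (\<Sum>i\<in>A. Act f (g i))"
  by (induction A rule: infinite_finite_induct) (simp_all add: Act_add_right)

lemma Act_mult: "Act (f * g) m = Act f (Act g m)"
proof (induction f rule: free_induct)
  case (add q xs c)
  have "Act (word xs * g) m = Act (word xs) (Act g m)"
    by (induction g rule: free_induct)
       (simp_all add: distrib_left Act_add Act_add_right Act_scal Act_scal_right scal_mult_right
          Act_word flip: word_append)
  then show ?case
    using add by (simp add: distrib_right Act_add Act_scal scal_mult_left)
qed simp

definition words_in :: "('v, 'e) wleavitt_gen list set \<Rightarrow> (('v, 'e) wleavitt_gen fmon \<Rightarrow>\<^sub>0 'k) set" where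
  "words_in S = {m. \<forall>u\<in>Poly_Mapping.keys m. letters u \<in> S}"

lemma words_in_zero [simp]: "0 \<in> words_in S"
  by (simp add: words_in_def)

lemma words_in_word: "word l \<in> words_in S \<longleftrightarrow> l \<in> S"
  by (simp add: words_in_def)

lemma words_in_add: "m \<in> words_in S \<Longrightarrow> n \<in> words_in S \<Longrightarrow> m + n \<in> words_in S"
  using keys_add[of m n] by (auto simp: words_in_def)

lemma words_in_scal: "m \<in> words_in S \<Longrightarrow> scal c m \<in> words_in S"
  using keys_scal[of c m] by (auto simp: words_in_def)

lemma words_in_diff: "m \<in> words_in S \<Longrightarrow> n \<in> words_in S \<Longrightarrow> m - n \<in> words_in S"
  using words_in_add[of m S "scal (- 1) n"] words_in_scal[of n S "- 1"] by (simp add: scal_minus_one)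

lemma words_in_sum: "(\<And>i. i \<in> A \<Longrightarrow> f i \<in> words_in S) \<Longrightarrow> (\<Sum>i\<in>A. f i) \<in> words_in S"
  by (induction A rule: infinite_finite_induct) (auto intro: words_in_add)

lemma words_in_mono: "S \<subseteq> T \<Longrightarrow> words_in S \<subseteq> words_in T"
  by (auto simp: words_in_def)

lemma words_in_induct [consumes 1, case_names zero add]:
  assumes "m \<in> words_in S" "P 0" "\<And>q l c. l \<in> S \<Longrightarrow> q \<in> words_in S \<Longrightarrow> P q \<Longrightarrow> P (scal c (word l) + q)"
  shows "P m"
proof -
  have "P m \<and> m \<in> words_in S"
  proof (induction m rule: free_induct)
    case (add q xs c)
    have "xs \<in> S" using add(1) assms(1) by (auto simp: words_in_def)
    then show ?case
      using add(2) assms(3)[of xs q c] by (auto intro!: words_in_add words_in_scal simp: words_in_word)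
  qed (use assms(2) in simp)
  then show ?thesis by simp
qed

lemma words_in_Act:
  assumes "m \<in> words_in S" "\<And>l. l \<in> S \<Longrightarrow> Act f (word l) \<in> words_in T"
  shows "Act f m \<in> words_in T"
  using assms(1)
  by (induction rule: words_in_induct)
     (auto simp: Act_add_right Act_scal_right intro!: words_in_add words_in_scal assms(2))

text \<open>Rewriting consumes at most the first letter of \<open>l\<close>, and only if that letter
  belongs to a redex. This is what will protect a word standing at the right end.\<close>

lemma red_tail:
  "red x l \<in> words_in {z @ t | z t. t = l \<or> l \<noteq> [] \<and> redex x (hd l) \<and> t = tl l}"
proof -
  define S where "S = {z @ t | z t. t = l \<or> l \<noteq> [] \<and> redex x (hd l) \<and> t = tl l}"
  have l: "word l \<in> words_in S" "word (x # l) \<in> words_in S"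
    unfolding words_in_word S_def by (auto intro: exI[of _ "[]"] exI[of _ "[x]"])
  have tl: "word (z @ tl l) \<in> words_in S" if "l \<noteq> []" "redex x (hd l)" for z
    unfolding words_in_word S_def using that by blast
  have XY: "X g i * Y g' j * word (tl l) \<in> words_in S" "Y g i * X g' j * word (tl l) \<in> words_in S"
    if "l \<noteq> []" "redex x (hd l)" for g g' i j
    using tl[OF that, of "[WEdge g i, WGhost g' j]"] tl[OF that, of "[WGhost g i, WEdge g' j]"]
    by (simp_all add: wedge_def wghost_def word_Cons mult.assoc)
  have "red x l \<in> words_in S"
  proof (cases x)
    case (WVertex v)
    then show ?thesis using l by simp
  next
    case (WEdge e i)
    show ?thesis
    proof (cases "head E e = wsrc l \<and> l \<noteq> [] \<and> redex x (hd l)")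
      case True
      then obtain j where h: "hd l = WGhost e j" using WEdge by (cases "hd l") auto
      have "red x l = (if i = j then word (tl l) else 0)
         - (\<Sum>g\<in>out_arcs E (tail E e) - {e}. X g i * Y g j * word (tl l))"
        using True WEdge h by simp
      also have "\<dots> \<in> words_in S"
        using True tl[of "[]"] XY by (intro words_in_diff words_in_sum) auto
      finally show ?thesis .
    next
      case False
      then have "red x l = 0 \<or> red x l = word (x # l)" using WEdge by auto
      then show ?thesis using l by auto
    qed
  next
    case (WGhost e i)
    show ?thesis
    proof (cases "tail E e = wsrc l \<and> l \<noteq> [] \<and> redex x (hd l)")
      case True
      then obtain f j where h: "hd l = WEdge f j" using WGhost by (cases "hd l") auto
      have "red x l = (if e = f then word (tl l) else 0)
         - (\<Sum>k = 2..vw (tail E e). Y e k * X f k * word (tl l))"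
        using True WGhost h by simp
      also have "\<dots> \<in> words_in S"
        using True tl[of "[]"] XY by (intro words_in_diff words_in_sum) auto
      finally show ?thesis .
    next
      case False
      then have "red x l = 0 \<or> red x l = word (x # l)" using WGhost by auto
      then show ?thesis using l by auto
    qed
  qed
  then show ?thesis by (simp only: S_def)
qed

definition N :: "(('v, 'e) wleavitt_gen fmon \<Rightarrow>\<^sub>0 'k) set" where
  "N = words_in {l. normal l}"

definition Nv :: "'v \<Rightarrow> (('v, 'e) wleavitt_gen fmon \<Rightarrow>\<^sub>0 'k) set" where
  "Nv v = words_in {l. normal l \<and> wsrc l = v}"

lemma Nv_sub_N: "Nv v \<subseteq> N"
  unfolding Nv_def N_def by (intro words_in_mono) auto

lemma X_word: "1 \<le> i \<Longrightarrow> i \<le> w e \<Longrightarrow> X e i * word l = word (WEdge e i # l)"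
  and Y_word: "1 \<le> i \<Longrightarrow> i \<le> w e \<Longrightarrow> Y e i * word l = word (WGhost e i # l)"
  by (simp_all add: wedge_def wghost_def word_Cons)

lemma X_zero: "\<not> i \<le> w e \<Longrightarrow> X e i = 0" and Y_zero: "\<not> i \<le> w e \<Longrightarrow> Y e i = 0"
  by (simp_all add: wedge_def wghost_def)

lemma Act_X:
  assumes "head E e = wsrc l" "\<not> (\<exists>j y. l = WGhost e j # y \<and> special e)"
  shows "Act (X e i) (word l) = X e i * word l"
proof (cases "i \<le> w e")
  case True
  have "\<not> (l \<noteq> [] \<and> redex (WEdge e i) (hd l))"
    using assms(2) by (cases l; cases "hd l") auto
  then show ?thesis
    using assms(1) True by (auto simp: wedge_def Act_gen act_word word_Cons)
qed (simp add: X_zero)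

lemma Act_X_special:
  assumes "head E e = wsrc (WGhost e j # y)" "special e" "i \<le> w e"
  shows "Act (X e i) (word (WGhost e j # y)) =
    (if i = j then word y else 0) - (\<Sum>g\<in>out_arcs E (tail E e) - {e}. X g i * Y g j * word y)"
  using assms by (simp add: wedge_def[of w e] Act_gen act_word)

lemma Act_Y:
  assumes "tail E e = wsrc l" "i \<noteq> 1 \<or> \<not> (\<exists>f y. l = WEdge f 1 # y)"
  shows "Act (Y e i) (word l) = Y e i * word l"
proof (cases "i \<le> w e")
  case True
  have "\<not> (l \<noteq> [] \<and> redex (WGhost e i) (hd l))"
    using assms(2) by (cases l; cases "hd l") auto
  then show ?thesis
    using assms(1) True by (auto simp: wghost_def Act_gen act_word word_Cons)
qed (simp add: Y_zero)

lemma Act_Y_one: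
  assumes "tail E e = tail E f" "1 \<le> w e"
  shows "Act (Y e 1) (word (WEdge f 1 # y)) =
    (if e = f then word y else 0) - (\<Sum>k = 2..vw (tail E e). Y e k * X f k * word y)"
  using assms by (simp add: wghost_def[of w e 1] Act_gen act_word)

lemma Act_X_src: "head E e \<noteq> wsrc l \<Longrightarrow> Act (X e i) (word l) = 0"
  by (auto simp: wedge_def Act_gen act_word)

lemma Act_Y_src: "tail E e \<noteq> wsrc l \<Longrightarrow> Act (Y e i) (word l) = 0"
  by (auto simp: wghost_def Act_gen act_word)

lemma sum_split_first:
  fixes g :: "nat \<Rightarrow> 'z::ab_group_add"
  assumes "1 \<le> n"
  shows "(\<Sum>i = 1..n. g i) = g 1 + (\<Sum>i = 2..n. g i)"
  using sum.atLeast_Suc_atMost[of 1 n g] assms by (simp add: numeral_2_eq_2 One_nat_def)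

lemma vw_ge_1: "e \<in> arcs E \<Longrightarrow> 1 \<le> vw (tail E e)"
  using w_le_vw[of e] w_ge_1[of e] by simp

text \<open>The case without overlap: the action of e_1^* on f_1 l produces minus the terms of index
  above 1, and the rest of the sum adds them back.\<close>

lemma Act_YX:
  assumes "e \<in> arcs E" "f \<in> arcs E" "tail E e = tail E f" "wsrc l = head E f"
    "\<not> (\<exists>j y. l = WGhost f j # y \<and> special f)"
  shows "(\<Sum>i = 1..vw (tail E e). Act (Y e i) (Act (X f i) (word l))) = (if e = f then word l else 0)"
proof -
  have 1: "Act (Y e 1) (Act (X f 1) (word l)) =
      (if e = f then word l else 0) - (\<Sum>k = 2..vw (tail E e). Y e k * X f k * word l)"
    using assms w_ge_1[of e] w_ge_1[of f] by (simp add: Act_X X_word Act_Y_one)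
  have "Act (Y e i) (Act (X f i) (word l)) = Y e i * X f i * word l" if "i \<in> {2..vw (tail E e)}" for i
  proof (cases "i \<le> w f")
    case True
    then have "X f i * word l = word (WEdge f i # l)" using that by (intro X_word) auto
    then show ?thesis using assms that True by (simp add: Act_X Act_Y mult.assoc)
  qed (simp add: X_zero)
  then show ?thesis
    unfolding sum_split_first[OF vw_ge_1[OF assms(1)]] 1 by simp
qed

text \<open>The difficulty is the overlap of f_i with a leading f_j^* of a special edge f. The
  expansion of f_i f_j^* y runs over the other edges g at the vertex; they are not special, so
  \<open>Act_YX\<close> evaluates their contributions. What is left is e_j^* y, minus the same word
  if e is one of the g.\<close>

lemma Act_ghost_edge:
  assumes "e \<in> arcs E" "f \<in> arcs E" "tail E e = tail E f" "normal l"
  shows "(\<Sum>i = 1..vw (tail E e). Act (Y e i) (Act (X f i) (word l))) =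
    (if e = f \<and> wsrc l = head E e then word l else 0)"
proof (cases "wsrc l = head E f \<and> (\<exists>j y. l = WGhost f j # y \<and> special f)")
  case True
  then obtain j y where l: "l = WGhost f j # y" and sp: "special f" by auto
  have n: "letter (WGhost f j)" "ltgt (WGhost f j) = wsrc y" "normal y" "y = [] \<or> \<not> redex (WGhost f j) (hd y)"
    using assms(4) unfolding l normal.simps by simp_all
  then have y: "1 \<le> j" "j \<le> w f" "wsrc y = tail E f" "normal y" by simp_all
  have nr: "j \<noteq> 1 \<or> \<not> (\<exists>g t. y = WEdge g 1 # t)" using n(4) by auto
  let ?n = "vw (tail E e)" and ?O = "out_arcs E (tail E f) - {f}"
  \<comment> \<open>Every index of the sum must be an index of \<open>f\<close>, so that
    \<open>Act_X_special\<close> applies to all its terms.\<close>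
  have wf: "w f = ?n"
  proof -
    have "1 \<in> {1..?n}" using vw_ge_1[OF assms(1)] by simp
    then obtain a where a: "special a" "tail E a = tail E e" "w a = ?n" by (rule special_exists)
    then have "a = f" using special_unique[of a f] sp assms(3) by simp
    with a show ?thesis by simp
  qed
  have Xf: "Act (X f i) (word l) = (if i = j then word y else 0) - (\<Sum>g\<in>?O. X g i * Y g j * word y)"
    if "i \<in> {1..?n}" for i
    unfolding l using sp that wf by (intro Act_X_special) auto
  have XY: "X g i * Y g j * word y = Act (X g i) (Y g j * word y)" if "g \<in> ?O" for g i
  proof (cases "j \<le> w g")
    case True
    have "g \<noteq> f" "tail E g = tail E f" using that by auto
    then have "\<not> special g" using special_unique[of f g] sp by metis
    then show ?thesis using y True by (simp add: mult.assoc Y_word Act_X)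
  qed (simp add: Y_zero)
  have YXY: "(\<Sum>i = 1..?n. Act (Y e i) (Act (X g i) (Y g j * word y))) = (if e = g then Y g j * word y else 0)"
    if "g \<in> ?O" for g
  proof (cases "j \<le> w g")
    case True
    have g: "g \<noteq> f" "tail E g = tail E f" "g \<in> arcs E" using that by auto
    then have "\<not> special g" using special_unique[of f g] sp by metis
    then show ?thesis
      using y True Act_YX[OF assms(1) g(3), of "WGhost g j # y"] g assms(3) by (simp add: Y_word)
  qed (simp add: Y_zero)
  have "(\<Sum>i = 1..?n. Act (Y e i) (Act (X f i) (word l))) =
      (\<Sum>i = 1..?n. Act (Y e i) (if i = j then word y else 0) - (\<Sum>g\<in>?O. Act (Y e i) (Act (X g i) (Y g j * word y))))"
    by (rule sum.cong[OF refl]) (simp add: Xf XY Act_diff_right Act_sum_right del: if_split)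
  also have "\<dots> = (\<Sum>i = 1..?n. Act (Y e i) (if i = j then word y else 0))
      - (\<Sum>g\<in>?O. \<Sum>i = 1..?n. Act (Y e i) (Act (X g i) (Y g j * word y)))"
    unfolding sum_subtractf by (subst sum.swap) (rule refl)
  also have "(\<Sum>i = 1..?n. Act (Y e i) (if i = j then word y else 0)) = Act (Y e j) (word y)"
    using y wf by (subst sum.mono_neutral_right[of _ "{j}"]) auto
  also have "Act (Y e j) (word y) = Y e j * word y"
    using y nr assms(3) by (intro Act_Y) auto
  also have "(\<Sum>g\<in>?O. \<Sum>i = 1..?n. Act (Y e i) (Act (X g i) (Y g j * word y))) =
      (if e = f then 0 else Y e j * word y)"
  proof -
    have "(\<Sum>g\<in>?O. \<Sum>i = 1..?n. Act (Y e i) (Act (X g i) (Y g j * word y))) =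
        (\<Sum>g\<in>?O. if e = g then Y g j * word y else 0)"
      by (rule sum.cong[OF refl]) (rule YXY)
    also have "\<dots> = (if e \<in> ?O then Y e j * word y else 0)"
      by (rule sum.delta') simp
    also have "e \<in> ?O \<longleftrightarrow> e \<noteq> f" using assms by auto
    finally show ?thesis by simp
  qed
  also have "Y e j * word y - (if e = f then 0 else Y e j * word y) = (if e = f then word l else 0)"
    using y by (simp add: l Y_word)
  finally show ?thesis using True by auto
next
  case False
  show ?thesis
  proof (cases "wsrc l = head E f")
    case True
    then show ?thesis using Act_YX[OF assms(1,2,3) True] False by auto
  qed (auto simp: Act_X_src)
qed

text \<open>The case without overlap: the action of the special edge produces minus the terms of the
  other edges.\<close>

lemma Act_XY:
  assumes "i \<in> {1..vw v}" "j \<in> {1..vw v}" "wsrc l = v" "j \<noteq> 1 \<or> \<not> (\<exists>f y. l = WEdge f 1 # y)"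
  shows "(\<Sum>e\<in>out_arcs E v. Act (X e i) (Act (Y e j) (word l))) = (if i = j then word l else 0)"
proof -
  obtain a where a: "special a" "a \<in> arcs E" "tail E a = v" "w a = vw v"
    by (rule special_exists[OF assms(1)])
  let ?O = "out_arcs E v - {a}"
  have Xa: "Act (X a i) (Act (Y a j) (word l)) =
      (if i = j then word l else 0) - (\<Sum>g\<in>?O. X g i * Y g j * word l)"
    using Act_Y[of a l j] assms a by (simp add: Y_word Act_X_special)
  have "Act (X g i) (Act (Y g j) (word l)) = X g i * Y g j * word l" if "g \<in> ?O" for g
  proof -
    have g: "g \<noteq> a" "tail E g = v" using that by auto
    then have "\<not> special g" using special_unique[of a g] a by metis
    moreover have "Act (Y g j) (word l) = Y g j * word l"
      using Act_Y[of g l j] assms g by simp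
    ultimately show ?thesis
      by (cases "j \<le> w g") (use assms in \<open>simp_all add: Y_word Act_X mult.assoc Y_zero\<close>)
  qed
  then have "(\<Sum>g\<in>?O. Act (X g i) (Act (Y g j) (word l))) = (\<Sum>g\<in>?O. X g i * Y g j * word l)"
    by (rule sum.cong[OF refl])
  then show ?thesis
    using a by (subst sum.remove[of _ a]) (simp_all add: Xa)
qed

text \<open>The mirror image of \<open>Act_ghost_edge\<close>: here e_1^* meets a leading f_1. The
  expansion has the terms e_k^* f_k y with k > 1, to which \<open>Act_XY\<close> applies. What is
  left is f_i y, minus itself if i > 1.\<close>

lemma Act_edge_ghost:
  assumes "i \<in> {1..vw v}" "j \<in> {1..vw v}" "normal l"
  shows "(\<Sum>e\<in>out_arcs E v. Act (X e i) (Act (Y e j) (word l))) =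
    (if i = j \<and> wsrc l = v then word l else 0)"
proof (cases "wsrc l = v")
  case False
  then show ?thesis by (auto intro!: sum.neutral simp: Act_Y_src)
next
  case src: True
  show ?thesis
  proof (cases "j = 1 \<and> (\<exists>f y. l = WEdge f 1 # y)")
    case False
    then show ?thesis using Act_XY[OF assms(1,2) src] src by auto
  next
    case True
    then obtain f y where j: "j = 1" and l: "l = WEdge f 1 # y" by auto
    have n: "letter (WEdge f 1)" "ltgt (WEdge f 1) = wsrc y" "normal y" "y = [] \<or> \<not> redex (WEdge f 1) (hd y)"
      using assms(3) unfolding l normal.simps by simp_all
    have "tail E f = v" using src by (simp add: l)
    with n have f: "f \<in> arcs E" "tail E f = v" "wsrc y = head E f" "normal y" by simp_all
    have nr: "\<not> (\<exists>k t. y = WGhost f k # t \<and> special f)" using n(4) by auto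
    let ?O = "out_arcs E v" and ?n = "vw v"
    have Ye: "Act (Y e 1) (word l) = (if e = f then word y else 0) - (\<Sum>k = 2..?n. Y e k * X f k * word y)"
      if "e \<in> ?O" for e
      unfolding l using that f w_ge_1[of e] Act_Y_one[of e f y] by simp
    have YX: "Y e k * X f k * word y = Act (Y e k) (X f k * word y)" if "e \<in> ?O" "k \<in> {2..?n}" for e k
    proof (cases "k \<le> w f")
      case True
      then show ?thesis using that f by (simp add: mult.assoc X_word Act_Y)
    qed (simp add: X_zero)
    have XYX: "(\<Sum>e\<in>?O. Act (X e i) (Act (Y e k) (X f k * word y))) = (if i = k then X f k * word y else 0)"
      if "k \<in> {2..?n}" for k
    proof (cases "k \<le> w f")
      case True
      then show ?thesis
        using that f Act_XY[OF assms(1), of k "WEdge f k # y"] by (simp add: X_word)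
    qed (simp add: X_zero)
    have "(\<Sum>e\<in>?O. Act (X e i) (Act (Y e j) (word l))) =
      (\<Sum>e\<in>?O. Act (X e i) (if e = f then word y else 0) - (\<Sum>k = 2..?n. Act (X e i) (Act (Y e k) (X f k * word y))))"
      unfolding j by (rule sum.cong[OF refl]) (simp add: Ye YX Act_diff_right Act_sum_right del: if_split)
    also have "\<dots> = (\<Sum>e\<in>?O. Act (X e i) (if e = f then word y else 0))
        - (\<Sum>k = 2..?n. \<Sum>e\<in>?O. Act (X e i) (Act (Y e k) (X f k * word y)))"
      unfolding sum_subtractf by (subst sum.swap) (rule refl)
    also have "(\<Sum>e\<in>?O. Act (X e i) (if e = f then word y else 0)) = Act (X f i) (word y)"
      using f by (subst sum.mono_neutral_right[of _ "{f}"]) auto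
    also have "Act (X f i) (word y) = X f i * word y" using f nr by (intro Act_X) auto
    also have "(\<Sum>k = 2..?n. \<Sum>e\<in>?O. Act (X e i) (Act (Y e k) (X f k * word y))) =
        (if i = 1 then 0 else X f i * word y)"
    proof -
      have "(\<Sum>k = 2..?n. \<Sum>e\<in>?O. Act (X e i) (Act (Y e k) (X f k * word y))) =
          (\<Sum>k = 2..?n. if i = k then X f k * word y else 0)"
        by (rule sum.cong[OF refl]) (rule XYX)
      also have "\<dots> = (if i \<in> {2..?n} then X f i * word y else 0)"
        by (rule sum.delta') simp
      also have "i \<in> {2..?n} \<longleftrightarrow> i \<noteq> 1" using assms(1) by auto
      finally show ?thesis by simp
    qed
    also have "X f i * word y - (if i = 1 then 0 else X f i * word y) = (if i = j then word l else 0)"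
      using f w_ge_1[of f] by (auto simp: l j X_word)
    finally show ?thesis using src by simp
  qed
qed

end

section \<open>The span of the normal words as a module over the weighted algebra\<close>

context normal_forms begin

lemma redex_path_normal:
  assumes "normal l" "wsrc l = tail E g"
  shows "i \<le> w g \<Longrightarrow> j \<le> w g \<Longrightarrow> 1 \<le> i \<Longrightarrow> 1 \<le> j \<Longrightarrow> g \<in> arcs E \<Longrightarrow> \<not> special g \<Longrightarrow>
      j \<noteq> 1 \<or> \<not> (\<exists>f t. l = WEdge f 1 # t) \<Longrightarrow> normal (WEdge g i # WGhost g j # l)"
proof -
  assume a: "i \<le> w g" "j \<le> w g" "1 \<le> i" "1 \<le> j" "g \<in> arcs E" "\<not> special g"
    "j \<noteq> 1 \<or> \<not> (\<exists>f t. l = WEdge f 1 # t)"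
  have "l = [] \<or> \<not> redex (WGhost g j) (hd l)"
    using a(7) by (cases l; cases "hd l") auto
  then show ?thesis using a assms by simp
qed

text \<open>The words that replace a redex are already normal. In g_i g_j^* y the edge g is not
  special, and g_j^* fits y because the removed e_j^* did. In e_k^* f_k y the index k exceeds 1, and
  f_k fits y because the removed f_1 did.\<close>

lemma red_normal:
  assumes "x \<in> wleavitt_gens E w" "normal l"
  shows "red x l \<in> Nv (lsrc x)"
  using assms(1)
proof (cases rule: gens_cases)
  case (1 v)
  then show ?thesis using assms(2) by (simp add: Nv_def words_in_word)
next
  case x: 2
  show ?thesis
  proof (cases "ltgt x = wsrc l \<and> l \<noteq> [] \<and> redex x (hd l)")
    case False
    have "red x l = 0 \<or> (normal (x # l) \<and> red x l = word (x # l))"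
      using x assms(2) False by (cases x) auto
    moreover have "wsrc (x # l) = lsrc x" by simp
    ultimately show ?thesis unfolding Nv_def by (auto simp: words_in_word)
  next
    case True
    then obtain y0 y where l: "l = y0 # y" and r: "redex x y0" by (cases l) auto
    have ly: "letter y0" "ltgt y0 = wsrc y" "normal y" "y = [] \<or> \<not> redex y0 (hd y)"
      using assms(2) unfolding l normal.simps by simp_all
    show ?thesis
    proof (cases x)
      case (WEdge e i)
      then obtain j where y0: "y0 = WGhost e j" and sp: "special e" using r by (cases y0) auto
      have src: "wsrc y = tail E e" using ly(2) y0 by simp
      have j: "j \<noteq> 1 \<or> \<not> (\<exists>f t. y = WEdge f 1 # t)" "1 \<le> j" using ly y0 by auto
      have i: "1 \<le> i" using x WEdge by simp
      have "red x l = (if i = j then word y else 0)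
         - (\<Sum>g\<in>out_arcs E (tail E e) - {e}. X g i * Y g j * word y)"
        using True WEdge l y0 by simp
      also have "\<dots> \<in> Nv (tail E e)"
        unfolding Nv_def
      proof (intro words_in_diff words_in_sum)
        show "(if i = j then word y else 0) \<in> words_in {l. normal l \<and> wsrc l = tail E e}"
          using ly src by (simp add: words_in_word)
        fix g assume g: "g \<in> out_arcs E (tail E e) - {e}"
        then have g': "g \<in> arcs E" "tail E g = tail E e" "g \<noteq> e" by auto
        have nsp: "\<not> special g" using special_unique[of g e] g' sp by blast
        show "X g i * Y g j * word y \<in> words_in {l. normal l \<and> wsrc l = tail E e}"
        proof (cases "i \<le> w g \<and> j \<le> w g")
          case True
          have "normal (WEdge g i # WGhost g j # y)"
            using redex_path_normal[of y g i j] ly src g' nsp j i True by simp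
          then show ?thesis
            using True i j(2) g' unfolding mult.assoc by (simp add: X_word Y_word words_in_word)
        qed (auto simp: X_zero Y_zero)
      qed
      finally show ?thesis using WEdge by simp
    next
      case (WGhost e i)
      then obtain f j where y0: "y0 = WEdge f j" and ij: "i = 1" "j = 1" using r by (cases y0) auto
      have src: "wsrc y = head E f" using ly(2) y0 by simp
      have fe: "tail E f = tail E e" using True WGhost l y0 by simp
      have fa: "f \<in> arcs E" and ea: "e \<in> arcs E" using ly x y0 WGhost by auto
      have nr: "y = [] \<or> \<not> redex (WEdge f k) (hd y)" for k
        using ly(4) y0 by (cases "hd y") auto
      have "red x l = (if e = f then word y else 0)
         - (\<Sum>k = 2..vw (tail E e). Y e k * X f k * word y)"
        using True WGhost l y0 by simp
      also have "\<dots> \<in> Nv (head E e)"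
        unfolding Nv_def
      proof (intro words_in_diff words_in_sum)
        show "(if e = f then word y else 0) \<in> words_in {l. normal l \<and> wsrc l = head E e}"
          using ly src by (simp add: words_in_word)
        fix k assume k: "k \<in> {2..vw (tail E e)}"
        show "Y e k * X f k * word y \<in> words_in {l. normal l \<and> wsrc l = head E e}"
        proof (cases "k \<le> w e \<and> k \<le> w f")
          case True
          have "normal (WGhost e k # WEdge f k # y)"
            using k True ly(3) src fe fa ea nr by auto
          then show ?thesis
            using True k unfolding mult.assoc by (simp add: X_word Y_word words_in_word)
        qed (auto simp: X_zero Y_zero)
      qed
      finally show ?thesis using WGhost by simp
    qed (use x in simp)
  qed
qed

lemma act_Nv:
  assumes "x \<in> wleavitt_gens E w" "m \<in> N"
  shows "act x m \<in> Nv (lsrc x)"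
  using words_in_Act[of m "{l. normal l}" "gen x" "{l. normal l \<and> wsrc l = lsrc x}"] red_normal[OF assms(1)] assms(2)
  by (simp add: N_def Nv_def Act_gen act_word)

lemma Act_N:
  assumes "f \<in> carrier (free_algebra (wleavitt_gens E w))" "m \<in> N"
  shows "Act f m \<in> N"
proof (induction f rule: free_induct)
  case (add q xs c)
  have "set xs \<subseteq> wleavitt_gens E w" using add(1) assms(1) by (fastforce simp: free_carrier)
  then have "foldr act xs m \<in> N"
  proof (induction xs)
    case (Cons x xs)
    then show ?case using act_Nv[of x "foldr act xs m"] Nv_sub_N by auto
  qed (use assms in simp)
  then show ?case
    using add unfolding N_def by (auto simp: Act_add Act_scal Act_word intro!: words_in_add words_in_scal)
qed (simp add: N_def)

lemma Act_V:
  assumes "m \<in> Nv v"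
  shows "Act (V v) m = m"
  using assms unfolding Nv_def
  by (induction rule: words_in_induct) (auto simp: Act_add_right Act_scal_right Act_gen act_word)

lemma Act_rel:
  assumes "r \<in> wleavitt_rels E w" "normal l"
  shows "Act r (word l) = 0"
  using assms(1) unfolding wleavitt_rels_def
proof (elim UnE CollectE exE conjE)
  fix u v assume "r = V u * V v - (if u = v then V u else 0)"
  then show ?thesis by (auto simp: Act_diff Act_mult Act_gen act_word)
next
  fix e i assume r: "r = V (tail E e) * gen (WEdge e i) - gen (WEdge e i)" "e \<in> arcs E" "1 \<le> i" "i \<le> w e"
  have "WEdge e i \<in> wleavitt_gens E w" using r by (intro letter_gens) simp
  from red_normal[OF this assms(2)] have "red (WEdge e i) l \<in> Nv (tail E e)" by simp
  from Act_V[OF this] show ?thesis unfolding r Act_diff Act_mult by (simp only: Act_gen act_word) simp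
next
  fix e i assume r: "r = gen (WEdge e i) * V (head E e) - gen (WEdge e i)"
  have "red (WEdge e i) l = 0" if "head E e \<noteq> wsrc l" using that by simp
  then show ?thesis unfolding r Act_diff Act_mult Act_gen act_word red.simps(1)
    by (simp add: act_word del: red.simps)
next
  fix e i assume r: "r = V (head E e) * gen (WGhost e i) - gen (WGhost e i)" "e \<in> arcs E" "1 \<le> i" "i \<le> w e"
  have "WGhost e i \<in> wleavitt_gens E w" using r by (intro letter_gens) simp
  from red_normal[OF this assms(2)] have "red (WGhost e i) l \<in> Nv (head E e)" by simp
  from Act_V[OF this] show ?thesis unfolding r Act_diff Act_mult by (simp only: Act_gen act_word) simp
next
  fix e i assume r: "r = gen (WGhost e i) * V (tail E e) - gen (WGhost e i)"
  have "red (WGhost e i) l = 0" if "tail E e \<noteq> wsrc l" using that by simp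
  then show ?thesis unfolding r Act_diff Act_mult Act_gen act_word red.simps(1)
    by (simp add: act_word del: red.simps)
next
  fix v e f assume r: "r = (\<Sum>i = 1..vw v. Y e i * X f i) - (if e = f then V (head E e) else 0)"
    "e \<in> out_arcs E v" "f \<in> out_arcs E v"
  then have ef: "e \<in> arcs E" "f \<in> arcs E" "tail E e = tail E f" "v = tail E e" by auto
  have "Act (if e = f then V (head E e) else 0) (word l) = (if e = f \<and> wsrc l = head E e then word l else 0)"
    by (simp add: Act_gen act_word)
  then show ?thesis
    using Act_ghost_edge[OF ef(1,2,3) assms(2)] unfolding r(1) ef(4) by (simp only: Act_diff Act_sum Act_mult) simp
next
  fix v i j assume r: "r = (\<Sum>e\<in>out_arcs E v. X e i * Y e j) - (if i = j then V v else 0)"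
    "i \<in> {1..vw v}" "j \<in> {1..vw v}"
  have "Act (if i = j then V v else 0) (word l) = (if i = j \<and> wsrc l = v then word l else 0)"
    by (simp add: Act_gen act_word)
  then show ?thesis
    using Act_edge_ghost[OF r(2,3) assms(2)] unfolding r(1) by (simp only: Act_diff Act_sum Act_mult) simp
qed

text \<open>The elements of \<open>C\<close> that annihilate \<open>N\<close> form an ideal; closure
  under multiplication from the right uses that \<open>N\<close> is stable under the action.\<close>

lemma Act_ideal:
  assumes "f \<in> presentation.I (wleavitt_gens E w) (wleavitt_rels E w)" "m \<in> N"
  shows "Act f m = 0"
proof -
  interpret P: presentation "wleavitt_gens E w" "wleavitt_rels E w :: (_ \<Rightarrow>\<^sub>0 'k) set" by (rule pres)
  let ?Z = "{f \<in> P.C. \<forall>m\<in>N. Act f m = 0}"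
  have "two_sided_ideal (free_algebra (wleavitt_gens E w)) ?Z"
    by (auto simp: free_ideal_iff free_add free_scal free_mult Act_add Act_scal Act_mult Act_N)
  moreover have "Act r m = 0" if "r \<in> wleavitt_rels E w" "m \<in> N" for r m
    using that(2) unfolding N_def
    by (induction rule: words_in_induct) (auto simp: Act_add_right Act_scal_right Act_rel that(1))
  ultimately have "P.I \<subseteq> ?Z" using P.rels by (intro P.I_least) auto
  then show ?thesis using assms by auto
qed

lemma red_normal_Cons: "normal (x # l) \<Longrightarrow> red x l = word (x # l)"
  by (cases x) auto

lemma Act_normal:
  "normal (l @ z) \<Longrightarrow> Act (word l) (word z) = word (l @ z)"
proof (induction l)
  case (Cons x l)
  then show ?case by (simp add: Act_word act_word red_normal_Cons del: red.simps)
qed (simp add: Act_word)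

lemma Act_src:
  assumes "l \<noteq> []" "letter (last l)" "ltgt (last l) \<noteq> wsrc z"
  shows "Act (word l) (word z) = 0"
proof -
  have "act (last l) (word z) = 0" using assms(2,3) by (cases "last l") (auto simp: act_word)
  moreover have "foldr act l (word z) = foldr act (butlast l) (act (last l) (word z))"
    by (metis assms(1) append_butlast_last_id foldr_Cons foldr_Nil foldr_append comp_apply id_apply)
  ultimately show ?thesis by (simp add: Act_word foldr_act_zero)
qed

text \<open>An edge with index 2 is never the second letter of a redex, and a ghost edge with index 2 is never
  the first one. Hence no multiplication destroys such a word.\<close>

definition persistent :: "('v, 'e) wleavitt_gen list \<Rightarrow> bool" where
  "persistent l \<longleftrightarrow> l \<noteq> [] \<and> normal l \<and> wsrc l = s \<and> (\<exists>e. hd l = WEdge e 2) \<and> (\<exists>e. last l = WGhost e 2)"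

lemma normal_append:
  assumes "normal l" "l \<noteq> []" "last l = WGhost e 2" "normal z" "wsrc z = s"
  shows "normal (l @ z)"
  using assms(2,1,3)
proof (induction l rule: list_nonempty_induct)
  case (single x)
  have "z = [] \<or> \<not> redex (WGhost e 2) (hd z)" by (cases "hd z") auto
  then show ?case using single assms(4,5) by simp
next
  case (cons x l)
  then have "wsrc (l @ z) = wsrc l" "hd (l @ z) = hd l" by (cases l; simp)+
  then show ?case using cons by simp
qed

lemma persistent_normal: "persistent p \<Longrightarrow> normal z \<Longrightarrow> wsrc z = s \<Longrightarrow> normal (p @ z)"
  using normal_append[of p _ z] by (auto simp: persistent_def)

lemma persistent_append: "persistent p \<Longrightarrow> persistent q \<Longrightarrow> persistent (p @ q)"
proof -
  assume a: "persistent p" "persistent q"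
  have "wsrc (p @ q) = wsrc p" using a by (cases p) (auto simp: persistent_def)
  then show ?thesis
    using persistent_normal[OF a(1), of q] a by (auto simp: persistent_def)
qed

lemma persistent_concat:
  "ps \<noteq> [] \<Longrightarrow> (\<And>p. p \<in> set ps \<Longrightarrow> persistent p) \<Longrightarrow> persistent (concat ps)"
proof (induction ps rule: list_nonempty_induct)
  case (cons p ps)
  then show ?case using persistent_append[of p "concat ps"] by auto
qed simp

lemma persistent_ltgt: "persistent p \<Longrightarrow> letter (last p) \<and> ltgt (last p) = s"
proof -
  have "normal l \<Longrightarrow> l \<noteq> [] \<Longrightarrow> letter (last l) \<and> ltgt (last l) = s" for l
    by (induction l) (auto split: if_splits)
  then show "persistent p \<Longrightarrow> letter (last p) \<and> ltgt (last p) = s" by (simp add: persistent_def)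
qed

lemma normal_gens: "normal l \<Longrightarrow> set l \<subseteq> wleavitt_gens E w"
  by (induction l) (auto intro: letter_gens)

lemma Act_persistent:
  assumes "persistent p" "normal z"
  shows "Act (word p) (word z) = (if wsrc z = s then word (p @ z) else 0)"
  using Act_normal[OF persistent_normal[OF assms]] Act_src[of p z] persistent_ltgt[OF assms(1)] assms
  by (auto simp: persistent_def)

definition ending :: "('v, 'e) wleavitt_gen list set \<Rightarrow> ('v, 'e) wleavitt_gen list set" where
  "ending T = {x @ t | x t. t \<in> T}"

text \<open>By \<open>red_tail\<close> only the first letter of a word can be lost. If that letter
  belongs to the protected ending, it is an edge of index 2, and no redex has such a second
  letter.\<close>

lemma act_ending:
  assumes "\<And>t. t \<in> T \<Longrightarrow> t \<noteq> [] \<and> (\<exists>e. hd t = WEdge e 2)" "m \<in> words_in (ending T)"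
  shows "act x m \<in> words_in (ending T)"
proof -
  have "red x l \<in> words_in (ending T)" if l: "l \<in> ending T" for l
  proof -
    obtain y t where yt: "l = y @ t" "t \<in> T" using l by (auto simp: ending_def)
    have "{z @ t | z t. t = l \<or> l \<noteq> [] \<and> redex x (hd l) \<and> t = tl l} \<subseteq> ending T"
    proof (intro subsetI, elim CollectE exE conjE)
      fix u z t' assume u: "u = z @ t'" "t' = l \<or> l \<noteq> [] \<and> redex x (hd l) \<and> t' = tl l"
      show "u \<in> ending T"
      proof (cases "t' = l")
        case True
        then have "u = (z @ y) @ t" using u yt by simp
        then show ?thesis unfolding ending_def using yt(2) by blast
      next
        case False
        then have r: "redex x (hd l)" "t' = tl l" using u by auto
        have "y \<noteq> []"
        proof
          assume "y = []"
          then obtain e where "hd l = WEdge e 2" using assms(1)[OF yt(2)] yt(1) by auto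
          then show False using r(1) by (cases x) auto
        qed
        then have "u = (z @ tl y) @ t" using u r yt by simp
        then show ?thesis unfolding ending_def using yt(2) by blast
      qed
    qed
    then show ?thesis using words_in_mono red_tail[of x l] by blast
  qed
  then show ?thesis
    using words_in_Act[OF assms(2), of "gen x"] by (simp add: Act_gen act_word)
qed

lemma Act_ending:
  assumes "\<And>t. t \<in> T \<Longrightarrow> t \<noteq> [] \<and> (\<exists>e. hd t = WEdge e 2)" "m \<in> words_in (ending T)"
  shows "Act f m \<in> words_in (ending T)"
proof (induction f rule: free_induct)
  case (add q xs c)
  have "foldr act xs m \<in> words_in (ending T)"
    by (induction xs) (simp_all add: assms(2) act_ending[OF assms(1)])
  then show ?case using add by (auto simp: Act_add Act_scal Act_word intro!: words_in_add words_in_scal)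
qed simp

end

section \<open>Subspaces spanned by words and independence in a presented algebra\<close>

context presentation begin

lemma A_submodule_iff: "LinearCombinations.submodule class_ring V A \<longleftrightarrow> lin_subspace A V"
  by (auto simp: LinearCombinations.submodule_def A_subspace_iff A_module)

lemma A_submodule_vectorspace:
  "lin_subspace A V \<Longrightarrow> vectorspace class_ring (A\<lparr>carrier := V\<rparr>)"
  using LinearCombinations.module.submodule_is_module[OF A_module, of V] class_field
  by (simp add: A_submodule_iff vectorspace_def)

text \<open>Required because \<open>gk_dim\<close> restricts the carrier to a subalgebra and then
  speaks of subspaces of the restricted algebra.\<close>

lemma subspace_restrict:
  assumes "lin_subspace A B"
  shows "lin_subspace (A\<lparr>carrier := B\<rparr>) V \<longleftrightarrow> V \<subseteq> B \<and> lin_subspace A V"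
proof -
  have "Module.module class_ring (A\<lparr>carrier := B\<rparr>)"
    using A_submodule_vectorspace[OF assms] by (simp add: vectorspace_def)
  from module.lin_subspace_iff[OF this, of V] show ?thesis
    using assms by (auto simp: A_subspace_iff)
qed

definition word_space :: "'x list set \<Rightarrow> ('x fmon \<Rightarrow>\<^sub>0 'k) set set" where
  "word_space U = proj ` {f. \<forall>u\<in>Poly_Mapping.keys f. letters u \<in> U}"

lemma proj_word_in_word_space: "l \<in> U \<Longrightarrow> proj (word l) \<in> word_space U"
  by (auto simp: word_space_def)

context
  fixes U :: "'x list set"
  assumes U: "\<And>l. l \<in> U \<Longrightarrow> l \<noteq> [] \<and> set l \<subseteq> X"
begin

lemma word_space_C: "\<forall>u\<in>Poly_Mapping.keys f. letters u \<in> U \<Longrightarrow> f \<in> C"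
  using U by (auto simp: free_carrier)

lemma word_space_subspace: "lin_subspace A (word_space U)"
  unfolding A_subspace_iff
proof (intro conjI ballI allI)
  show "word_space U \<subseteq> carrier A" using word_space_C by (auto simp: word_space_def carrier_A)
  have "0 \<in> {f :: _ \<Rightarrow>\<^sub>0 'k. \<forall>u\<in>Poly_Mapping.keys f. letters u \<in> U}" by simp
  then show "\<zero>\<^bsub>A\<^esub> \<in> word_space U" unfolding A_zero word_space_def by (rule imageI)
next
  fix x y assume "x \<in> word_space U" "y \<in> word_space U"
  then obtain f g where fg: "x = proj f" "y = proj g" "\<forall>u\<in>Poly_Mapping.keys f. letters u \<in> U"
    "\<forall>u\<in>Poly_Mapping.keys g. letters u \<in> U" by (auto simp: word_space_def)
  then have "f + g \<in> {f. \<forall>u\<in>Poly_Mapping.keys f. letters u \<in> U}" using keys_add[of f g] by auto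
  then show "x \<oplus>\<^bsub>A\<^esub> y \<in> word_space U" unfolding fg A_add word_space_def by (rule imageI)
next
  fix c x assume "x \<in> word_space U"
  then obtain f where f: "x = proj f" "\<forall>u\<in>Poly_Mapping.keys f. letters u \<in> U" by (auto simp: word_space_def)
  then have "scal c f \<in> {f. \<forall>u\<in>Poly_Mapping.keys f. letters u \<in> U}" using keys_scal[of c f] by auto
  then show "c \<odot>\<^bsub>A\<^esub> x \<in> word_space U" unfolding f A_smult word_space_def by (rule imageI)
qed

lemma span_words: "LinearCombinations.module.span class_ring A ((\<lambda>l. proj (word l)) ` U) = word_space U"
proof
  show "LinearCombinations.module.span class_ring A ((\<lambda>l. proj (word l)) ` U) \<subseteq> word_space U"
    using word_space_subspace proj_word_in_word_space
    by (intro LinearCombinations.module.span_is_subset[OF A_module]) (auto simp: A_submodule_iff)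
  have sub: "(\<lambda>l. proj (word l)) ` U \<subseteq> carrier A"
    using U by (auto simp: carrier_A free_word)
  note S = LinearCombinations.module.span_is_submodule[OF A_module sub, unfolded A_submodule_iff A_subspace_iff]
  have own: "(\<lambda>l. proj (word l)) ` U \<subseteq> LinearCombinations.module.span class_ring A ((\<lambda>l. proj (word l)) ` U)"
    by (rule LinearCombinations.module.in_own_span[OF A_module sub])
  show "word_space U \<subseteq> LinearCombinations.module.span class_ring A ((\<lambda>l. proj (word l)) ` U)"
  proof
    fix x assume "x \<in> word_space U"
    then obtain f where f: "x = proj f" "\<forall>u\<in>Poly_Mapping.keys f. letters u \<in> U"
      by (auto simp: word_space_def)
    have "proj f \<in> LinearCombinations.module.span class_ring A ((\<lambda>l. proj (word l)) ` U)"
    proof (induction f rule: free_induct)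
      case (add q xs c)
      have "xs \<in> U" using add(1) f(2) by auto
      then have "c \<odot>\<^bsub>A\<^esub> proj (word xs) \<in> LinearCombinations.module.span class_ring A ((\<lambda>l. proj (word l)) ` U)"
        using S own by blast
      then have "c \<odot>\<^bsub>A\<^esub> proj (word xs) \<oplus>\<^bsub>A\<^esub> proj q \<in> LinearCombinations.module.span class_ring A ((\<lambda>l. proj (word l)) ` U)"
        using S add(2) by blast
      then show ?case by (simp add: A_smult A_add)
    qed (use S A_zero in simp)
    with f show "x \<in> LinearCombinations.module.span class_ring A ((\<lambda>l. proj (word l)) ` U)" by simp
  qed
qed

lemma word_space_fin_dim:
  assumes "finite U"
  shows "vectorspace.fin_dim class_ring (A\<lparr>carrier := word_space U\<rparr>)"
proof -
  have "LinearCombinations.module.span class_ring (A\<lparr>carrier := word_space U\<rparr>) ((\<lambda>l. proj (word l)) ` U) = word_space U"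
    using LinearCombinations.module.span_li_not_depend(1)[OF A_module, of "(\<lambda>l. proj (word l)) ` U" "word_space U"]
      word_space_subspace proj_word_in_word_space span_words
    by (auto simp: A_submodule_iff)
  then show ?thesis
    using assms proj_word_in_word_space
    unfolding vectorspace.fin_dim_def[OF A_submodule_vectorspace[OF word_space_subspace]]
    by (intro exI[of _ "(\<lambda>l. proj (word l)) ` U"]) auto
qed

end

text \<open>Distinct words are independent in the free ring, where the coefficient at a word can be
  read off; \<open>T\<close> transports a linear relation there.\<close>

lemma lin_indpt_words:
  assumes "S \<subseteq> carrier A"
    and T_add: "\<And>x y. x \<in> carrier A \<Longrightarrow> y \<in> carrier A \<Longrightarrow> T (x \<oplus>\<^bsub>A\<^esub> y) = T x + (T y :: 'z fmon \<Rightarrow>\<^sub>0 'k)"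
    and T_smult: "\<And>c x. x \<in> carrier A \<Longrightarrow> T (c \<odot>\<^bsub>A\<^esub> x) = scal c (T x)"
    and T_word: "\<And>x. x \<in> S \<Longrightarrow> T x = word (g x)" and inj: "inj_on g S"
  shows "\<not> LinearCombinations.module.lin_dep class_ring A S"
proof
  assume "LinearCombinations.module.lin_dep class_ring A S"
  then obtain B a v where B: "finite B" "B \<subseteq> S" "LinearCombinations.module.lincomb A a B = \<zero>\<^bsub>A\<^esub>" "v \<in> B" "a v \<noteq> 0"
    unfolding LinearCombinations.module.lin_dep_def[OF A_module] by auto
  have T0: "T \<zero>\<^bsub>A\<^esub> = 0"
    using T_add[of "\<zero>\<^bsub>A\<^esub>" "\<zero>\<^bsub>A\<^esub>"] by (simp add: A_zero A_add carrier_A)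
  have "LinearCombinations.module.lincomb A a D \<in> carrier A \<and> T (LinearCombinations.module.lincomb A a D) = (\<Sum>x\<in>D. scal (a x) (T x))"
    if "finite D" "D \<subseteq> carrier A" for D
    using that
  proof (induction D rule: finite_induct)
    case empty
    interpret Module.module class_ring A by (rule A_module)
    show ?case using T0 by (simp add: lincomb_def)
  next
    case (insert x D)
    interpret Module.module class_ring A by (rule A_module)
    have l: "LinearCombinations.module.lincomb A a (insert x D) = a x \<odot>\<^bsub>A\<^esub> x \<oplus>\<^bsub>A\<^esub> LinearCombinations.module.lincomb A a D"
      using lincomb_insert[of D a x] insert by simp
    have x: "x \<in> carrier A" "a x \<odot>\<^bsub>A\<^esub> x \<in> carrier A" using insert by auto
    show ?case unfolding l using insert x by (simp add: T_add T_smult)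
  qed
  note key = this
  have BA: "B \<subseteq> carrier A" using B(2) assms(1) by blast
  have "(\<Sum>x\<in>B. scal (a x) (word (g x) :: 'z fmon \<Rightarrow>\<^sub>0 'k)) = (\<Sum>x\<in>B. scal (a x) (T x))"
    by (rule sum.cong[OF refl]) (use B(2) T_word in \<open>simp add: subset_iff\<close>)
  also have "\<dots> = 0" using key[OF B(1) BA] B(3) T0 by simp
  finally have "(\<Sum>x\<in>B. scal (a x) (word (g x) :: 'z fmon \<Rightarrow>\<^sub>0 'k)) = 0" .
  then have "Poly_Mapping.lookup (\<Sum>x\<in>B. scal (a x) (word (g x) :: 'z fmon \<Rightarrow>\<^sub>0 'k)) (FMon (g v)) = 0" by simp
  also have "Poly_Mapping.lookup (\<Sum>x\<in>B. scal (a x) (word (g x) :: 'z fmon \<Rightarrow>\<^sub>0 'k)) (FMon (g v)) =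
      (\<Sum>x\<in>B. if x = v then a x else 0)"
    unfolding lookup_sum
    by (rule sum.cong[OF refl]) (use B inj in \<open>auto simp: lookup_word inj_on_def\<close>)
  also have "\<dots> = a v" using B by simp
  finally show False using B by simp
qed

end

section \<open>Algebras containing a free pair of words\<close>

text \<open>Equal lengths make products of \<open>p\<close> and \<open>q\<close> uniquely decodable;
  degree 0 is asked of \<open>p\<close> so that all its powers lie in the same component.\<close>

locale free_pair = normal_forms E w K s
  for E :: "('v, 'e) pre_digraph" and w :: "'e \<Rightarrow> nat" and K :: "'k::field itself" and s +
  fixes p q :: "('v, 'e) wleavitt_gen list"
  assumes p: "persistent p" and q: "persistent q" and pq: "p \<noteq> q" and len: "length p = length q"
    and deg: "word_degree (FMon p) = 0"
begin

sublocale P: presentation "wleavitt_gens E w" "wleavitt_rels E w :: (_ \<Rightarrow>\<^sub>0 'k) set"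
  by (rule pres)

abbreviation L where "L \<equiv> P.A"

text \<open>Evaluation at the empty word, which stands for \<open>s\<close>: the value is the normal
  form of x s. Well defined since the ideal of relations annihilates the module.\<close>

definition T where "T = P.lift (\<lambda>f. Act f 1)"

lemma one_N: "1 \<in> N"
  using words_in_word[of "[]"] by (simp add: N_def)

lemma T_proj: "f \<in> P.C \<Longrightarrow> T (P.proj f) = Act f 1"
  unfolding T_def
proof (rule P.lift_proj)
  fix f g assume "f - g \<in> P.I"
  then have "Act (f - g) 1 = 0" using one_N by (rule Act_ideal)
  then show "Act f 1 = Act g 1" by (simp add: Act_diff)
qed

lemma T_add: "x \<in> carrier L \<Longrightarrow> y \<in> carrier L \<Longrightarrow> T (x \<oplus>\<^bsub>L\<^esub> y) = T x + T y"
  by (auto simp: P.carrier_A P.A_add T_proj free_add Act_add)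

lemma T_smult: "x \<in> carrier L \<Longrightarrow> T (c \<odot>\<^bsub>L\<^esub> x) = scal c (T x)"
  by (auto simp: P.carrier_A P.A_smult T_proj free_scal Act_scal)

lemma T_mult: "f \<in> P.C \<Longrightarrow> x \<in> carrier L \<Longrightarrow> T (P.proj f \<otimes>\<^bsub>L\<^esub> x) = Act f (T x)"
  by (auto simp: P.carrier_A P.A_mult T_proj free_mult Act_mult)

lemma normal_C: "normal l \<Longrightarrow> l \<noteq> [] \<Longrightarrow> word l \<in> P.C"
  using normal_gens by (simp add: free_word)

lemma T_word: "normal l \<Longrightarrow> l \<noteq> [] \<Longrightarrow> T (P.proj (word l)) = word l"
  using Act_normal[of l "[]"] by (simp add: T_proj normal_C)

lemma persistent_C: "persistent l \<Longrightarrow> word l \<in> P.C"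
  by (rule normal_C) (auto simp: persistent_def)

lemma T_persistent: "persistent l \<Longrightarrow> T (P.proj (word l)) = word l"
  by (rule T_word) (auto simp: persistent_def)

lemma persistent_head: "persistent l \<Longrightarrow> l \<noteq> [] \<and> (\<exists>e. hd l = WEdge e 2)"
  by (simp add: persistent_def)

lemma p_Cons: "p \<noteq> []" using p by (simp add: persistent_def)

lemma lin_indpt_persistent:
  assumes "\<And>l. l \<in> U \<Longrightarrow> persistent l"
  shows "\<not> LinearCombinations.module.lin_dep class_ring L ((\<lambda>l. P.proj (word l)) ` U)"
    and "inj_on (\<lambda>l. P.proj (word l)) U"
proof -
  have T: "T (P.proj (word l)) = word l" if "l \<in> U" for l
    using that assms T_persistent by blast
  have inj: "inj_on (\<lambda>l. P.proj (word l)) U"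
  proof (rule inj_onI)
    fix l l' assume l: "l \<in> U" "l' \<in> U" "P.proj (word l) = P.proj (word l')"
    then have "word l = (word l' :: _ \<Rightarrow>\<^sub>0 'k)" using T by metis
    then have "Poly_Mapping.keys (word l :: _ \<Rightarrow>\<^sub>0 'k) = Poly_Mapping.keys (word l' :: _ \<Rightarrow>\<^sub>0 'k)" by simp
    then show "l = l'" by simp
  qed
  then show "inj_on (\<lambda>l. P.proj (word l)) U" .
  have g: "inv_into U (\<lambda>l. P.proj (word l)) (P.proj (word l)) = l" if "l \<in> U" for l
    by (rule inv_into_f_f[OF inj that])
  show "\<not> LinearCombinations.module.lin_dep class_ring L ((\<lambda>l. P.proj (word l)) ` U)"
  proof (rule P.lin_indpt_words[of _ T "inv_into U (\<lambda>l. P.proj (word l))"])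
    show "(\<lambda>l. P.proj (word l)) ` U \<subseteq> carrier L"
      using assms persistent_C by (auto simp: P.carrier_A)
    show "inj_on (inv_into U (\<lambda>l. P.proj (word l))) ((\<lambda>l. P.proj (word l)) ` U)"
      by (rule inj_on_inv_into) simp
  qed (use T g T_add T_smult in auto)
qed

lemma lattice_zero: "0 \<in> weight_lattice E w"
  and lattice_add: "g \<in> weight_lattice E w \<Longrightarrow> h \<in> weight_lattice E w \<Longrightarrow> g + h \<in> weight_lattice E w"
  using keys_add[of g h] by (auto simp: weight_lattice_def)

lemma word_degree_lattice:
  "set l \<subseteq> wleavitt_gens E w \<Longrightarrow> word_degree (FMon l) \<in> weight_lattice E w"
proof (induction l)
  case Nil
  then show ?case by (simp add: word_degree_def lattice_zero)
next
  case (Cons x l)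
  have "gen_degree x \<in> weight_lattice E w"
    using Cons(2) by (auto simp: wleavitt_gens_def weight_lattice_def)
  then show ?case using Cons lattice_add by (simp add: word_degree_def)
qed

lemma component_word:
  assumes "l \<noteq> []" "set l \<subseteq> wleavitt_gens E w"
  shows "P.proj (word l) \<in> wleavitt_component E w (word_degree (FMon l))"
  unfolding wleavitt_component_def P.proj_def P.I_def
  using assms by (intro CollectI exI[of _ "word l"]) (simp add: free_word)

lemma ending_self: "t \<in> U \<Longrightarrow> t \<in> ending U"
  unfolding ending_def by (intro CollectI exI[of _ "[]"] exI[of _ t]) simp

text \<open>The letters around \<open>p\<close> are arbitrary and normality is not asked for, so the
  set is closed under multiplication by words and spans the ideal generated by \<open>p\<close>.
  Being spanned by words, this ideal is graded.\<close>

definition containing :: "('v, 'e) wleavitt_gen list set" where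
  "containing = {x @ p @ y | x y. set x \<subseteq> wleavitt_gens E w \<and> set y \<subseteq> wleavitt_gens E w}"

lemma containing_gens: "l \<in> containing \<Longrightarrow> l \<noteq> [] \<and> set l \<subseteq> wleavitt_gens E w"
  using p p_Cons normal_gens[of p] by (auto simp: containing_def persistent_def)

lemma containing_word_mult:
  assumes "\<forall>u\<in>Poly_Mapping.keys f. letters u \<in> containing" "a \<in> P.C"
  shows "\<forall>u\<in>Poly_Mapping.keys (a * f). letters u \<in> containing"
    "\<forall>u\<in>Poly_Mapping.keys (f * a). letters u \<in> containing"
proof -
  have "v @ u \<in> containing \<and> u @ v \<in> containing" if h: "u \<in> containing" "set v \<subseteq> wleavitt_gens E w" for u v
  proof -
    obtain x y where xy: "u = x @ p @ y" "set x \<subseteq> wleavitt_gens E w" "set y \<subseteq> wleavitt_gens E w"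
      using h(1) by (auto simp: containing_def)
    then have "v @ u = (v @ x) @ p @ y" "u @ v = x @ p @ (y @ v)" by simp_all
    moreover have "set (v @ x) \<subseteq> wleavitt_gens E w" "set (y @ v) \<subseteq> wleavitt_gens E w"
      using xy h(2) by simp_all
    ultimately show ?thesis unfolding containing_def using xy(2,3) by blast
  qed
  note c = this
  have a: "set (letters v) \<subseteq> wleavitt_gens E w" if "v \<in> Poly_Mapping.keys a" for v
    using assms(2) that by (auto simp: free_carrier)
  show "\<forall>u\<in>Poly_Mapping.keys (a * f). letters u \<in> containing"
    using keys_mult[of a f] assms(1) a c by (fastforce simp: plus_fmon_def)
  show "\<forall>u\<in>Poly_Mapping.keys (f * a). letters u \<in> containing"
    using keys_mult[of f a] assms(1) a c by (fastforce simp: plus_fmon_def)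
qed

lemma ideal_containing: "two_sided_ideal L (P.word_space containing)"
  unfolding two_sided_ideal_def
proof (intro conjI ballI)
  show "lin_subspace L (P.word_space containing)"
    by (rule P.word_space_subspace) (rule containing_gens)
next
  fix a x assume "a \<in> carrier L" "x \<in> P.word_space containing"
  then obtain b f where bf: "a = P.proj b" "b \<in> P.C" "x = P.proj f"
    "\<forall>u\<in>Poly_Mapping.keys f. letters u \<in> containing"
    by (auto simp: P.carrier_A P.word_space_def)
  have "f \<in> P.C" using bf(4) containing_gens by (auto simp: free_carrier)
  then have "a \<otimes>\<^bsub>L\<^esub> x = P.proj (b * f)" "x \<otimes>\<^bsub>L\<^esub> a = P.proj (f * b)"
    using bf(1,2,3) by (simp_all add: P.A_mult)
  then show "a \<otimes>\<^bsub>L\<^esub> x \<in> P.word_space containing" "x \<otimes>\<^bsub>L\<^esub> a \<in> P.word_space containing"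
    using containing_word_mult[OF bf(4,2)] unfolding P.word_space_def by blast+
qed

lemma graded_containing:
  "graded_ideal L (weight_lattice E w) (wleavitt_component E w) (P.word_space containing)"
  unfolding graded_ideal_def
proof (intro conjI ideal_containing)
  let ?J = "P.word_space containing"
  let ?H = "\<Union>g\<in>weight_lattice E w. ?J \<inter> wleavitt_component E w g"
  have sub: "lin_subspace L ?J" using ideal_containing by (simp add: two_sided_ideal_def)
  have "LinearCombinations.module.span class_ring L ?H \<subseteq> ?J"
    using sub by (intro LinearCombinations.module.span_is_subset[OF P.A_module]) (auto simp: P.A_submodule_iff)
  moreover have "?J \<subseteq> LinearCombinations.module.span class_ring L ?H"
  proof -
    have "(\<lambda>l. P.proj (word l)) ` containing \<subseteq> ?H"
    proof (intro image_subsetI)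
      fix l assume l: "l \<in> containing"
      have "P.proj (word l) \<in> ?J" using l by (rule P.proj_word_in_word_space)
      moreover have "P.proj (word l) \<in> wleavitt_component E w (word_degree (FMon l))"
        "word_degree (FMon l) \<in> weight_lattice E w"
        using containing_gens[OF l] component_word word_degree_lattice by auto
      ultimately show "P.proj (word l) \<in> ?H" by blast
    qed
    from LinearCombinations.module.span_is_monotone[OF P.A_module this] show ?thesis
      by (simp only: P.span_words[OF containing_gens])
  qed
  ultimately show "?J = LinearCombinations.module.span class_ring L ?H" by blast
qed

text \<open>After \<open>y\<close> has acted, \<open>p\<close> is put in front of each surviving
  normal word, and by \<open>Act_ending\<close> nothing that acts later can remove it. Hence the
  empty word does not occur.\<close>

lemma Act_containing:
  assumes "l \<in> containing"
  shows "Act (word l) 1 \<in> words_in {l. l \<noteq> []}"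
proof -
  obtain x y where xy: "l = x @ p @ y" "set y \<subseteq> wleavitt_gens E w"
    using assms by (auto simp: containing_def)
  have "Act (word y) 1 \<in> N"
  proof (cases "y = []")
    case False
    then show ?thesis using xy by (intro Act_N one_N) (simp add: free_word)
  qed (simp add: one_N)
  moreover have "Act (word p) m \<in> words_in (ending {p @ z | z. True})" if "m \<in> N" for m
    using that unfolding N_def
  proof (rule words_in_Act)
    fix z assume "z \<in> {l. normal l}"
    then have "Act (word p) (word z) = (if wsrc z = s then word (p @ z) else 0)"
      by (intro Act_persistent p) simp
    moreover have "p @ z \<in> ending {p @ z | z. True}" by (rule ending_self) blast
    ultimately show "Act (word p) (word z) \<in> words_in (ending {p @ z | z. True})"
      by (simp add: words_in_word)
  qed
  ultimately have "Act (word p) (Act (word y) 1) \<in> words_in (ending {p @ z | z. True})"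
    by blast
  then have "Act (word x) (Act (word p) (Act (word y) 1)) \<in> words_in (ending {p @ z | z. True})"
    by (rule Act_ending[rotated]) (use persistent_head[OF p] in auto)
  also have "\<dots> \<subseteq> words_in {l. l \<noteq> []}"
    using p_Cons by (intro words_in_mono) (auto simp: ending_def)
  finally show ?thesis unfolding xy(1) by (simp add: word_append Act_mult)
qed

lemma s_vert: "s \<in> verts E"
proof -
  have "letter (last p)" "ltgt (last p) = s" using persistent_ltgt[OF p] by auto
  then show ?thesis by (cases "last p") auto
qed

lemma not_graded_simple: "\<not> graded_simple L (weight_lattice E w) (wleavitt_component E w)"
proof
  let ?J = "P.word_space containing"
  assume "graded_simple L (weight_lattice E w) (wleavitt_component E w)"
  then have "?J = {\<zero>\<^bsub>L\<^esub>} \<or> ?J = carrier L"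
    using graded_containing by (auto simp: graded_simple_def)
  moreover have "?J \<noteq> {\<zero>\<^bsub>L\<^esub>}"
  proof
    assume J: "?J = {\<zero>\<^bsub>L\<^esub>}"
    have "p \<in> containing" unfolding containing_def by (intro CollectI exI[of _ "[]"]) simp
    then have "P.proj (word p) \<in> ?J" by (rule P.proj_word_in_word_space)
    then have "T (P.proj (word p)) = T (P.proj 0)" using J by (simp add: P.A_zero)
    then show False using T_persistent[OF p] by (simp add: T_proj)
  qed
  moreover have "?J \<noteq> carrier L"
  proof
    assume J: "?J = carrier L"
    \<comment> \<open>The vertex \<open>s\<close> fixes the empty word, so as a member of the ideal
      it would contradict \<open>Act_containing\<close>.\<close>
    have V: "V s \<in> P.C" using s_vert by (simp add: free_gen wleavitt_gens_def)
    then have "P.proj (V s) \<in> ?J" by (simp add: J P.carrier_A)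
    then obtain f where f: "P.proj (V s) = P.proj f" "\<forall>u\<in>Poly_Mapping.keys f. letters u \<in> containing"
      by (auto simp: P.word_space_def)
    have fC: "f \<in> P.C" using f(2) containing_gens by (auto simp: free_carrier)
    have "Act f 1 = Act (V s) 1" using f(1) T_proj[OF fC] T_proj[OF V] by simp
    also have "\<dots> = word []" using act_word[of "WVertex s" "[]"] by (simp add: Act_gen)
    finally have "Act f 1 = word []" .
    moreover have "Act f 1 \<in> words_in {l. l \<noteq> []}"
    proof (induction f rule: free_induct)
      case (add q xs c)
      have "xs \<in> containing" using add(1) f(2) by auto
      then show ?case using Act_containing[of xs] add(2)
        by (auto simp: Act_add Act_scal intro!: words_in_add words_in_scal)
    qed simp
    ultimately show False using words_in_word[of "[]" "{l. l \<noteq> []}"] by simp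
  qed
  ultimately show False by blast
qed

lemma not_simple: "\<not> simple_algebra L"
  using not_graded_simple by (auto simp: simple_algebra_def graded_simple_def graded_ideal_def)

text \<open>In p x p every word has the form p z with z ending in p. It is longer than p, so p x p =
  p is impossible.\<close>

lemma not_regular: "\<not> von_neumann_regular L"
proof
  assume "von_neumann_regular L"
  moreover have "P.proj (word p) \<in> carrier L" using persistent_C[OF p] by (simp add: P.carrier_A)
  ultimately obtain x where "x \<in> carrier L" "P.proj (word p) \<otimes>\<^bsub>L\<^esub> x \<otimes>\<^bsub>L\<^esub> P.proj (word p) = P.proj (word p)"
    unfolding von_neumann_regular_def by blast
  then obtain f where f: "f \<in> P.C" "P.proj (word p * f * word p) = P.proj (word p)"
    using persistent_C[OF p] by (auto simp: P.carrier_A P.A_mult free_mult)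
  have pC: "word p \<in> P.C" by (rule persistent_C[OF p])
  have m: "Act (word p) 1 = word p" using T_persistent[OF p] by (simp add: T_proj pC)
  let ?m = "Act f (word p)"
  have "Act (word p) ?m = word p"
    using arg_cong[OF f(2), of T] f(1) pC m by (simp add: T_proj free_mult Act_mult)
  moreover have "Act (word p) ?m \<in> words_in {l. length p < length l}"
  proof (rule words_in_Act)
    have "word p \<in> N" using p by (simp add: N_def words_in_word persistent_def)
    then have "?m \<in> N" using f(1) by (intro Act_N)
    moreover have "?m \<in> words_in (ending {p})"
      using persistent_head[OF p]
      by (intro Act_ending) (auto simp: words_in_word ending_def)
    ultimately show "?m \<in> words_in ({l. normal l} \<inter> ending {p})"
      by (simp add: N_def words_in_def)
  next
    fix z assume z: "z \<in> {l. normal l} \<inter> ending {p}"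
    then have "length p < length (p @ z)" using p_Cons by (auto simp: ending_def)
    then show "Act (word p) (word z) \<in> words_in {l. length p < length l}"
      using Act_persistent[OF p, of z] z by (auto simp: words_in_word)
  qed
  ultimately show False by (simp add: words_in_word)
qed

text \<open>Left ideals are described by normal forms instead of generators, so that membership of a
  persistent word is decided by looking at its end.\<close>

definition ending_ideal where
  "ending_ideal U = {x \<in> carrier L. T x \<in> words_in (ending U)}"

lemma ending_left_ideal:
  assumes "\<And>l. l \<in> U \<Longrightarrow> persistent l"
  shows "left_ideal L (ending_ideal U)"
  unfolding left_ideal_def P.A_subspace_iff
proof (intro conjI ballI allI)
  show "\<zero>\<^bsub>L\<^esub> \<in> ending_ideal U"
    by (simp add: ending_ideal_def P.A_zero P.carrier_A T_proj)
next
  interpret Module.module class_ring L by (rule P.A_module)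
  fix x y assume "x \<in> ending_ideal U" "y \<in> ending_ideal U"
  then show "x \<oplus>\<^bsub>L\<^esub> y \<in> ending_ideal U"
    by (auto simp: ending_ideal_def T_add intro: words_in_add)
next
  interpret Module.module class_ring L by (rule P.A_module)
  fix c x assume "x \<in> ending_ideal U"
  then show "c \<odot>\<^bsub>L\<^esub> x \<in> ending_ideal U"
    by (auto simp: ending_ideal_def T_smult intro: words_in_scal)
next
  fix a x assume a: "a \<in> carrier L" "x \<in> ending_ideal U"
  then obtain f where f: "a = P.proj f" "f \<in> P.C" by (auto simp: P.carrier_A)
  have "a \<otimes>\<^bsub>L\<^esub> x \<in> carrier L"
    using a by (auto simp: ending_ideal_def P.carrier_A P.A_mult free_mult)
  moreover have "T (a \<otimes>\<^bsub>L\<^esub> x) \<in> words_in (ending U)"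
    using a f persistent_head assms by (auto simp: ending_ideal_def T_mult intro!: Act_ending)
  ultimately show "a \<otimes>\<^bsub>L\<^esub> x \<in> ending_ideal U" by (simp add: ending_ideal_def)
qed (auto simp: ending_ideal_def)

lemma persistent_ending_ideal:
  "persistent l \<Longrightarrow> P.proj (word l) \<in> ending_ideal U \<longleftrightarrow> l \<in> ending U"
  using persistent_C by (auto simp: ending_ideal_def T_persistent words_in_word P.carrier_A)

text \<open>The power of \<open>p\<close> with exponent m + 1 lies in the ideal with number m, but
  it is too short to end in a higher power.\<close>

lemma not_artinian: "\<not> artinian_algebra L"
proof
  define U where "U n = {concat (replicate k p) | k. Suc n \<le> k}" for n
  have U: "persistent l" if "l \<in> U n" for l n
    using that p by (auto simp: U_def intro!: persistent_concat)
  assume chain: "artinian_algebra L"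
  have mon: "ending_ideal (U (Suc n)) \<subseteq> ending_ideal (U n)" for n
  proof -
    have "U (Suc n) \<subseteq> U n" by (auto simp: U_def)
    then have "ending (U (Suc n)) \<subseteq> ending (U n)" by (auto simp: ending_def)
    then show ?thesis using words_in_mono by (auto simp: ending_ideal_def)
  qed
  have "left_ideal L (ending_ideal (U n))" for n by (rule ending_left_ideal) (rule U)
  then obtain m where m: "\<forall>n\<ge>m. ending_ideal (U n) = ending_ideal (U m)"
    using chain[unfolded artinian_algebra_def, rule_format, of "\<lambda>n. ending_ideal (U n)"] mon by blast
  have eq: "ending_ideal (U (Suc m)) = ending_ideal (U m)" by (rule m[rule_format]) simp
  let ?l = "concat (replicate (Suc m) p)"
  have l: "?l \<in> U m" unfolding U_def by blast
  then have "?l \<in> ending (U m)" by (rule ending_self)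
  then have "P.proj (word ?l) \<in> ending_ideal (U m)"
    by (rule persistent_ending_ideal[OF U[OF l], THEN iffD2])
  then have "P.proj (word ?l) \<in> ending_ideal (U (Suc m))" by (simp only: eq)
  then have "?l \<in> ending (U (Suc m))"
    by (rule persistent_ending_ideal[OF U[OF l], THEN iffD1])
  then obtain x k where "?l = x @ concat (replicate k p)" and k: "Suc (Suc m) \<le> k"
    unfolding ending_def U_def by blast
  then have "length ?l = length (x @ concat (replicate k p))" by (simp only:)
  then have "Suc m * length p = length x + k * length p"
    by (simp only: length_append length_concat map_replicate sum_list_replicate) simp
  then have "k * length p \<le> Suc m * length p" by linarith
  then have "k \<le> Suc m" using p_Cons by (simp only: mult_le_cancel2 length_greater_0_conv simp_thms)
  then show False using k by simp
qed

text \<open>The leading \<open>p\<close> marks the number of factors \<open>q\<close>: if p q^(m+1)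
  ended in p q^k with k at most m, cancelling q^k and comparing the last blocks would give q = p, as
  both have the same length.\<close>

lemma not_noetherian: "\<not> noetherian_algebra L"
proof
  define U where "U n = {p @ concat (replicate k q) | k. k \<le> n}" for n
  have pk: "persistent (p @ concat (replicate k q))" for k
    using persistent_concat[of "p # replicate k q"] p q by auto
  then have U: "persistent l" if "l \<in> U n" for l n using that by (auto simp: U_def)
  assume chain: "noetherian_algebra L"
  have mon: "ending_ideal (U n) \<subseteq> ending_ideal (U (Suc n))" for n
  proof -
    have "U n \<subseteq> U (Suc n)" by (auto simp: U_def)
    then have "ending (U n) \<subseteq> ending (U (Suc n))" by (auto simp: ending_def)
    then show ?thesis using words_in_mono by (auto simp: ending_ideal_def)
  qed
  have "left_ideal L (ending_ideal (U n))" for n by (rule ending_left_ideal) (rule U)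
  then obtain m where m: "\<forall>n\<ge>m. ending_ideal (U n) = ending_ideal (U m)"
    using chain[unfolded noetherian_algebra_def, rule_format, of "\<lambda>n. ending_ideal (U n)"] mon by blast
  have eq: "ending_ideal (U (Suc m)) = ending_ideal (U m)" by (rule m[rule_format]) simp
  let ?l = "p @ concat (replicate (Suc m) q)"
  have l: "?l \<in> U (Suc m)" unfolding U_def by blast
  then have "?l \<in> ending (U (Suc m))" by (rule ending_self)
  then have "P.proj (word ?l) \<in> ending_ideal (U (Suc m))"
    by (rule persistent_ending_ideal[OF pk, THEN iffD2])
  then have "P.proj (word ?l) \<in> ending_ideal (U m)" by (simp only: eq)
  then have "?l \<in> ending (U m)"
    by (rule persistent_ending_ideal[OF pk, THEN iffD1])
  then obtain x k where k: "?l = x @ p @ concat (replicate k q)" "k \<le> m"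
    unfolding ending_def U_def by blast
  have "replicate (Suc m) q = replicate (m - k) q @ replicate (Suc k) q"
    using k(2) by (simp only: replicate_add[symmetric]) simp
  then have "concat (replicate (Suc m) q) = concat (replicate (m - k) q) @ q @ concat (replicate k q)"
    by (simp only: concat_append) simp
  then have "(p @ concat (replicate (m - k) q)) @ q = x @ p"
    using k(1) by (simp only: append_assoc[symmetric] append_same_eq)
  then have "q = p"
    by (rule append_eq_append_conv[THEN iffD1, THEN conjunct2, rotated]) (simp add: len)
  then show False using pq by simp
qed

lemma not_locally_finite: "\<not> locally_finite L (weight_lattice E w) (wleavitt_component E w)"
proof
  let ?c = "wleavitt_component E w 0 :: (_ fmon \<Rightarrow>\<^sub>0 'k) set set"
  define U where "U = range (\<lambda>k. concat (replicate (Suc k) p))"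
  let ?S = "(\<lambda>l. P.proj (word l)) ` U"
  have U: "persistent l" if h: "l \<in> U" for l
  proof -
    obtain k where "l = concat (replicate (Suc k) p)" using h unfolding U_def by blast
    then show ?thesis using persistent_concat[of "replicate (Suc k) p"] p by auto
  qed
  assume "locally_finite L (weight_lattice E w) (wleavitt_component E w)"
  then have c: "lin_subspace L ?c" "vectorspace.fin_dim class_ring (L\<lparr>carrier := ?c\<rparr>)"
    using lattice_zero by (auto simp: locally_finite_def)
  have Sc: "?S \<subseteq> ?c"
  proof (intro image_subsetI)
    fix l assume l: "l \<in> U"
    have "word_degree (FMon (concat (replicate k p))) = 0" for k
      by (induction k) (simp_all add: word_degree_append deg, simp add: word_degree_def)
    then have "word_degree (FMon l) = 0" using l by (auto simp: U_def simp del: replicate.simps)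
    then show "P.proj (word l) \<in> ?c"
      using component_word[of l] U[OF l] normal_gens[of l] by (simp add: persistent_def)
  qed
  have "\<not> LinearCombinations.module.lin_dep class_ring (L\<lparr>carrier := ?c\<rparr>) ?S"
    using lin_indpt_persistent(1)[of U, OF U] LinearCombinations.module.span_li_not_depend(2)[OF P.A_module Sc] c(1)
    by (simp add: P.A_submodule_iff)
  then have "finite ?S"
    using vectorspace.li_le_dim(1)[OF P.A_submodule_vectorspace[OF c(1)] c(2), of ?S] Sc by simp
  then have "finite U" by (rule finite_imageD[OF _ lin_indpt_persistent(2)[of U, OF U]])
  moreover have "inj (\<lambda>k. concat (replicate (Suc k) p))"
  proof (rule injI)
    fix i j assume "concat (replicate (Suc i) p) = concat (replicate (Suc j) p)"
    then have "length (concat (replicate (Suc i) p)) = length (concat (replicate (Suc j) p))" by simp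
    then have "Suc i * length p = Suc j * length p"
      by (simp only: length_concat map_replicate sum_list_replicate) simp
    then show "i = j" using p_Cons by simp
  qed
  ultimately show False unfolding U_def using range_inj_infinite by blast
qed

end

section \<open>Exponential growth and the Gelfand-Kirillov dimension\<close>

lemma limsup_log_exponential:
  fixes d :: "nat \<Rightarrow> nat"
  assumes "\<And>n. 2 ^ n \<le> d n"
  shows "limsup (\<lambda>n. ereal (log (real n) (real (d n)))) = \<infinity>"
proof (rule ereal_top)
  fix c :: real
  \<comment> \<open>This quotient is the logarithm of 2^n to the base n.\<close>
  have "filterlim (\<lambda>n. real n * ln 2 / ln (real n)) at_top at_top" by real_asymp
  then have "eventually (\<lambda>n. c \<le> real n * ln 2 / ln (real n)) at_top"
    by (simp add: filterlim_at_top)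
  then have "eventually (\<lambda>n. ereal c \<le> ereal (log (real n) (real (d n)))) at_top"
    using eventually_ge_at_top[of 2]
  proof eventually_elim
    case (elim n)
    have "(2::real) ^ n \<le> real (d n)"
      using assms[of n] by (metis of_nat_le_iff of_nat_numeral of_nat_power)
    then have "log (real n) (2 ^ n) \<le> log (real n) (real (d n))"
      using elim(2) by (intro log_mono) auto
    moreover have "log (real n) (2 ^ n) = real n * ln 2 / ln (real n)"
      by (simp add: log_def ln_realpow)
    ultimately show ?case using elim(1) by simp
  qed
  then show "ereal c \<le> limsup (\<lambda>n. ereal (log (real n) (real (d n))))"
    by (intro le_Limsup) auto
qed

context free_pair begin

lemma concat_pq_inj:
  assumes "length xs = length ys" "set xs \<subseteq> {p, q}" "set ys \<subseteq> {p, q}" "concat xs = concat ys"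
  shows "xs = ys"
  using assms
proof (induction xs ys rule: list_induct2)
  case (Cons x xs y ys)
  have "length x = length y" using Cons(3,4) len by auto
  then have "x = y" "concat xs = concat ys" using Cons(5) by (simp_all add: append_eq_append_conv)
  then show ?case using Cons by simp
qed simp

text \<open>\<open>M\<close> prescribes the number of factors: {1} gives the generators, {n} an
  independent family, {..n} the power spaces and UNIV the free subalgebra. Since M may contain 0,
  the condition \<open>ys \<noteq> []\<close> keeps out the empty word.\<close>

definition products :: "nat set \<Rightarrow> ('v, 'e) wleavitt_gen list set" where
  "products M = {concat ys | ys. set ys \<subseteq> {p, q} \<and> ys \<noteq> [] \<and> length ys \<in> M}"

lemma products_persistent: "l \<in> products M \<Longrightarrow> persistent l"
  using p q by (auto simp: products_def intro!: persistent_concat)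

lemma products_gens: "l \<in> products M \<Longrightarrow> l \<noteq> [] \<and> set l \<subseteq> wleavitt_gens E w"
  using products_persistent[of l M] normal_gens[of l] by (auto simp: persistent_def)

lemma products_mono: "M \<subseteq> M' \<Longrightarrow> products M \<subseteq> products M'"
  by (auto simp: products_def)

lemma products_append:
  "a \<in> products M \<Longrightarrow> b \<in> products M' \<Longrightarrow> (\<And>i j. i \<in> M \<Longrightarrow> j \<in> M' \<Longrightarrow> i + j \<in> M'') \<Longrightarrow>
    a @ b \<in> products M''"
proof -
  assume h: "a \<in> products M" "b \<in> products M'" "\<And>i j. i \<in> M \<Longrightarrow> j \<in> M' \<Longrightarrow> i + j \<in> M''"
  obtain xs ys where "a = concat xs" "set xs \<subseteq> {p, q}" "xs \<noteq> []" "length xs \<in> M"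
    "b = concat ys" "set ys \<subseteq> {p, q}" "length ys \<in> M'"
    using h(1,2) unfolding products_def by blast
  then have "a @ b = concat (xs @ ys)" "set (xs @ ys) \<subseteq> {p, q}" "xs @ ys \<noteq> []" "length (xs @ ys) \<in> M''"
    using h(3) by simp_all
  then show ?thesis unfolding products_def by blast
qed

lemma finite_products: "finite (products {..n})"
proof -
  have "products {..n} \<subseteq> concat ` {ys. set ys \<subseteq> {p, q} \<and> length ys \<le> n}"
    by (auto simp: products_def)
  then show ?thesis by (rule finite_subset) (intro finite_imageI finite_lists_length_le, simp)
qed

lemma word_space_products_C: "\<forall>u\<in>Poly_Mapping.keys f. letters u \<in> products M \<Longrightarrow> f \<in> P.C"
  using products_gens by (auto simp: free_carrier)

lemma word_space_mult:
  assumes "x \<in> P.word_space (products M)" "y \<in> P.word_space (products M')"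
    "\<And>i j. i \<in> M \<Longrightarrow> j \<in> M' \<Longrightarrow> i + j \<in> M''"
  shows "x \<otimes>\<^bsub>L\<^esub> y \<in> P.word_space (products M'')"
proof -
  obtain f g where fg: "x = P.proj f" "y = P.proj g" "\<forall>u\<in>Poly_Mapping.keys f. letters u \<in> products M"
    "\<forall>u\<in>Poly_Mapping.keys g. letters u \<in> products M'"
    using assms(1,2) unfolding P.word_space_def by blast
  have "letters u \<in> products M''" if h: "u \<in> Poly_Mapping.keys (f * g)" for u
  proof -
    obtain a b where "u = a + b" "a \<in> Poly_Mapping.keys f" "b \<in> Poly_Mapping.keys g"
      using h keys_mult[of f g] by blast
    then show ?thesis using products_append[of "letters a" M "letters b" M' M''] fg assms(3)
      by (simp add: plus_fmon_def)
  qed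
  then have "P.proj (f * g) \<in> P.word_space (products M'')" unfolding P.word_space_def by blast
  then show ?thesis using fg word_space_products_C by (simp add: P.A_mult)
qed

abbreviation B where "B \<equiv> P.word_space (products UNIV)"
abbreviation gen_space where "gen_space \<equiv> P.word_space (products {1})"

lemma products_subspace: "lin_subspace L (P.word_space (products M))"
  by (rule P.word_space_subspace) (rule products_gens)

lemma word_space_products_mono: "M \<subseteq> M' \<Longrightarrow> P.word_space (products M) \<subseteq> P.word_space (products M')"
  using products_mono unfolding P.word_space_def by blast

lemma B_subalgebra: "subalgebra L B"
  unfolding subalgebra_def using products_subspace word_space_mult[of _ UNIV _ UNIV UNIV] by blast

lemma list_prod_restrict: "list_prod (A'\<lparr>carrier := D\<rparr>) xs = list_prod A' xs"
  by (induction A' xs rule: list_prod.induct) simp_all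

lemma list_prod_words:
  assumes "ys \<noteq> []" "set ys \<subseteq> {p, q}"
  shows "list_prod L (map (\<lambda>l. P.proj (word l)) ys) = P.proj (word (concat ys))"
  using assms
proof (induction ys rule: list_nonempty_induct)
  case (cons y ys)
  obtain z zs where z: "ys = z # zs" using cons(1) by (cases ys) auto
  have "persistent y" "persistent (concat ys)"
    using cons p q by (auto intro!: persistent_concat)
  then have "word y \<in> P.C" "word (concat ys) \<in> P.C" by (simp_all add: persistent_C)
  then have "P.proj (word y) \<otimes>\<^bsub>L\<^esub> P.proj (word (concat ys)) = P.proj (word (y @ concat ys))"
    by (simp add: P.A_mult word_append)
  then show ?case using cons by (simp add: z)
qed simp

lemma list_prod_word_space:
  "xs \<noteq> [] \<Longrightarrow> set xs \<subseteq> gen_space \<Longrightarrow> list_prod L xs \<in> P.word_space (products {length xs})"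
proof (induction L xs rule: list_prod.induct)
  case (3 x y xs)
  then show ?case
    using word_space_mult[of x "{1}" "list_prod L (y # xs)" "{length (y # xs)}" "{length (x # y # xs)}"]
    by simp
qed (simp_all add: One_nat_def)

text \<open>\<open>power_space\<close> multiplies arbitrary elements of the generating space and not
  only \<open>p\<close> and \<open>q\<close>; \<open>list_prod_word_space\<close> expands such
  products into words.\<close>

lemma power_space_eq:
  assumes "1 \<le> n"
  shows "power_space (L\<lparr>carrier := B\<rparr>) gen_space n = P.word_space (products {..n})"
proof -
  let ?S = "{list_prod L xs | xs. set xs \<subseteq> gen_space \<and> 1 \<le> length xs \<and> length xs \<le> n}"
  have Sn: "?S \<subseteq> P.word_space (products {..n})"
  proof
    fix x assume "x \<in> ?S"
    then obtain xs where xs: "x = list_prod L xs" "set xs \<subseteq> gen_space" "1 \<le> length xs" "length xs \<le> n"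
      by blast
    then have "xs \<noteq> []" by auto
    then have "x \<in> P.word_space (products {length xs})" using list_prod_word_space xs by blast
    then show "x \<in> P.word_space (products {..n})"
      using word_space_products_mono[of "{length xs}" "{..n}"] xs(4) by blast
  qed
  then have SB: "?S \<subseteq> B" using word_space_products_mono[of "{..n}" UNIV] by blast
  have "power_space (L\<lparr>carrier := B\<rparr>) gen_space n = LinearCombinations.module.span class_ring L ?S"
    unfolding power_space_def list_prod_restrict
    using LinearCombinations.module.span_li_not_depend(1)[OF P.A_module SB] products_subspace
    by (simp add: P.A_submodule_iff)
  also have "\<dots> = P.word_space (products {..n})"
  proof
    show "LinearCombinations.module.span class_ring L ?S \<subseteq> P.word_space (products {..n})"
      using Sn products_subspace
      by (intro LinearCombinations.module.span_is_subset[OF P.A_module]) (simp_all add: P.A_submodule_iff)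
    have "(\<lambda>l. P.proj (word l)) ` products {..n} \<subseteq> ?S"
    proof (intro image_subsetI)
      fix l assume "l \<in> products {..n}"
      then obtain ys where ys: "l = concat ys" "set ys \<subseteq> {p, q}" "ys \<noteq> []" "length ys \<le> n"
        unfolding products_def by auto
      have "r \<in> products {1}" if "r \<in> {p, q}" for r
        unfolding products_def using that by (intro CollectI exI[of _ "[r]"]) simp
      then have "set (map (\<lambda>l. P.proj (word l)) ys) \<subseteq> gen_space"
        using ys(2) P.proj_word_in_word_space by auto
      moreover have "P.proj (word l) = list_prod L (map (\<lambda>l. P.proj (word l)) ys)"
        using list_prod_words[OF ys(3,2)] ys(1) by simp
      moreover have "1 \<le> length ys" using ys(3) by (cases ys) auto
      ultimately show "P.proj (word l) \<in> ?S"
        using ys(4) by (intro CollectI exI[of _ "map (\<lambda>l. P.proj (word l)) ys"]) simp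
    qed
    from LinearCombinations.module.span_is_monotone[OF P.A_module this]
    show "P.word_space (products {..n}) \<subseteq> LinearCombinations.module.span class_ring L ?S"
      by (simp only: P.span_words[OF products_gens])
  qed
  finally show ?thesis .
qed

text \<open>The products with exactly \<open>n\<close> factors already give 2^n independent
  elements.\<close>

lemma dim_power_space:
  assumes "1 \<le> n"
  shows "2 ^ n \<le> vectorspace.dim class_ring (L\<lparr>carrier := P.word_space (products {..n})\<rparr>)"
proof -
  let ?W = "P.word_space (products {..n})"
  let ?Y = "{ys. set ys \<subseteq> {p, q} \<and> length ys = n}"
  let ?S = "(\<lambda>l. P.proj (word l)) ` products {n}"
  have Y: "products {n} = concat ` ?Y" using assms by (auto simp: products_def)
  have "inj_on concat ?Y" by (rule inj_onI) (use concat_pq_inj in auto)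
  then have "card (products {n}) = card {p, q} ^ n"
    unfolding Y by (simp only: card_image card_lists_length_eq finite.intros)
  also have "card {p, q} = 2" using pq by simp
  finally have c: "card ?S = 2 ^ n"
    using card_image[OF lin_indpt_persistent(2)[of "products {n}", OF products_persistent]] by simp
  have SW: "?S \<subseteq> ?W"
    using products_mono[of "{n}" "{..n}"] P.proj_word_in_word_space by blast
  have "\<not> LinearCombinations.module.lin_dep class_ring (L\<lparr>carrier := ?W\<rparr>) ?S"
    using lin_indpt_persistent(1)[of "products {n}", OF products_persistent]
      LinearCombinations.module.span_li_not_depend(2)[OF P.A_module SW] products_subspace
    by (simp add: P.A_submodule_iff)
  moreover have "vectorspace.fin_dim class_ring (L\<lparr>carrier := ?W\<rparr>)"
    by (rule P.word_space_fin_dim) (use products_gens finite_products in auto)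
  ultimately have "card ?S \<le> vectorspace.dim class_ring (L\<lparr>carrier := ?W\<rparr>)"
    using vectorspace.li_le_dim(2)[OF P.A_submodule_vectorspace[OF products_subspace], of "{..n}" ?S] SW
    by simp
  with c show ?thesis by simp
qed

lemma generating_gen_space: "generating_subspace (L\<lparr>carrier := B\<rparr>) gen_space"
  unfolding generating_subspace_def
proof (intro conjI)
  show "lin_subspace (L\<lparr>carrier := B\<rparr>) gen_space"
    using P.subspace_restrict[OF products_subspace] products_subspace word_space_products_mono[of "{1}" UNIV]
    by simp
  have "finite (products {1})"
    using finite_products[of 1] products_mono[of "{1}" "{..1}"] by (auto intro: finite_subset)
  then show "vectorspace.fin_dim class_ring (L\<lparr>carrier := B, carrier := gen_space\<rparr>)"
    using P.word_space_fin_dim[OF products_gens] by simp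
  have BB: "subalgebra (L\<lparr>carrier := B\<rparr>) B"
    using B_subalgebra P.subspace_restrict[OF products_subspace] by (simp add: subalgebra_def)
  have least: "B \<subseteq> D" if D: "subalgebra (L\<lparr>carrier := B\<rparr>) D" "gen_space \<subseteq> D" for D
  proof -
    have sub: "lin_subspace L D" and mult: "\<And>x y. x \<in> D \<Longrightarrow> y \<in> D \<Longrightarrow> x \<otimes>\<^bsub>L\<^esub> y \<in> D"
      using D(1) P.subspace_restrict[OF products_subspace] by (simp_all add: subalgebra_def)
    have pD: "P.proj (word r) \<in> D" if "r \<in> {p, q}" for r
    proof -
      have "r \<in> products {1}"
        unfolding products_def using that by (intro CollectI exI[of _ "[r]"]) simp
      then show ?thesis using D(2) P.proj_word_in_word_space by blast
    qed
    have "list_prod L (map (\<lambda>l. P.proj (word l)) ys) \<in> D" if "ys \<noteq> []" "set ys \<subseteq> {p, q}" for ys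
      using that
    proof (induction ys rule: list_nonempty_induct)
      case (cons y ys)
      obtain z zs where "ys = z # zs" using cons(1) by (cases ys) auto
      then show ?case using cons pD[of y] mult by simp
    qed (use pD in simp)
    then have "(\<lambda>l. P.proj (word l)) ` products UNIV \<subseteq> D"
      unfolding products_def using list_prod_words by auto
    then have "LinearCombinations.module.span class_ring L ((\<lambda>l. P.proj (word l)) ` products UNIV) \<subseteq> D"
      using sub by (intro LinearCombinations.module.span_is_subset[OF P.A_module]) (simp_all add: P.A_submodule_iff)
    then show ?thesis by (simp only: P.span_words[OF products_gens])
  qed
  show "subalgebra_generated (L\<lparr>carrier := B\<rparr>) gen_space = carrier (L\<lparr>carrier := B\<rparr>)"
  proof -
    have "B \<in> {D. subalgebra (L\<lparr>carrier := B\<rparr>) D \<and> gen_space \<subseteq> D}"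
      using BB word_space_products_mono[of "{1}" UNIV] by simp
    then show ?thesis
      unfolding subalgebra_generated_def using least by (simp add: set_eq_iff) blast
  qed
qed

lemma gk_dim_infinite: "gk_dim L = \<infinity>"
proof -
  define d where "d n = vectorspace.dim class_ring
      (L\<lparr>carrier := power_space (L\<lparr>carrier := B\<rparr>) gen_space n\<rparr>)" for n
  have d: "2 ^ n \<le> d n" if "1 \<le> n" for n
    using dim_power_space[OF that] by (simp add: d_def power_space_eq[OF that])
  \<comment> \<open>The bound on \<open>d\<close> starts at n = 1, while
    \<open>limsup_log_exponential\<close> asks for it at every n; passing to the maximum does not
    change the limit superior.\<close>
  have "eventually (\<lambda>n. ereal (log (real n) (real (d n))) =
      ereal (log (real n) (real (max (2 ^ n) (d n))))) sequentially"
    by (rule eventually_mono[OF eventually_ge_at_top[of 1]]) (use d in \<open>simp add: max_absorb2\<close>)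
  then have "limsup (\<lambda>n. ereal (log (real n) (real (d n)))) =
      limsup (\<lambda>n. ereal (log (real n) (real (max (2 ^ n) (d n)))))"
    by (rule Limsup_eq)
  also have "\<dots> = \<infinity>" by (rule limsup_log_exponential) simp
  finally have g: "gk_growth (L\<lparr>carrier := B\<rparr>) gen_space = \<infinity>"
    by (simp add: gk_growth_def d_def)
  have "B \<noteq> {\<zero>\<^bsub>L\<^esub>}"
  proof
    assume B: "B = {\<zero>\<^bsub>L\<^esub>}"
    have "p \<in> products UNIV" unfolding products_def by (intro CollectI exI[of _ "[p]"]) simp
    then have "P.proj (word p) \<in> B" by (rule P.proj_word_in_word_space)
    then have "T (P.proj (word p)) = T (P.proj 0)" using B by (simp add: P.A_zero)
    then show False using T_persistent[OF p] by (simp add: T_proj)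
  qed
  then have "gk_growth (L\<lparr>carrier := B\<rparr>) gen_space \<le> gk_dim_fg (L\<lparr>carrier := B\<rparr>)"
    unfolding gk_dim_fg_def using generating_gen_space by (simp add: SUP_upper)
  also have "\<dots> \<le> gk_dim L"
    unfolding gk_dim_def using B_subalgebra generating_gen_space by (intro SUP_upper) auto
  finally show ?thesis using g by simp
qed

end

section \<open>Free pairs from a violation of the condition on R\<close>

context normal_forms begin

definition link :: "('v, 'e) wleavitt_gen \<Rightarrow> ('v, 'e) wleavitt_gen \<Rightarrow> bool" where
  "link x y \<longleftrightarrow> ltgt x = lsrc y \<and> \<not> redex x y"

text \<open>Normality concerns neighbouring letters only, so words can be glued from pieces by
  inspecting the seams.\<close>

lemma normal_iff:
  "normal l \<longleftrightarrow> (\<forall>x\<in>set l. letter x) \<and> successively link l \<and> (l \<noteq> [] \<longrightarrow> ltgt (last l) = s)"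
proof (induction l)
  case (Cons x l)
  then show ?case by (cases l) (auto simp: link_def)
qed simp

lemma persistentI:
  assumes "l \<noteq> []" "\<And>x. x \<in> set l \<Longrightarrow> letter x" "successively link l"
    "hd l = WEdge e 2" "last l = WGhost f 2" "tail E e = s" "tail E f = s"
  shows "persistent l"
proof -
  have "normal l" unfolding normal_iff using assms by simp
  moreover have "wsrc l = s" using assms(1,4,6) by (cases l) auto
  ultimately show ?thesis using assms by (simp add: persistent_def)
qed

text \<open>Only the first edge of the path is known to be heavy, so it carries the index 2 that
  persistence asks for; the index 1 is available on all edges.\<close>

definition up :: "'e list \<Rightarrow> ('v, 'e) wleavitt_gen list" where
  "up es = WEdge (hd es) 2 # map (\<lambda>e. WEdge e 1) (tl es)"

text \<open>The way back along the path. The free index \<open>j\<close> at its end is where the two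
  words of a pair will differ.\<close>

definition down :: "nat \<Rightarrow> 'e list \<Rightarrow> ('v, 'e) wleavitt_gen list" where
  "down j es = map (\<lambda>e. WGhost e 1) (rev (tl es)) @ [WGhost (hd es) j]"

definition path_list :: "'e list \<Rightarrow> bool" where
  "path_list es \<longleftrightarrow> es \<noteq> [] \<and> hd es \<in> heavy \<and> set es \<subseteq> arcs E \<and> successively (\<lambda>e f. head E e = tail E f) es"

lemma up_props:
  assumes "path_list es"
  shows "\<And>x. x \<in> set (up es) \<Longrightarrow> letter x" "successively link (up es)" "up es \<noteq> []"
    "hd (up es) = WEdge (hd es) 2" "\<exists>i. last (up es) = WEdge (last es) i"
proof -
  obtain e fs where es: "es = e # fs" using assms by (cases es) (auto simp: path_list_def)
  have e: "e \<in> arcs E" "2 \<le> w e" using assms by (auto simp: es path_list_def heavy_def)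
  show "up es \<noteq> []" "hd (up es) = WEdge (hd es) 2" by (simp_all add: up_def)
  have fs: "set fs \<subseteq> arcs E" "successively (\<lambda>e f. head E e = tail E f) (e # fs)"
    using assms by (auto simp: es path_list_def)
  show "letter x" if "x \<in> set (up es)" for x
    using that e fs w_ge_1 by (auto simp: up_def es)
  have "successively link (WEdge e i # map (\<lambda>e. WEdge e 1) fs)" for i
    using fs(2) by (induction fs arbitrary: e i) (auto simp: link_def)
  then show "successively link (up es)" by (simp add: up_def es)
  show "\<exists>i. last (up es) = WEdge (last es) i"
    by (cases fs) (auto simp: up_def es last_map)
qed

lemma down_props:
  assumes "path_list es" "1 \<le> j" "j \<le> 2"
  shows "\<And>x. x \<in> set (down j es) \<Longrightarrow> letter x" "successively link (down j es)" "down j es \<noteq> []"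
    "last (down j es) = WGhost (hd es) j" "\<exists>i. hd (down j es) = WGhost (last es) i"
proof -
  obtain e fs where es: "es = e # fs" using assms by (cases es) (auto simp: path_list_def)
  have e: "e \<in> arcs E" "2 \<le> w e" using assms by (auto simp: es path_list_def heavy_def)
  show "down j es \<noteq> []" "last (down j es) = WGhost (hd es) j" by (simp_all add: down_def)
  have fs: "set fs \<subseteq> arcs E" "successively (\<lambda>e f. head E e = tail E f) (e # fs)"
    using assms by (auto simp: es path_list_def)
  show "letter x" if "x \<in> set (down j es)" for x
    using that e fs w_ge_1 assms(2,3) by (auto simp: down_def es)
  have "successively link (map (\<lambda>e. WGhost e 1) (rev fs) @ [WGhost e i])" for i
    using fs(2)
  proof (induction fs arbitrary: e i)
    case (Cons f fs)
    have "successively link (map (\<lambda>e. WGhost e 1) (rev fs) @ [WGhost f 1])"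
      using Cons by (cases fs) auto
    moreover have "link (WGhost f 1) (WGhost e i)" using Cons(2) by (simp add: link_def)
    ultimately have "successively link ((map (\<lambda>e. WGhost e 1) (rev fs) @ [WGhost f 1]) @ [WGhost e i])"
      by (subst successively_append_iff) simp
    then show ?case by simp
  qed simp
  then show "successively link (down j es)" by (simp add: down_def es)
  show "\<exists>i. hd (down j es) = WGhost (last es) i"
  proof (cases fs rule: rev_cases)
    case (snoc ys y)
    then show ?thesis by (simp add: down_def es)
  qed (simp add: down_def es)
qed

lemma degree_up_down: "word_degree (FMon (up es)) + word_degree (FMon (down 2 es)) = 0"
proof -
  have "sum_list (map gen_degree (map (\<lambda>e. WEdge e 1) fs)) +
      sum_list (map gen_degree (map (\<lambda>e. WGhost e 1) (rev fs))) = 0" for fs :: "'e list"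
    by (induction fs) (simp_all add: algebra_simps)
  from this[of "tl es"] show ?thesis
    by (simp add: word_degree_def up_def down_def algebra_simps)
qed

lemma down_neq: "down 1 es \<noteq> down 2 es"
  by (simp add: down_def)

lemma length_down: "length (down i es) = length (down j es)"
  by (simp add: down_def)

lemma free_pairI:
  assumes "persistent p" "persistent q" "p \<noteq> q" "length p = length q" "word_degree (FMon p) = 0"
  shows "free_pair E w s p q"
  by unfold_locales (use assms in auto)

text \<open>Going up the path and back down, the turn at the last edge is no redex since this edge
  is not special. The word \<open>m 1\<close> ends with index 1 and so is not persistent; appending
  \<open>m 2\<close> to both \<open>m 1\<close> and \<open>m 2\<close> repairs this. The seam is no
  redex because \<open>m 2\<close> starts with index 2.\<close>

lemma not_special_pair:
  assumes "path_list es" "tail E (hd es) = s" "\<not> special (last es)"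
  shows "\<exists>p q. free_pair E w s p q"
proof -
  define m where "m j = up es @ down j es" for j
  note u = up_props[OF assms(1)]
  obtain i where i: "last (up es) = WEdge (last es) i" using u(5) by blast
  have m: "(\<forall>x\<in>set (m j). letter x) \<and> successively link (m j) \<and> m j \<noteq> [] \<and>
      hd (m j) = WEdge (hd es) 2 \<and> last (m j) = WGhost (hd es) j" if j: "1 \<le> j" "j \<le> 2" for j
  proof -
    note d = down_props[OF assms(1) j]
    obtain k where k: "hd (down j es) = WGhost (last es) k" using d(5) by blast
    have "link (last (up es)) (hd (down j es))" using assms(3) unfolding i k by (simp add: link_def)
    then have "successively link (m j)"
      unfolding m_def successively_append_iff using u(2) d(2) by simp
    then show ?thesis using u(1,3,4) d(1,3,4) by (auto simp: m_def)
  qed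
  have mm: "persistent (m j @ m 2)" if j: "1 \<le> j" "j \<le> 2" for j
  proof -
    note mj = m[OF j] and m2 = m[of 2]
    have "link (last (m j)) (hd (m 2))" using mj m2 by (simp add: link_def)
    then have "successively link (m j @ m 2)"
      unfolding successively_append_iff using mj m2 by simp
    moreover have "hd (m j @ m 2) = WEdge (hd es) 2" "last (m j @ m 2) = WGhost (hd es) 2"
      using mj m2 by simp_all
    moreover have "letter x" if "x \<in> set (m j @ m 2)" for x using that mj m2 by auto
    ultimately show ?thesis using mj assms(2) by (intro persistentI[of "m j @ m 2"]) auto
  qed
  have "m 2 @ m 2 \<noteq> m 1 @ m 2" using down_neq[of es] by (simp add: m_def)
  moreover have "length (m 2 @ m 2) = length (m 1 @ m 2)" using length_down[of 1 es 2] by (simp add: m_def)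
  moreover have "word_degree (FMon (m 2)) = 0"
    using degree_up_down[of es] by (simp only: m_def word_degree_append)
  ultimately show ?thesis
    using free_pairI[OF mm[of 2] mm[of 1]] by (simp add: word_degree_append) blast
qed

text \<open>Each turn leads from the last edge of one path to the ghost of the last edge of the
  other. These edges differ, so the turn is no redex even if both are special. The index
  \<open>j\<close> sits inside the word, in front of an edge of index 2.\<close>

lemma merging_pair:
  assumes "path_list es" "path_list fs" "last es \<noteq> last fs" "head E (last es) = head E (last fs)"
    "tail E (hd es) = s"
  shows "\<exists>p q. free_pair E w s p q"
proof -
  define m where "m j = up es @ down j fs @ up fs @ down 2 es" for j
  note ue = up_props[OF assms(1)] and uf = up_props[OF assms(2)]
  obtain i k where ik: "last (up es) = WEdge (last es) i" "last (up fs) = WEdge (last fs) k"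
    using ue(5) uf(5) by blast
  have m: "persistent (m j)" if j: "1 \<le> j" "j \<le> 2" for j
  proof -
    note dj = down_props[OF assms(2) j] and d2 = down_props[OF assms(1), of 2]
    obtain i' k' where ik': "hd (down 2 es) = WGhost (last es) i'" "hd (down j fs) = WGhost (last fs) k'"
      using d2(5) dj(5) by auto
    have "link (last (up fs)) (hd (down 2 es))" "link (last (up es)) (hd (down j fs))"
      "link (last (down j fs)) (hd (up fs))"
      unfolding ik ik' dj(4) uf(4) using assms(3,4) by (simp_all add: link_def)
    then have "successively link (m j)"
      unfolding m_def successively_append_iff using ue(2,3) uf(2,3) d2(2,3) dj(2,3)
      by simp
    moreover have "m j \<noteq> []" "hd (m j) = WEdge (hd es) 2" "last (m j) = WGhost (hd es) 2"
      using ue(3,4) d2(3,4) by (simp_all add: m_def)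
    moreover have "letter x" if "x \<in> set (m j)" for x
      using that ue(1) uf(1) d2(1) dj(1) by (auto simp: m_def)
    ultimately show ?thesis using assms(5) by (intro persistentI[of "m j"]) auto
  qed
  have "m 2 \<noteq> m 1" using down_neq[of fs] length_down[of 1 fs 2] by (auto simp: m_def)
  moreover have "length (m 2) = length (m 1)" using length_down[of 1 fs 2] by (simp add: m_def)
  moreover have "word_degree (FMon (m 2)) = 0"
  proof -
    have "word_degree (FMon (m 2)) =
        (word_degree (FMon (up es)) + word_degree (FMon (down 2 es))) +
        (word_degree (FMon (up fs)) + word_degree (FMon (down 2 fs)))"
      unfolding m_def word_degree_append by (simp only: ac_simps)
    then show ?thesis unfolding degree_up_down by simp
  qed
  ultimately show ?thesis using free_pairI[OF m[of 2] m[of 1]] by auto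
qed

end

context row_finite_weighted begin

lemma below_path:
  assumes "u \<in> below"
  obtains es where "normal_forms.path_list E w es" "head E (last es) = u"
proof -
  \<comment> \<open>The base vertex may be arbitrary here, as \<open>path_list\<close> speaks of the
    graph alone.\<close>
  interpret normal_forms E w K undefined
    by (rule normal_forms.intro) (rule row_finite_weighted_axioms)
  obtain e where e: "e \<in> heavy" "(head E e, u) \<in> {(tail E f, head E f) | f. f \<in> arcs E}\<^sup>*"
    using assms by (auto simp: below_def)
  from e(2) have "\<exists>es. path_list es \<and> head E (last es) = u"
  proof (induction rule: rtrancl_induct)
    case base
    have "path_list [e]" using e(1) by (simp add: path_list_def heavy_def)
    then show ?case by (intro exI[of _ "[e]"]) simp
  next
    case (step y z)
    then obtain es f where "path_list es" "head E (last es) = y" "f \<in> arcs E" "tail E f = y" "head E f = z"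
      by auto
    then have "path_list (es @ [f])" "head E (last (es @ [f])) = z"
      by (simp_all add: path_list_def successively_append_iff)
    then show ?case by blast
  qed
  then show ?thesis using that by blast
qed

text \<open>Two edges with the same source are not both special, which supplies the turning point in
  the first two cases; in the third, two paths that start with heavy edges merge. The base vertex is
  the source of the first edge of a path.\<close>

lemma not_good_pair:
  assumes "\<not> good"
  shows "\<exists>s p q. free_pair E w s p q"
proof -
  have nf: "normal_forms E w" by (rule normal_forms.intro) (rule row_finite_weighted_axioms)
  note path = normal_forms.path_list_def[OF nf]
  have not_special: "\<exists>e'\<in>{e, f}. \<not> special e'" if "e \<noteq> f" "tail E e = tail E f" for e f
    using special_unique[of e f] that by blast
  consider (heavy) e f where "e \<in> heavy" "f \<in> heavy" "tail E e = tail E f" "e \<noteq> f"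
    | (below) e f where "e \<in> arcs E" "f \<in> arcs E" "tail E e \<in> below" "tail E e = tail E f" "e \<noteq> f"
    | (reversed) e f where "e \<in> reversed" "f \<in> reversed" "head E e = head E f" "e \<noteq> f"
    using assms unfolding good_def inj_on_def by blast
  then show ?thesis
  proof cases
    case heavy
    then obtain g where g: "g \<in> heavy" "\<not> special g" using not_special[of e f] by blast
    then have "normal_forms.path_list E w [g]" by (simp add: path heavy_def)
    from normal_forms.not_special_pair[OF nf this refl] g show ?thesis by auto
  next
    case below
    then obtain g where g: "g \<in> arcs E" "\<not> special g" "tail E g = tail E e"
      using not_special[of e f] by auto
    obtain es where es: "normal_forms.path_list E w es" "head E (last es) = tail E e"
      using below_path[OF below(3)] by blast
    then have "normal_forms.path_list E w (es @ [g])"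
      using g by (simp add: path successively_append_iff)
    from normal_forms.not_special_pair[OF nf this refl] g show ?thesis by auto
  next
    case reversed
    have ex: "\<exists>es. normal_forms.path_list E w es \<and> last es = e" if e: "e \<in> reversed" for e
    proof (cases "e \<in> heavy")
      case True
      then have "normal_forms.path_list E w [e]" by (simp add: path heavy_def)
      then show ?thesis by (intro exI[of _ "[e]"]) simp
    next
      case False
      then have "tail E e \<in> below" "e \<in> arcs E" using e by (simp_all add: reversed_def)
      moreover from this obtain es where es: "normal_forms.path_list E w es" "head E (last es) = tail E e"
        using below_path by blast
      ultimately have "normal_forms.path_list E w (es @ [e])"
        by (simp add: path successively_append_iff)
      then show ?thesis by (intro exI[of _ "es @ [e]"]) simp
    qed
    obtain es fs where "normal_forms.path_list E w es" "last es = e" "normal_forms.path_list E w fs" "last fs = f"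
      using ex[OF reversed(1)] ex[OF reversed(2)] by blast
    with normal_forms.merging_pair[OF nf, of es fs "tail E (hd es)"] reversed(3,4) show ?thesis by auto
  qed
qed

end

theorem theorem39:
  fixes E :: "('v, 'e) pre_digraph"
    and w :: "'e \<Rightarrow> nat"
    and L :: "('k::field, (('v, 'e) wleavitt_gen fmon \<Rightarrow>\<^sub>0 'k) set) module"
  assumes "weighted_digraph E w"
    and "row_finite E"
    and "L = wleavitt_algebra E w"
    and "simple_algebra L
       \<or> graded_simple L (weight_lattice E w) (wleavitt_component E w)
       \<or> locally_finite L (weight_lattice E w) (wleavitt_component E w)
       \<or> noetherian_algebra L
       \<or> artinian_algebra L
       \<or> von_neumann_regular L
       \<or> gk_dim L < \<infinity>"
  shows "\<exists>F :: (('v, 'e) label, ('v, 'e) label) pre_digraph.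
           wf_digraph F \<and> row_finite F \<and> algebra_iso L (leavitt_algebra F)"
proof -
  have W: "row_finite_weighted E w" by (rule row_finite_weighted.intro) (use assms in auto)
  have "row_finite_weighted.good E w"
  proof (rule ccontr)
    assume "\<not> row_finite_weighted.good E w"
    then obtain s p q where "free_pair E w s p q"
      using row_finite_weighted.not_good_pair[OF W] by blast
    then interpret free_pair E w "TYPE('k)" s p q .
    have "L = P.A" by (simp add: assms(3) wleavitt_algebra_def P.A_def)
    then show False
      using assms(4) not_simple not_graded_simple not_locally_finite not_noetherian not_artinian
        not_regular gk_dim_infinite by auto
  qed
  then interpret good_graph E w "TYPE('k)"
    using W by (simp add: good_graph_def good_graph_axioms_def)
  show ?thesis using F_wf F_row_finite good_iso assms(3) by blast
qed

end
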